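(* Let $T^3-AT+B$ be in standard form with function field $\mathcal{F}$, and let $I$ be the index of $y$. If the place at infinity of $\mathbb{F}_q(x)$ is tamely ramified or unramified in $\mathcal{F}$, then the genus of $\mathcal{F}$ is $$g=\frac{3\deg A-2\deg I+\delta_\infty-4}{2},$$ where $\delta_\infty=0$ if $\deg A$ is even and $\delta_\infty=1$ if $\deg A$ is odd.
   Context: $q$ is a power of $3$. $A,B\in\mathbb{F}_q[x]$, $A\neq 0$, and $T^3-AT+B\in\mathbb{F}_q[x,T]$ is absolutely irreducible; $\mathcal{F}=\mathbb{F}_q(x,y)$ with $y^3-Ay+B=0$, and $\mathcal{O}_{\mathcal{F}}$ is the integral closure of $\mathbb{F}_q[x]$ in $\mathcal{F}$. The place at infinity of $\mathbb{F}_q(x)$ is the one with uniformizer $1/x$; it is tamely ramified or unramified in $\mathcal{F}$ if no place of $\mathcal{F}$ above it has ramification index divisible by $3$. The polynomial $T^3-AT+B$ is in standard form if (a) there are no non-constant $Q\in\mathbb{F}_q[x]$ and $i\in\mathbb{F}_q[x]$ with $Q^2\mid A$ and $Q^3\mid i^3-iA+B$, and (b) either $3\nmid\deg B$ and $2\deg B>3\deg A$, or $2\deg B\le 3\deg A$. The index $I\in\mathbb{F}_q[x]$ of $y$ (defined up to a nonzero constant) satisfies $\mathrm{disc}(1,y,y^2)=A^3=I^2\,\mathrm{disc}(\mathcal{F})$, where $\mathrm{disc}(\mathcal{F})$ is the discriminant of an $\mathbb{F}_q[x]$-basis of $\mathcal{O}_{\mathcal{F}}$. *)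

theory Defs
  imports
    "HOL-Analysis.Determinants"
    "HOL-Algebra.Algebraic_Closure_Type"
    "HOL-Library.Poly_Mapping"
begin

text \<open>
  Algebraic function fields over a field of constants \<open>'a\<close> are treated as subfields \<open>F\<close>
  of an arbitrary ambient field \<open>'l\<close>; the constants enter through a map \<open>\<kappa> :: 'a \<Rightarrow> 'l\<close>, and the
  rational function field \<open>'a poly fract\<close> through a homomorphism \<open>\<iota>\<close> into \<open>'l\<close>.
  The rational function field itself is the case \<open>'l = 'a poly fract\<close>, \<open>F = UNIV\<close>.
\<close>

definition field_embedding :: "('k::field \<Rightarrow> 'l::field) \<Rightarrow> bool" where
  "field_embedding \<iota> \<longleftrightarrow> \<iota> 1 = 1 \<and>
     (\<forall>a b. \<iota> (a + b) = \<iota> a + \<iota> b) \<and> (\<forall>a b. \<iota> (a * b) = \<iota> a * \<iota> b)"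

definition is_subfield :: "'l::field set \<Rightarrow> bool" where
  "is_subfield S \<longleftrightarrow> 1 \<in> S \<and> (\<forall>a\<in>S. \<forall>b\<in>S. a - b \<in> S \<and> a * b \<in> S) \<and> (\<forall>a\<in>S. inverse a \<in> S)"

definition adjoin :: "('k::field \<Rightarrow> 'l::field) \<Rightarrow> 'l \<Rightarrow> 'l set" where
  "adjoin \<iota> y = \<Inter>{S. is_subfield S \<and> range \<iota> \<subseteq> S \<and> y \<in> S}"

definition rat_const :: "'a::field \<Rightarrow> 'a poly fract" where
  "rat_const c = to_fract [:c:]"

definition rat_x :: "'a::field poly fract" where
  "rat_x = to_fract [:0, 1:]"


subsection \<open>Places\<close>

text \<open>
  A place is represented by its normalized discrete valuation, trivial on the constants.
  The value at \<open>0\<close> (mathematically \<open>\<infinity>\<close>) and the values outside \<open>F\<close> carry no meaning; they are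
  fixed to be \<open>0\<close>, so that a place corresponds to exactly one function.
\<close>

definition places :: "('a::field \<Rightarrow> 'l::field) \<Rightarrow> 'l set \<Rightarrow> ('l \<Rightarrow> int) set" where
  "places \<kappa> F = {v.
     (\<forall>a\<in>F - {0}. \<forall>b\<in>F - {0}. v (a * b) = v a + v b) \<and>
     (\<forall>a\<in>F - {0}. \<forall>b\<in>F - {0}. a + b \<noteq> 0 \<longrightarrow> min (v a) (v b) \<le> v (a + b)) \<and>
     (\<forall>c. c \<noteq> 0 \<longrightarrow> v (\<kappa> c) = 0) \<and>
     (\<exists>t\<in>F - {0}. v t = 1) \<and>
     (\<forall>z. z \<notin> F - {0} \<longrightarrow> v z = 0)}"

definition valuation_ring :: "'l::field set \<Rightarrow> ('l \<Rightarrow> int) \<Rightarrow> 'l set" where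
  "valuation_ring F v = {z \<in> F. z = 0 \<or> 0 \<le> v z}"

definition place_ideal :: "'l::field set \<Rightarrow> ('l \<Rightarrow> int) \<Rightarrow> 'l set" where
  "place_ideal F v = {z \<in> F. z = 0 \<or> 0 < v z}"

text \<open>
  The degree of a place is the dimension over the constants of the residue class field
  \<open>valuation_ring F v / place_ideal F v\<close>: the size of a set whose residue classes form a basis.
\<close>

definition place_degree :: "('a::field \<Rightarrow> 'l::field) \<Rightarrow> 'l set \<Rightarrow> ('l \<Rightarrow> int) \<Rightarrow> nat" where
  "place_degree \<kappa> F v = (THE n. \<exists>B. finite B \<and> card B = n \<and> B \<subseteq> valuation_ring F v \<and>
     (\<forall>z\<in>valuation_ring F v.
        \<exists>!c. c \<in> B \<rightarrow>\<^sub>E UNIV \<and> z - (\<Sum>b\<in>B. \<kappa> (c b) * b) \<in> place_ideal F v))"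

definition lies_over :: "('k::field \<Rightarrow> 'l::field) \<Rightarrow> ('l \<Rightarrow> int) \<Rightarrow> ('k \<Rightarrow> int) \<Rightarrow> bool" where
  "lies_over \<iota> v w \<longleftrightarrow> (\<forall>f. 0 < w f \<longrightarrow> 0 < v (\<iota> f))"

definition ramification_index :: "('k::field \<Rightarrow> 'l::field) \<Rightarrow> ('l \<Rightarrow> int) \<Rightarrow> ('k \<Rightarrow> int) \<Rightarrow> nat" where
  "ramification_index \<iota> v w = (THE e. 0 < e \<and> (\<forall>f. v (\<iota> f) = int e * w f))"

definition infinite_place :: "'a::field poly fract \<Rightarrow> int" where
  "infinite_place = (THE w. w \<in> places rat_const UNIV \<and> w (1 / rat_x) = 1)"

definition tame_or_unramified_at_infinity ::
    "('a::field poly fract \<Rightarrow> 'l::field) \<Rightarrow> 'l set \<Rightarrow> bool" where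
  "tame_or_unramified_at_infinity \<iota> F \<longleftrightarrow>
     (\<forall>v\<in>places (\<iota> \<circ> rat_const) F. lies_over \<iota> v infinite_place \<longrightarrow>
        \<not> 3 dvd ramification_index \<iota> v infinite_place)"


subsection \<open>Divisors and genus\<close>

definition divisors :: "('a::field \<Rightarrow> 'l::field) \<Rightarrow> 'l set \<Rightarrow> (('l \<Rightarrow> int) \<Rightarrow>\<^sub>0 int) set" where
  "divisors \<kappa> F = {D. Poly_Mapping.keys D \<subseteq> places \<kappa> F}"

definition divisor_degree :: "('a::field \<Rightarrow> 'l::field) \<Rightarrow> 'l set \<Rightarrow> (('l \<Rightarrow> int) \<Rightarrow>\<^sub>0 int) \<Rightarrow> int" where
  "divisor_degree \<kappa> F D =
     (\<Sum>v\<in>Poly_Mapping.keys D. Poly_Mapping.lookup D v * int (place_degree \<kappa> F v))"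

definition riemann_roch_space ::
    "('a::field \<Rightarrow> 'l::field) \<Rightarrow> 'l set \<Rightarrow> (('l \<Rightarrow> int) \<Rightarrow>\<^sub>0 int) \<Rightarrow> 'l set" where
  "riemann_roch_space \<kappa> F D =
     {f \<in> F. f = 0 \<or> (\<forall>v\<in>places \<kappa> F. - Poly_Mapping.lookup D v \<le> v f)}"

text \<open>
  The genus is the maximum of \<open>deg D - \<ell>(D) + 1\<close> over all divisors \<open>D\<close>, the constants being the
  full constant field of \<open>F\<close>.
\<close>

definition genus :: "('a::field \<Rightarrow> 'l::field) \<Rightarrow> 'l set \<Rightarrow> int" where
  "genus \<kappa> F = (GREATEST g. \<exists>D\<in>divisors \<kappa> F. g = divisor_degree \<kappa> F D
     - int (vector_space.dim (\<lambda>c z. \<kappa> c * z) (riemann_roch_space \<kappa> F D)) + 1)"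


subsection \<open>Integral closure, discriminant and index\<close>

definition integral_closure :: "('a::field poly fract \<Rightarrow> 'l::field) \<Rightarrow> 'l set \<Rightarrow> 'l set" where
  "integral_closure \<iota> F = {z \<in> F. \<exists>p :: 'a poly poly.
     lead_coeff p = 1 \<and> poly (map_poly (\<lambda>a. \<iota> (to_fract a)) p) z = 0}"

text \<open>
  The trace of \<open>z\<close> is the trace of multiplication by \<open>z\<close> on the \<open>'k\<close>-vector space \<open>F\<close>,
  read off in an arbitrary basis.
\<close>

definition field_trace :: "('k::field \<Rightarrow> 'l::field) \<Rightarrow> 'l set \<Rightarrow> 'l \<Rightarrow> 'k" where
  "field_trace \<iota> F z = (let s = (\<lambda>c u. \<iota> c * u);
       B = (SOME B. \<not> module.dependent s B \<and> module.span s B = F)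
     in \<Sum>b\<in>B. module.representation s B (z * b) b)"

definition discriminant :: "('k::field \<Rightarrow> 'l::field) \<Rightarrow> 'l set \<Rightarrow> 'l ^ 'n \<Rightarrow> 'k" where
  "discriminant \<iota> F b = det (\<chi> i j. field_trace \<iota> F (b $ i * b $ j))"

definition is_integral_basis ::
    "('a::field poly fract \<Rightarrow> 'l::field) \<Rightarrow> 'l set \<Rightarrow> 'l ^ 'n \<Rightarrow> bool" where
  "is_integral_basis \<iota> F b \<longleftrightarrow> (\<forall>i. b $ i \<in> integral_closure \<iota> F) \<and>
     (\<forall>z\<in>integral_closure \<iota> F. \<exists>!c :: 'a poly ^ 'n. z = (\<Sum>i\<in>UNIV. \<iota> (to_fract (c $ i)) * b $ i))"

text \<open>
  The index is determined only up to a nonzero constant, through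
  \<open>disc(1, y, y\<^sup>2) = I\<^sup>2 disc(F)\<close>, where \<open>disc(F)\<close> is the discriminant of some integral basis.
\<close>

definition is_index :: "('a::field poly fract \<Rightarrow> 'l::field) \<Rightarrow> 'l set \<Rightarrow> 'l \<Rightarrow> 'a poly \<Rightarrow> bool" where
  "is_index \<iota> F y I \<longleftrightarrow> (\<exists>b :: 'l ^ 3. is_integral_basis \<iota> F b \<and>
     discriminant \<iota> F (vector [1, y, y\<^sup>2] :: 'l ^ 3) = (to_fract I)\<^sup>2 * discriminant \<iota> F b)"


subsection \<open>The defining polynomial\<close>

definition cubic :: "'a::field poly \<Rightarrow> 'a poly \<Rightarrow> 'a poly poly" where
  "cubic A B = [:B, - A, 0, 1:]"

definition absolutely_irreducible :: "'a::field poly poly \<Rightarrow> bool" where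
  "absolutely_irreducible p \<longleftrightarrow> irreducible (map_poly (map_poly to_ac) p)"

definition standard_form :: "'a::field poly \<Rightarrow> 'a poly \<Rightarrow> bool" where
  "standard_form A B \<longleftrightarrow>
     \<not> (\<exists>Q i. 0 < degree Q \<and> Q ^ 2 dvd A \<and> Q ^ 3 dvd i ^ 3 - i * A + B) \<and>
     ((\<not> 3 dvd degree B \<and> 2 * degree B > 3 * degree A) \<or> 2 * degree B \<le> 3 * degree A)"

end

theory Submission
  imports Defs
begin

text \<open>
  Let \<open>k\<close> be the field of constants and \<open>d = deg A\<close>. The genus is defined as the maximum of
  \<open>deg D - dim L(D) + 1\<close>. Enlarging \<open>D\<close> by a place \<open>P\<close> enlarges \<open>L(D)\<close> by at most \<open>deg P\<close>
  dimensions, so this quantity grows with \<open>D\<close>; every divisor lies, after subtracting the divisor of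
  a polynomial, below a multiple of the pole divisor of \<open>x\<close>; and the degrees involved are under
  control because a function \<open>h\<close> has at most \<open>[F : k(h)]\<close> zeros. Hence the genus can be read off from the dimensions of the spaces
  \<open>L(n (x)\<^sub>\<infinity>)\<close> for large \<open>n\<close>, as soon as they have the form \<open>3 n + 1 - g\<close> (\<open>genus_eqI\<close>); the
  number \<open>g\<close> is then the genus. The bound on the number of zeros is \<open>zero_degree_le\<close>, a
  consequence of weak approximation. Since \<open>k\<close> is finite, dimensions are compared by counting.

  Tameness excludes the first alternative of the normalization at infinity: if
  \<open>2 deg B > 3 deg A\<close> and \<open>3\<close> does not divide \<open>deg B\<close>, then \<open>y\<^sup>3\<close> and \<open>B\<close> have the same value at
  a place above infinity, which makes the ramification index a multiple of \<open>3\<close>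
  (\<open>wildly_ramified_at_infinity\<close>). So \<open>2 deg B \<le> 3 deg A\<close>, and \<open>y\<close> has, relative to \<open>x\<close>, a pole of
  order at most \<open>d / 2\<close> at infinity.

  The point where characteristic \<open>3\<close> helps is the description of \<open>L(n (x)\<^sub>\<infinity>)\<close>. Give \<open>x\<close> the
  weight \<open>1\<close> and \<open>y\<close> the weight \<open>d / 2\<close>, and let \<open>N(a + b y + c y\<^sup>2)\<close> be the largest weight of the
  three terms. Because cubing is additive, \<open>N(f\<^sup>3) = 3 N(f)\<close> (\<open>G_if_cube_in_G\<close>), while the powers of
  an element integral at infinity have bounded weight; so such an element has
  \<open>N(f) \<le> 0\<close>, and conversely. An element that is not integral has a pole at some place
  (\<open>pole_of_non_integral\<close>, by Chevalley's extension argument together with the finiteness of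
  \<open>[F : k(h)]\<close>). Therefore \<open>L(n (x)\<^sub>\<infinity>)\<close> consists of the integral elements \<open>f\<close> with
  \<open>N(f) \<le> n\<close> (\<open>Lsp_pole_multiple\<close>).

  These are counted in a triangular basis \<open>1 / d\<^sub>0\<close>, \<open>u\<^sub>1 + y / d\<^sub>1\<close>, \<open>u\<^sub>3 + u\<^sub>2 y + y\<^sup>2 / d\<^sub>2\<close> of the
  integral closure. Its transition matrix to \<open>1, y, y\<^sup>2\<close> has determinant \<open>d\<^sub>0 d\<^sub>1 d\<^sub>2\<close>, so the three
  degrees add up to the degree of the index (\<open>degree_index\<close>), and the count gives the dimension
  \<open>3 n + 3 - d - \<lceil>d / 2\<rceil> + deg I\<close>. Comparison with \<open>3 n + 1 - g\<close> yields
  \<open>g = d + \<lceil>d / 2\<rceil> - 2 - deg I\<close>.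
\<close>

section \<open>Field embeddings and evaluation of polynomials\<close>

lemma card_field_gt_1: "1 < CARD('b::{finite, field})"
proof -
  have "card {0, 1 :: 'b} \<le> CARD('b)"
    by (intro card_mono) auto
  then show ?thesis by simp
qed

locale embedding =
  fixes \<kappa> :: "'k::field \<Rightarrow> 'l::field"
  assumes emb: "field_embedding \<kappa>"
begin

lemma map_one [simp]: "\<kappa> 1 = 1"
  and map_add [simp]: "\<kappa> (a + b) = \<kappa> a + \<kappa> b"
  and map_mult [simp]: "\<kappa> (a * b) = \<kappa> a * \<kappa> b"
  using emb by (auto simp: field_embedding_def)

lemma map_zero [simp]: "\<kappa> 0 = 0"
proof -
  have "\<kappa> 0 + \<kappa> 0 = \<kappa> 0"
    by (metis add_0 map_add)
  then show ?thesis
    by (metis add_cancel_left_left)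
qed

lemma map_minus [simp]: "\<kappa> (- a) = - \<kappa> a"
  using map_add[of a "- a"] by (simp add: eq_neg_iff_add_eq_0 add.commute)

lemma map_diff [simp]: "\<kappa> (a - b) = \<kappa> a - \<kappa> b"
  using map_add[of a "- b"] by simp

lemma map_power [simp]: "\<kappa> (a ^ n) = \<kappa> a ^ n"
  by (induction n) auto

lemma map_sum: "\<kappa> (sum f S) = (\<Sum>s\<in>S. \<kappa> (f s))"
  by (induction S rule: infinite_finite_induct) auto

lemma map_eq_0_iff [simp]: "\<kappa> a = 0 \<longleftrightarrow> a = 0"
proof
  assume "\<kappa> a = 0"
  then show "a = 0"
    using map_mult[of a "inverse a"] by (cases "a = 0") auto
qed simp

lemma map_eq_iff [simp]: "\<kappa> a = \<kappa> b \<longleftrightarrow> a = b"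
  using map_eq_0_iff[of "a - b"] by simp

lemma map_inverse [simp]: "\<kappa> (inverse a) = inverse (\<kappa> a)"
proof (cases "a = 0")
  case False
  then have "\<kappa> a * \<kappa> (inverse a) = 1"
    by (metis map_mult map_one right_inverse)
  then show ?thesis
    by (metis inverse_unique)
qed simp

lemma map_divide [simp]: "\<kappa> (a / b) = \<kappa> a / \<kappa> b"
  by (simp add: divide_inverse)

text \<open>
  The image of \<open>ev h\<close> is the ring \<open>k[h]\<close>; working with polynomials instead leaves open whether \<open>h\<close>
  is transcendental.
\<close>

definition ev :: "'l \<Rightarrow> 'k poly \<Rightarrow> 'l" where
  "ev h p = poly (map_poly \<kappa> p) h"

lemma ev_0 [simp]: "ev h 0 = 0"
  by (simp add: ev_def)

lemma ev_pCons [simp]: "ev h (pCons c p) = \<kappa> c + h * ev h p"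
  by (simp add: ev_def map_poly_pCons)

lemma ev_1 [simp]: "ev h 1 = 1"
  by (simp add: one_pCons)

lemma ev_add [simp]: "ev h (p + q) = ev h p + ev h q"
proof (induction p arbitrary: q)
  case (pCons a p)
  show ?case
    by (cases q) (simp add: pCons.IH distrib_left add.assoc add.left_commute)
qed simp

lemma ev_smult [simp]: "ev h (smult c p) = \<kappa> c * ev h p"
  by (induction p) (auto simp: algebra_simps)

lemma ev_mult [simp]: "ev h (p * q) = ev h p * ev h q"
  by (induction p) (auto simp: algebra_simps)

lemma ev_minus [simp]: "ev h (- p) = - ev h p"
  by (induction p) (auto simp: algebra_simps)

lemma ev_diff [simp]: "ev h (p - q) = ev h p - ev h q"
  using ev_add[of h p "- q"] by simp

lemma ev_power [simp]: "ev h (p ^ n) = ev h p ^ n"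
  by (induction n) auto

end


section \<open>Places\<close>

text \<open>
  Finiteness of \<open>[F : k(h)]\<close> is expressed without forming \<open>k(h)\<close>: denominators can be cleared in
  a linear relation, so independence may be tested with coefficients in \<open>k[h]\<close>. For algebraic
  \<open>h\<close> no nonempty set is independent in this sense and every bound holds.
\<close>

definition independent_over :: "('a::field \<Rightarrow> 'l::field) \<Rightarrow> 'l \<Rightarrow> 'l set \<Rightarrow> bool" where
  "independent_over \<kappa> h U \<longleftrightarrow>
     (\<forall>c. (\<Sum>u\<in>U. poly (map_poly \<kappa> (c u)) h * u) = 0 \<longrightarrow> (\<forall>u\<in>U. c u = 0))"

definition degree_over_le :: "('a::field \<Rightarrow> 'l::field) \<Rightarrow> 'l set \<Rightarrow> 'l \<Rightarrow> nat \<Rightarrow> bool" where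
  "degree_over_le \<kappa> F h c \<longleftrightarrow>
     (\<forall>U. finite U \<longrightarrow> U \<subseteq> F \<longrightarrow> independent_over \<kappa> h U \<longrightarrow> card U \<le> c)"

locale constant_field = embedding \<kappa>
  for \<kappa> :: "'a::field \<Rightarrow> 'l::field" +
  fixes F :: "'l set"
  assumes subfield: "is_subfield F"
    and constants: "range \<kappa> \<subseteq> F"
begin

lemma one_in [simp]: "1 \<in> F"
  and diff_in [simp]: "a \<in> F \<Longrightarrow> b \<in> F \<Longrightarrow> a - b \<in> F"
  and mult_in [simp]: "a \<in> F \<Longrightarrow> b \<in> F \<Longrightarrow> a * b \<in> F"
  and inverse_in [simp]: "a \<in> F \<Longrightarrow> inverse a \<in> F"
  using subfield by (auto simp: is_subfield_def)

lemma zero_in [simp]: "0 \<in> F"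
  using diff_in[of 1 1] by simp

lemma minus_in [simp]: "a \<in> F \<Longrightarrow> - a \<in> F"
  using diff_in[of 0 a] by simp

lemma add_in [simp]: "a \<in> F \<Longrightarrow> b \<in> F \<Longrightarrow> a + b \<in> F"
  using diff_in[of a "- b"] by simp

lemma divide_in [simp]: "a \<in> F \<Longrightarrow> b \<in> F \<Longrightarrow> a / b \<in> F"
  by (simp add: divide_inverse)

lemma power_in [simp]: "a \<in> F \<Longrightarrow> a ^ n \<in> F"
  by (induction n) auto

lemma sum_in: "(\<And>s. s \<in> S \<Longrightarrow> f s \<in> F) \<Longrightarrow> sum f S \<in> F"
  by (induction S rule: infinite_finite_induct) auto

lemma const_in [simp]: "\<kappa> c \<in> F"
  using constants by auto

lemma ev_in [simp]: "h \<in> F \<Longrightarrow> ev h p \<in> F"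
  by (induction p) auto

text \<open>
  Independent families are automatically injective, so the bound for sets applies to them.
\<close>

lemma degree_over_le_family:
  assumes "degree_over_le \<kappa> F h c" "finite J" "u ` J \<subseteq> F"
    and indep: "\<And>\<phi>. (\<Sum>i\<in>J. ev h (\<phi> i) * u i) = 0 \<Longrightarrow> \<forall>i\<in>J. \<phi> i = 0"
  shows "card J \<le> c"
proof -
  have inj: "inj_on u J"
  proof (rule inj_onI, rule ccontr)
    fix i j assume ij: "i \<in> J" "j \<in> J" "u i = u j" "i \<noteq> j"
    let ?\<phi> = "\<lambda>l. if l = i then 1 else if l = j then - 1 else (0 :: 'a poly)"
    have "(\<Sum>l\<in>J. ev h (?\<phi> l) * u l) = (\<Sum>l\<in>{i, j}. ev h (?\<phi> l) * u l)"
      by (rule sum.mono_neutral_right) (use ij \<open>finite J\<close> in auto)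
    also have "\<dots> = 0"
      using ij by simp
    finally have "?\<phi> i = 0"
      using indep[of ?\<phi>] ij(1) by blast
    then show False by simp
  qed
  have "independent_over \<kappa> h (u ` J)"
    unfolding independent_over_def ev_def[symmetric]
  proof (intro allI impI)
    fix \<phi> assume "(\<Sum>w\<in>u ` J. ev h (\<phi> w) * w) = 0"
    then have "(\<Sum>i\<in>J. ev h (\<phi> (u i)) * u i) = 0"
      by (simp add: sum.reindex[OF inj])
    then show "\<forall>w\<in>u ` J. \<phi> w = 0"
      using indep[of "\<lambda>i. \<phi> (u i)"] by auto
  qed
  then have "card (u ` J) \<le> c"
    using assms(1-3) by (simp add: degree_over_le_def)
  then show ?thesis
    by (simp add: card_image[OF inj])
qed

text \<open>
  A dependence over \<open>k[h]\<close> may be divided by the largest power of \<open>h\<close> occurring in all its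
  coefficients, so it may be assumed to stay nontrivial modulo \<open>h\<close>.
\<close>

lemma independent_over_if_mod:
  assumes J: "finite J" and h: "h \<noteq> 0"
    and mod: "\<And>\<phi> \<psi>. (\<Sum>i\<in>J. ev h (\<phi> i) * u i) = 0 \<Longrightarrow> (\<And>i. \<phi> i = pCons (coeff (\<phi> i) 0) (\<psi> i))
       \<Longrightarrow> \<forall>i\<in>J. coeff (\<phi> i) 0 = 0"
    and "(\<Sum>i\<in>J. ev h (\<phi> i) * u i) = 0"
  shows "\<forall>i\<in>J. \<phi> i = 0"
proof -
  have "\<forall>i\<in>J. \<phi> i = 0" if "(\<Sum>i\<in>J. ev h (\<phi> i) * u i) = 0" "(\<Sum>i\<in>J. degree (\<phi> i)) \<le> n" for n \<phi>
    using that
  proof (induction n arbitrary: \<phi> rule: less_induct)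
    case (less n)
    define \<psi> where "\<psi> i = (THE p. \<exists>c. \<phi> i = pCons c p)" for i
    have \<psi>: "\<phi> i = pCons (coeff (\<phi> i) 0) (\<psi> i)" for i
      by (cases "\<phi> i") (auto simp: \<psi>_def)
    have 0: "\<forall>i\<in>J. coeff (\<phi> i) 0 = 0"
      by (rule mod[OF less.prems(1) \<psi>])
    then have \<phi>: "\<phi> i = pCons 0 (\<psi> i)" if "i \<in> J" for i
      using \<psi>[of i] that by simp
    have "h * (\<Sum>i\<in>J. ev h (\<psi> i) * u i) = (\<Sum>i\<in>J. ev h (\<phi> i) * u i)"
      by (simp add: \<phi> sum_distrib_left mult.assoc)
    then have eq: "(\<Sum>i\<in>J. ev h (\<psi> i) * u i) = 0"
      using less.prems(1) h by simp
    show ?case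
    proof (cases "\<forall>i\<in>J. \<psi> i = 0")
      case False
      then obtain i where i: "i \<in> J" "\<psi> i \<noteq> 0" by auto
      have "(\<Sum>i\<in>J. degree (\<psi> i)) < (\<Sum>i\<in>J. degree (\<phi> i))"
        using J i by (intro sum_strict_mono_ex1) (auto simp: \<phi>)
      then have "\<forall>i\<in>J. \<psi> i = 0"
        using less.IH[OF _ eq order_refl] less.prems(2) by simp
      then show ?thesis using i by auto
    qed (simp add: \<phi>)
  qed
  then show ?thesis using assms(4) by blast
qed

abbreviation pl :: "('l \<Rightarrow> int) set" where "pl \<equiv> places \<kappa> F"

lemma place_mult: "v \<in> pl \<Longrightarrow> a \<in> F \<Longrightarrow> b \<in> F \<Longrightarrow> a \<noteq> 0 \<Longrightarrow> b \<noteq> 0 \<Longrightarrow> v (a * b) = v a + v b"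
  and place_add: "v \<in> pl \<Longrightarrow> a \<in> F \<Longrightarrow> b \<in> F \<Longrightarrow> a \<noteq> 0 \<Longrightarrow> b \<noteq> 0 \<Longrightarrow> a + b \<noteq> 0 \<Longrightarrow>
     min (v a) (v b) \<le> v (a + b)"
  and place_const: "v \<in> pl \<Longrightarrow> v (\<kappa> c) = 0"
  and place_unif: "v \<in> pl \<Longrightarrow> \<exists>t\<in>F. t \<noteq> 0 \<and> v t = 1"
  and place_outside: "v \<in> pl \<Longrightarrow> z \<notin> F \<Longrightarrow> v z = 0"
  and place_zero: "v \<in> pl \<Longrightarrow> v 0 = 0"
  by (auto simp: places_def) (cases "c = 0"; auto)

lemma place_one [simp]: "v \<in> pl \<Longrightarrow> v 1 = 0"
  using place_mult[of v 1 1] by simp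

lemma place_minus: "v \<in> pl \<Longrightarrow> a \<in> F \<Longrightarrow> v (- a) = v a"
proof (cases "a = 0")
  case False
  assume v: "v \<in> pl" "a \<in> F"
  have "v (- 1) = 0"
    using place_const[OF v(1), of "- 1"] by simp
  then show ?thesis
    using place_mult[OF v(1), of "- 1" a] v False by simp
qed simp

lemma place_inverse: "v \<in> pl \<Longrightarrow> a \<in> F \<Longrightarrow> v (inverse a) = - v a"
  using place_mult[of v a "inverse a"] by (cases "a = 0") (auto simp: place_zero)

lemma place_divide: "v \<in> pl \<Longrightarrow> a \<in> F \<Longrightarrow> b \<in> F \<Longrightarrow> a \<noteq> 0 \<Longrightarrow> b \<noteq> 0 \<Longrightarrow> v (a / b) = v a - v b"
  by (simp add: divide_inverse place_mult place_inverse)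

lemma place_power: "v \<in> pl \<Longrightarrow> a \<in> F \<Longrightarrow> v (a ^ n) = int n * v a"
proof (induction n)
  case (Suc n)
  then show ?case
    by (cases "a = 0") (auto simp: place_mult place_zero algebra_simps)
qed simp

text \<open>Balls absorb the special role of \<open>0\<close>, whose value would be \<open>\<infinity>\<close>.\<close>

definition ball :: "('l \<Rightarrow> int) \<Rightarrow> int \<Rightarrow> 'l set" where
  "ball v n = {z \<in> F. z = 0 \<or> n \<le> v z}"

lemma ball_in_F: "z \<in> ball v n \<Longrightarrow> z \<in> F"
  by (simp add: ball_def)

lemma zero_in_ball [simp]: "0 \<in> ball v n"
  by (simp add: ball_def)

lemma ball_mono: "m \<le> n \<Longrightarrow> z \<in> ball v n \<Longrightarrow> z \<in> ball v m"
  by (auto simp: ball_def)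

lemma ball_add: "v \<in> pl \<Longrightarrow> a \<in> ball v n \<Longrightarrow> b \<in> ball v n \<Longrightarrow> a + b \<in> ball v n"
  using place_add[of v a b] by (fastforce simp: ball_def)

lemma ball_minus: "v \<in> pl \<Longrightarrow> a \<in> ball v n \<Longrightarrow> - a \<in> ball v n"
  by (auto simp: ball_def place_minus)

lemma ball_diff: "v \<in> pl \<Longrightarrow> a \<in> ball v n \<Longrightarrow> b \<in> ball v n \<Longrightarrow> a - b \<in> ball v n"
  using ball_add[of v a n "- b"] ball_minus[of v b n] by simp

lemma ball_add_cancel: "v \<in> pl \<Longrightarrow> a + b \<in> ball v n \<Longrightarrow> b \<in> ball v n \<Longrightarrow> a \<in> ball v n"
  using ball_diff[of v "a + b" n b] by simp

lemma ball_sum: "v \<in> pl \<Longrightarrow> (\<And>s. s \<in> S \<Longrightarrow> f s \<in> ball v n) \<Longrightarrow> sum f S \<in> ball v n"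
  by (induction S rule: infinite_finite_induct) (auto intro: ball_add)

lemma ball_mult: "v \<in> pl \<Longrightarrow> a \<in> ball v m \<Longrightarrow> b \<in> ball v n \<Longrightarrow> a * b \<in> ball v (m + n)"
  by (cases "a = 0 \<or> b = 0") (auto simp: ball_def place_mult)

lemma ball_const: "v \<in> pl \<Longrightarrow> \<kappa> c \<in> ball v 0"
  by (simp add: ball_def place_const)

lemma ball_scale: "v \<in> pl \<Longrightarrow> a \<in> ball v n \<Longrightarrow> \<kappa> c * a \<in> ball v n"
  using ball_mult[OF _ ball_const, of v a n c] by simp

lemma ball_power: "v \<in> pl \<Longrightarrow> a \<in> ball v 0 \<Longrightarrow> a ^ n \<in> ball v 0"
  by (cases "a = 0") (auto simp: ball_def place_power place_zero)

lemma ball_ev: "v \<in> pl \<Longrightarrow> h \<in> ball v 0 \<Longrightarrow> ev h p \<in> ball v 0"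
proof (induction p)
  case (pCons a p)
  then have "h * ev h p \<in> ball v (0 + 0)"
    by (intro ball_mult)
  then show ?case
    using pCons.prems by (auto intro!: ball_add ball_const)
qed simp

lemma ball_cancel:
  "v \<in> pl \<Longrightarrow> a \<in> F \<Longrightarrow> b \<in> F \<Longrightarrow> a \<noteq> 0 \<Longrightarrow> a * b \<in> ball v n \<Longrightarrow> b \<in> ball v (n - v a)"
  by (cases "b = 0") (auto simp: ball_def place_mult)

lemma valuation_ring_eq: "valuation_ring F v = ball v 0"
  and place_ideal_eq: "place_ideal F v = ball v 1"
  by (auto simp: valuation_ring_def place_ideal_def ball_def)

lemma place_add_eq:
  assumes "v \<in> pl" "a \<in> F" "b \<in> F" "a \<noteq> 0" "b \<noteq> 0" "v a < v b"
  shows "a + b \<noteq> 0" "v (a + b) = v a"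
proof -
  show nz: "a + b \<noteq> 0"
    using assms place_minus[of v b] by (auto simp: add_eq_0_iff2)
  have "v a \<le> v (a + b)"
    using place_add[OF assms(1-5) nz] assms(6) by simp
  moreover have "v (a + b) \<le> v a"
  proof (rule ccontr)
    assume *: "\<not> v (a + b) \<le> v a"
    have "a + b \<in> ball v (v a + 1)" "b \<in> ball v (v a + 1)"
      using * assms by (auto simp: ball_def)
    then have "a \<in> ball v (v a + 1)"
      using ball_diff[OF assms(1), of "a + b" _ b] by simp
    then show False using assms by (simp add: ball_def)
  qed
  ultimately show "v (a + b) = v a" by simp
qed

text \<open>
  At a pole of \<open>x\<close> the monomials of a polynomial have distinct values, and the leading one dominates.
\<close>

lemma place_ev_pole:
  assumes v: "v \<in> pl" and x: "x \<in> F" "v x < 0" and "p \<noteq> 0"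
  shows "ev x p \<noteq> 0 \<and> v (ev x p) = int (degree p) * v x"
  using \<open>p \<noteq> 0\<close>
proof (induction p)
  case (pCons a p)
  have x0: "x \<noteq> 0" using x place_zero[OF v] by auto
  show ?case
  proof (cases "p = 0")
    case True
    then show ?thesis using pCons by (simp add: place_const v)
  next
    case False
    then have IH: "ev x p \<noteq> 0" "v (ev x p) = int (degree p) * v x"
      using pCons by auto
    have top: "x * ev x p \<noteq> 0" "v (x * ev x p) = int (Suc (degree p)) * v x"
      using IH x x0 by (auto simp: place_mult v algebra_simps)
    show ?thesis
    proof (cases "a = 0")
      case True
      then show ?thesis using top False by simp
    next
      case a: False
      have "v (x * ev x p) < 0"
        unfolding top(2) using x by (simp add: mult_pos_neg)
      then have "v (x * ev x p) < v (\<kappa> a)" by (simp add: place_const v)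
      then show ?thesis
        using place_add_eq[OF v, of "x * ev x p" "\<kappa> a"] x top a False by (simp add: add.commute)
    qed
  qed
qed simp

end

locale function_field = constant_field \<kappa> F
  for \<kappa> :: "'a::{finite, field} \<Rightarrow> 'l::field" and F +
  assumes finite_degree: "h \<in> F \<Longrightarrow> \<exists>c. degree_over_le \<kappa> F h c"

context function_field
begin

section \<open>Weak approximation\<close>

text \<open>
  Write \<open>z\<close> as a power of a uniformizer \<open>t\<close> of \<open>v\<close> times a unit of \<open>v\<close>; units of \<open>v\<close> are units of
  \<open>w\<close>, so \<open>w\<close> is a multiple of \<open>v\<close>, and both are normalized.
\<close>

lemma place_eqI:
  assumes v: "v \<in> pl" and w: "w \<in> pl"
    and le: "\<And>z. z \<in> F \<Longrightarrow> z \<noteq> 0 \<Longrightarrow> 0 \<le> v z \<Longrightarrow> 0 \<le> w z"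
  shows "v = w"
proof -
  obtain t where t: "t \<in> F" "t \<noteq> 0" "v t = 1"
    using place_unif[OF v] by blast
  have unit: "w z = 0" if "z \<in> F" "z \<noteq> 0" "v z = 0" for z
    using le[of z] le[of "inverse z"] that by (simp add: place_inverse v w)
  have scaled: "w z = v z * w t" if z: "z \<in> F" "z \<noteq> 0" for z
  proof (cases "0 \<le> v z")
    case True
    have "v (z / t ^ nat (v z)) = 0"
      using z t True by (simp add: place_divide place_power v)
    then have "w (z / t ^ nat (v z)) = 0"
      using z t by (intro unit) auto
    then show ?thesis
      using z t True by (simp add: place_divide place_power w)
  next
    case False
    have "v (z * t ^ nat (- v z)) = 0"
      using z t False by (simp add: place_mult place_power v)
    then have "w (z * t ^ nat (- v z)) = 0"
      using z t by (intro unit) auto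
    then show ?thesis
      using z t False by (simp add: place_mult place_power w)
  qed
  obtain s where s: "s \<in> F" "s \<noteq> 0" "w s = 1"
    using place_unif[OF w] by blast
  have "v s * w t = 1"
    using scaled[of s] s by simp
  moreover have "0 \<le> w t"
    using le[of t] t by simp
  ultimately have "w t = 1"
    using zmult_eq_1_iff by auto
  then show ?thesis
    using scaled place_outside[OF v] place_outside[OF w] place_zero[OF v] place_zero[OF w]
    by (intro ext) (metis mult.right_neutral)
qed

text \<open>
  Neither of two distinct valuation rings contains the other; the quotient of two witnesses works.
\<close>

lemma places_separated:
  assumes v: "v \<in> pl" and w: "w \<in> pl" and "v \<noteq> w"
  shows "\<exists>z\<in>F. z \<noteq> 0 \<and> 0 < v z \<and> w z < 0"
proof -
  obtain a where a: "a \<in> F" "a \<noteq> 0" "0 \<le> v a" "w a < 0"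
    using place_eqI[OF v w] \<open>v \<noteq> w\<close> by force
  obtain b where b: "b \<in> F" "b \<noteq> 0" "0 \<le> w b" "v b < 0"
    using place_eqI[OF w v] \<open>v \<noteq> w\<close> by force
  show ?thesis
    using a b by (intro bexI[of _ "a / b"]) (auto simp: place_divide v w)
qed

lemma place_separated_from_finite:
  assumes "finite S" "S \<subseteq> pl" and v: "v \<in> pl" "v \<notin> S"
  shows "\<exists>z\<in>F. z \<noteq> 0 \<and> 0 < v z \<and> (\<forall>w\<in>S. w z < 0)"
  using assms(1,2,4)
proof (induction S rule: finite_induct)
  case empty
  then show ?case
    using place_unif[OF v(1)] by (metis empty_iff zero_less_one)
next
  case (insert r S)
  then have r: "r \<in> pl" by simp
  obtain z where z: "z \<in> F" "z \<noteq> 0" "0 < v z" "\<And>i. i \<in> S \<Longrightarrow> i z < 0"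
    using insert by auto
  show ?case
  proof (cases "r z < 0")
    case True
    then show ?thesis using z by auto
  next
    case False
    obtain w where w: "w \<in> F" "w \<noteq> 0" "0 < v w" "r w < 0"
      using places_separated[OF v(1) r] insert.prems by auto
    \<comment> \<open>A large power of \<open>w\<close> avoids any cancellation with \<open>z\<close> at the places of \<open>S\<close>.\<close>
    define K where "K = (\<Sum>i\<in>S. nat \<bar>i z\<bar>)"
    define s where "s = Suc K"
    have "0 < s" by (simp add: s_def)
    have ws: "w ^ s \<in> F" "w ^ s \<noteq> 0" "0 < v (w ^ s)" "r (w ^ s) < 0"
      using w \<open>0 < s\<close> by (auto simp: place_power v r mult_pos_neg)
    have "r (w ^ s) < r z" using False ws by simp
    then have "w ^ s + z \<noteq> 0" "r (w ^ s + z) < 0"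
      using place_add_eq[OF r, of "w ^ s" z] ws z by auto
    moreover have "0 < v (w ^ s + z)"
      using place_add[OF v(1), of "w ^ s" z] ws z \<open>w ^ s + z \<noteq> 0\<close> by auto
    moreover have "i (w ^ s + z) < 0" if i: "i \<in> S" for i
    proof -
      have ip: "i \<in> pl" using insert i by auto
      have "nat \<bar>i z\<bar> \<le> K"
        unfolding K_def using insert i by (intro member_le_sum) auto
      then have small: "\<bar>i z\<bar> < int s" by (simp add: s_def)
      have iw: "i (w ^ s) = int s * i w"
        using w by (simp add: place_power ip)
      have "i (w ^ s) \<noteq> i z"
      proof
        assume eq: "i (w ^ s) = i z"
        then have "int s * i w = i z" using iw by simp
        moreover have "i z \<noteq> 0" using z(4)[OF i] by simp
        ultimately have "int s dvd i z" "i z \<noteq> 0" by (metis dvd_triv_left, simp)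
        then have "\<bar>int s\<bar> \<le> \<bar>i z\<bar>" by (rule dvd_imp_le_int[rotated])
        then show False using small by simp
      qed
      then consider "i (w ^ s) < i z" | "i z < i (w ^ s)" by linarith
      then show ?thesis
      proof cases
        case 1
        then show ?thesis
          using place_add_eq[OF ip, of "w ^ s" z] ws z z(4)[OF i] by simp
      next
        case 2
        then show ?thesis
          using place_add_eq[OF ip, of z "w ^ s"] ws z z(4)[OF i] by (simp add: add.commute)
      qed
    qed
    ultimately show ?thesis
      using ws z by (intro bexI[of _ "w ^ s + z"]) auto
  qed
qed

text \<open>
  If \<open>z\<close> vanishes at \<open>v\<close> and has poles at the places of \<open>S\<close>, then \<open>1 / (1 + z ^ n)\<close> is close to
  \<open>1\<close> at \<open>v\<close> and close to \<open>0\<close> on \<open>S\<close>. The finite set \<open>T\<close> collects the elements for which the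
  approximation is going to be used, so that their values need not be tracked.
\<close>

lemma weak_approximation:
  assumes S: "finite S" "S \<subseteq> pl" and v: "v \<in> pl" "v \<notin> S" and T: "finite T" "T \<subseteq> F"
  shows "\<exists>e\<in>F. \<forall>s\<in>T. (e - 1) * s \<in> ball v N \<and> (\<forall>w\<in>S. e * s \<in> ball w N)"
proof -
  obtain z where z: "z \<in> F" "z \<noteq> 0" "0 < v z" "\<And>w. w \<in> S \<Longrightarrow> w z < 0"
    using place_separated_from_finite[OF S v] by auto
  define K where "K = (\<Sum>s\<in>T. \<Sum>w\<in>insert v S. nat \<bar>w s\<bar>)"
  define n where "n = Suc (nat \<bar>N\<bar> + K)"
  have bound: "N - w s \<le> int n" if "s \<in> T" "w \<in> insert v S" for s w
  proof -
    have "nat \<bar>w s\<bar> \<le> (\<Sum>w\<in>insert v S. nat \<bar>w s\<bar>)"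
      using S that by (intro member_le_sum) auto
    also have "\<dots> \<le> K"
      unfolding K_def using T that by (intro member_le_sum) auto
    finally show ?thesis by (simp add: n_def)
  qed
  have "0 < n" by (simp add: n_def)
  then have vz: "0 < v (z ^ n)"
    using z by (simp add: place_power v)
  have nz: "1 + z ^ n \<noteq> 0" and v1: "v (1 + z ^ n) = 0"
    using place_add_eq[OF v(1), of 1 "z ^ n"] z vz v by auto
  define e where "e = 1 / (1 + z ^ n)"
  have e: "e \<in> F" using z by (simp add: e_def)
  have "e - 1 = - (z ^ n) / (1 + z ^ n)"
    using nz by (simp add: e_def field_simps)
  then have "v (e - 1) = v (z ^ n)"
    using z nz v1 v by (simp add: place_divide place_minus)
  moreover have "int n \<le> v (z ^ n)"
    using z mult_left_mono[of 1 "v z" "int n"] by (simp add: place_power v)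
  ultimately have "e - 1 \<in> ball v (int n)"
    using e by (auto simp: ball_def)
  moreover have "e \<in> ball w (int n)" if w: "w \<in> S" for w
  proof -
    have wp: "w \<in> pl" using S w by auto
    have "w (z ^ n) < 0"
      using z(1) z(4)[OF w] by (simp add: place_power wp \<open>0 < n\<close> mult_pos_neg)
    then have "w (z ^ n + 1) = w (z ^ n)"
      using place_add_eq(2)[OF wp, of "z ^ n" 1] z by (simp add: wp)
    moreover have "w (z ^ n) \<le> - int n"
      using z(1) z(4)[OF w] mult_left_mono[of "w z" "-1" "int n"] by (simp add: place_power wp)
    ultimately show ?thesis
      using e nz z by (auto simp: e_def ball_def place_divide wp add.commute)
  qed
  moreover have "s \<in> ball w (w s)" if "s \<in> T" for s w
    using T that by (auto simp: ball_def)
  ultimately have scaled: "(e - 1) * s \<in> ball v (int n + v s)" "w \<in> S \<Longrightarrow> e * s \<in> ball w (int n + w s)"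
    if "s \<in> T" for s w
    using that S v by (auto intro!: ball_mult)
  have "(e - 1) * s \<in> ball v N \<and> (\<forall>w\<in>S. e * s \<in> ball w N)" if "s \<in> T" for s
  proof (intro conjI ballI)
    have "N \<le> int n + v s"
      using bound[OF that, of v] by simp
    then show "(e - 1) * s \<in> ball v N"
      by (rule ball_mono[OF _ scaled(1)[OF that]])
  next
    fix w assume w: "w \<in> S"
    have "N \<le> int n + w s"
      using bound[OF that, of w] w by simp
    then show "e * s \<in> ball w N"
      by (rule ball_mono[OF _ scaled(2)[OF that w]])
  qed
  then show ?thesis using e by blast
qed


section \<open>Degrees of places and the zeros of a function\<close>

text \<open>
  Linear independence over \<open>k\<close> in the residue field, expressed by representatives.
\<close>

definition residue_independent :: "('l \<Rightarrow> int) \<Rightarrow> 'l set \<Rightarrow> bool" where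
  "residue_independent v R \<longleftrightarrow> finite R \<and> R \<subseteq> ball v 0 \<and>
     (\<forall>c. (\<Sum>b\<in>R. \<kappa> (c b) * b) \<in> ball v 1 \<longrightarrow> (\<forall>b\<in>R. c b = 0))"

text \<open>
  The first power \<open>t ^ j\<close> with a coefficient different from \<open>0\<close> in the residue field would have
  value exactly \<open>j\<close>, and all later terms have larger values.
\<close>

lemma uniformizer_expansion_eq_0:
  assumes v: "v \<in> pl" and t: "t \<in> F" "t \<noteq> 0" "v t = 1" and R: "residue_independent v R"
    and sum: "(\<Sum>j<n. \<Sum>b\<in>R. \<kappa> (c j b) * (t ^ j * b)) \<in> ball v (int n)"
  shows "\<forall>j<n. \<forall>b\<in>R. c j b = 0"
proof -
  have tj: "t ^ j \<in> ball v (int j)" for j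
    using t by (simp add: ball_def place_power v)
  have gin: "(\<Sum>b\<in>R. \<kappa> (c j b) * b) \<in> ball v 0" for j
    using R v by (intro ball_sum ball_scale) (auto simp: residue_independent_def)
  have "\<forall>b\<in>R. c j b = 0" if "j < n" for j
    using that
  proof (induction j rule: less_induct)
    case (less j)
    define f where "f i = (\<Sum>b\<in>R. \<kappa> (c i b) * (t ^ i * b))" for i
    have f: "f i = t ^ i * (\<Sum>b\<in>R. \<kappa> (c i b) * b)" for i
      by (simp add: f_def sum_distrib_left mult_ac)
    have "(\<Sum>i<n. f i) = f j + (\<Sum>i\<in>{..<n} - {j}. f i)"
      using less.prems by (simp add: sum.remove)
    moreover have "(\<Sum>i\<in>{..<n} - {j}. f i) \<in> ball v (int j + 1)"
    proof (rule ball_sum[OF v])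
      fix i assume i: "i \<in> {..<n} - {j}"
      show "f i \<in> ball v (int j + 1)"
      proof (cases "i < j")
        case True
        then have "f i = 0" using less by (simp add: f_def)
        then show ?thesis by simp
      next
        case False
        have "f i \<in> ball v (int i + 0)"
          unfolding f by (intro ball_mult v tj gin)
        then show ?thesis
          using False i by (auto intro: ball_mono[of _ "int i"])
      qed
    qed
    moreover have "(\<Sum>i<n. f i) \<in> ball v (int j + 1)"
      using sum less.prems unfolding f_def by (auto intro: ball_mono[of _ "int n"])
    ultimately have "f j \<in> ball v (int j + 1)"
      using ball_add_cancel[OF v] by simp
    then have "(\<Sum>b\<in>R. \<kappa> (c j b) * b) \<in> ball v (int j + 1 - v (t ^ j))"
      unfolding f using t gin[of j] by (intro ball_cancel v) (auto intro: ball_in_F)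
    then show ?case
      using R t by (simp add: place_power v residue_independent_def)
  qed
  then show ?thesis by blast
qed

text \<open>
  The zeros of \<open>h\<close>, counted with multiplicity and residue degree, number at most \<open>[F : k(h)]\<close>:
  products of powers of uniformizers with lifts of residue field elements, localized at one zero
  by weak approximation, are independent over \<open>k[h]\<close>, because a relation not divisible
  by \<open>h\<close> would be nontrivial modulo \<open>h\<close> at some zero.
\<close>

lemma residue_independent_sum_le:
  assumes h: "h \<in> F" "degree_over_le \<kappa> F h d"
    and S: "finite S" "S \<subseteq> pl" "\<And>v. v \<in> S \<Longrightarrow> 0 < v h"
    and R: "\<And>v. v \<in> S \<Longrightarrow> residue_independent v (R v)"
  shows "(\<Sum>v\<in>S. v h * int (card (R v))) \<le> int d"
proof (cases "S = {}")
  case False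
  then obtain v0 where "v0 \<in> S" by auto
  then have h0: "h \<noteq> 0"
    using S(2) S(3)[of v0] place_zero[of v0] by auto
  have "\<exists>t. t \<in> F \<and> t \<noteq> 0 \<and> v t = 1" if "v \<in> S" for v
    using place_unif[of v] S that by auto
  then obtain t where t: "\<And>v. v \<in> S \<Longrightarrow> t v \<in> F \<and> t v \<noteq> 0 \<and> v (t v) = 1"
    by metis
  define n where "n v = nat (v h)" for v :: "'l \<Rightarrow> int"
  have n: "int (n v) = v h" if "v \<in> S" for v
    using S(3)[OF that] by (simp add: n_def)
  define T where "T v = (\<lambda>(j, b). t v ^ j * b) ` ({..<n v} \<times> R v)" for v
  define N where "N = (\<Sum>v\<in>S. v h)"
  have N: "v h \<le> N" if "v \<in> S" for v
    unfolding N_def using S that by (intro member_le_sum) (auto intro: less_imp_le)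
  have Rfin: "finite (R v)" and RF: "R v \<subseteq> ball v 0" if "v \<in> S" for v
    using R[OF that] by (auto simp: residue_independent_def)
  have "\<exists>e. e \<in> F \<and> (\<forall>s\<in>T v. (e - 1) * s \<in> ball v N \<and> (\<forall>w\<in>S - {v}. e * s \<in> ball w N))"
    if v: "v \<in> S" for v
  proof -
    have "finite (T v)" "T v \<subseteq> F"
      using Rfin[OF v] RF[OF v] t[OF v] by (auto simp: T_def ball_def)
    then show ?thesis
      using weak_approximation[of "S - {v}" v "T v" N] S v by auto
  qed
  then obtain e where eF: "\<And>v. v \<in> S \<Longrightarrow> e v \<in> F"
    and e: "\<And>v s. v \<in> S \<Longrightarrow> s \<in> T v \<Longrightarrow> (e v - 1) * s \<in> ball v N"
    and e': "\<And>v s w. v \<in> S \<Longrightarrow> s \<in> T v \<Longrightarrow> w \<in> S \<Longrightarrow> w \<noteq> v \<Longrightarrow> e v * s \<in> ball w N"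
    by (metis DiffI singletonD)
  define J where "J = (SIGMA v:S. {..<n v} \<times> R v)"
  define u where "u = (\<lambda>(v, j, b). e v * (t v ^ j * b))"
  have J: "finite J"
    unfolding J_def using S Rfin by auto
  have TJ: "t v ^ j * b \<in> T v" "v \<in> S" "j < n v" "b \<in> R v" if "(v, j, b) \<in> J" for v j b
    using that by (auto simp: T_def J_def)
  have TB: "s \<in> ball v 0" if sT: "s \<in> T v" "v \<in> S" for s v
  proof -
    obtain j b where jb: "s = t v ^ j * b" "b \<in> R v" using sT by (auto simp: T_def)
    have vp: "v \<in> pl" using S sT(2) by auto
    then have "t v ^ j \<in> ball v 0"
      using t[OF sT(2)] by (intro ball_power) (auto simp: ball_def)
    then have "t v ^ j * b \<in> ball v (0 + 0)"
      using RF[OF sT(2)] jb S sT(2) by (intro ball_mult) auto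
    then show ?thesis using jb by simp
  qed
  have uF: "u ` J \<subseteq> F"
  proof (intro image_subsetI)
    fix i assume i: "i \<in> J"
    obtain v j b where vjb: "i = (v, j, b)" by (cases i)
    show "u i \<in> F"
      using ball_in_F[OF TB[OF TJ(1,2)]] eF[OF TJ(2)] i by (simp add: u_def vjb)
  qed
  have u0: "u i \<in> ball w 0" if "i \<in> J" "w \<in> S" for i w
  proof -
    obtain v j b where i: "i = (v, j, b)" by (cases i)
    have s: "t v ^ j * b \<in> T v" "v \<in> S" using TJ that i by auto
    have N0: "0 \<le> N" using N[OF that(2)] S(3)[OF that(2)] by simp
    show ?thesis
    proof (cases "w = v")
      case True
      have "(e v - 1) * (t v ^ j * b) + t v ^ j * b \<in> ball v 0"
        using S s by (intro ball_add ball_mono[OF N0 e] TB) auto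
      then show ?thesis by (simp add: u_def i True algebra_simps)
    next
      case False
      then show ?thesis
        using ball_mono[OF N0 e'[OF s(2,1) that(2)]] by (simp add: u_def i)
    qed
  qed
  have "card J \<le> d"
  proof (rule degree_over_le_family[OF h(2) J uF])
    fix \<phi> assume rel: "(\<Sum>i\<in>J. ev h (\<phi> i) * u i) = 0"
    show "\<forall>i\<in>J. \<phi> i = 0"
    proof (rule independent_over_if_mod[OF J h0 _ rel])
      fix \<phi> \<psi> assume rel: "(\<Sum>i\<in>J. ev h (\<phi> i) * u i) = 0"
        and \<psi>: "\<And>i. \<phi> i = pCons (coeff (\<phi> i) 0) (\<psi> i)"
      define c where "c i = coeff (\<phi> i) 0" for i
      have "ev h (\<phi> i) = \<kappa> (c i) + h * ev h (\<psi> i)" for i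
        using arg_cong[OF \<psi>[of i], of "ev h"] by (simp add: c_def)
      then have split: "(\<Sum>i\<in>J. \<kappa> (c i) * u i) = - (h * (\<Sum>i\<in>J. ev h (\<psi> i) * u i))"
        using rel by (simp add: algebra_simps sum.distrib sum_distrib_left eq_neg_iff_add_eq_0)
      have small: "(\<Sum>i\<in>J. \<kappa> (c i) * u i) \<in> ball v (v h)" if v: "v \<in> S" for v
      proof -
        have vp: "v \<in> pl" using S v by auto
        have hb: "h \<in> ball v (v h)" "h \<in> ball v 0" 
          using h S(3)[OF v] by (auto simp: ball_def)
        have "(\<Sum>i\<in>J. ev h (\<psi> i) * u i) \<in> ball v (0 + 0)"
          using u0 v by (intro ball_sum ball_mult ball_ev vp hb) auto
        then have "h * (\<Sum>i\<in>J. ev h (\<psi> i) * u i) \<in> ball v (v h + 0)"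
          by (intro ball_mult vp hb) simp
        then show ?thesis
          unfolding split using ball_minus[OF vp] by simp
      qed
      have "\<forall>j<n v. \<forall>b\<in>R v. c (v, j, b) = 0" if v: "v \<in> S" for v
      proof (rule uniformizer_expansion_eq_0[where t = "t v" and v = v])
        show vp: "v \<in> pl" using S v by auto
        show "t v \<in> F" "t v \<noteq> 0" "v (t v) = 1" "residue_independent v (R v)"
          using t[OF v] R[OF v] by auto
        let ?Jv = "{v} \<times> ({..<n v} \<times> R v)"
        have Jv: "?Jv \<subseteq> J" using v by (auto simp: J_def)
        have "(\<Sum>i\<in>J. \<kappa> (c i) * u i) = (\<Sum>i\<in>?Jv. \<kappa> (c i) * u i) + (\<Sum>i\<in>J - ?Jv. \<kappa> (c i) * u i)"
          using sum.subset_diff[OF Jv J] by (simp add: add.commute)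
        moreover have "(\<Sum>i\<in>J - ?Jv. \<kappa> (c i) * u i) \<in> ball v (v h)"
        proof (intro ball_sum ball_scale vp)
          fix i assume "i \<in> J - ?Jv"
          then obtain w j b where i: "i = (w, j, b)" "(w, j, b) \<in> J" "w \<noteq> v"
            by (cases i) (auto simp: J_def)
          then have "e w * (t w ^ j * b) \<in> ball v N"
            using e'[OF TJ(2) TJ(1) v] by blast
          then show "u i \<in> ball v (v h)"
            using ball_mono[OF N[OF v]] i by (simp add: u_def)
        qed
        ultimately have "(\<Sum>i\<in>?Jv. \<kappa> (c i) * u i) \<in> ball v (v h)"
          using ball_add_cancel[OF vp] small[OF v] by simp
        moreover have "(\<Sum>i\<in>?Jv. \<kappa> (c i) * ((e v - 1) * (t v ^ fst (snd i) * snd (snd i))))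
            \<in> ball v (v h)"
        proof (intro ball_sum ball_scale vp)
          fix i assume "i \<in> ?Jv"
          then obtain j b where "i = (v, j, b)" by auto
          then have i: "i = (v, j, b)" "(v, j, b) \<in> J"
            using Jv \<open>i \<in> ?Jv\<close> by auto
          show "(e v - 1) * (t v ^ fst (snd i) * snd (snd i)) \<in> ball v (v h)"
            using ball_mono[OF N[OF v] e[OF v TJ(1)[OF i(2)]]] i by simp
        qed
        ultimately have "(\<Sum>i\<in>?Jv. \<kappa> (c i) * u i) -
            (\<Sum>i\<in>?Jv. \<kappa> (c i) * ((e v - 1) * (t v ^ fst (snd i) * snd (snd i)))) \<in> ball v (v h)"
          by (intro ball_diff vp)
        also have "(\<Sum>i\<in>?Jv. \<kappa> (c i) * u i) -
            (\<Sum>i\<in>?Jv. \<kappa> (c i) * ((e v - 1) * (t v ^ fst (snd i) * snd (snd i)))) =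
            (\<Sum>i\<in>?Jv. \<kappa> (c i) * (t v ^ fst (snd i) * snd (snd i)))"
          unfolding sum_subtractf[symmetric]
          by (intro sum.cong refl) (auto simp: u_def algebra_simps)
        also have "\<dots> = (\<Sum>p\<in>{..<n v} \<times> R v. \<kappa> (c (v, p)) * (t v ^ fst p * snd p))"
          by (rule sum.reindex_bij_witness[of _ "\<lambda>p. (v, p)" snd]) auto
        also have "\<dots> = (\<Sum>j<n v. \<Sum>b\<in>R v. \<kappa> (c (v, j, b)) * (t v ^ j * b))"
          by (simp add: sum.cartesian_product case_prod_unfold)
        finally show "(\<Sum>j<n v. \<Sum>b\<in>R v. \<kappa> (c (v, j, b)) * (t v ^ j * b)) \<in> ball v (int (n v))"
          using n[OF v] by simp
      qed
      then show "\<forall>i\<in>J. coeff (\<phi> i) 0 = 0"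
        by (auto simp: J_def c_def)
    qed
  qed
  moreover have "int (card J) = (\<Sum>v\<in>S. v h * int (card (R v)))"
    unfolding J_def using S Rfin by (simp add: card_SigmaI n)
  ultimately show ?thesis by linarith
qed simp

text \<open>
  The property that the definition of the degree of a place requires of a set of representatives.
\<close>

definition residue_basis :: "('l \<Rightarrow> int) \<Rightarrow> 'l set \<Rightarrow> bool" where
  "residue_basis v R \<longleftrightarrow> finite R \<and> R \<subseteq> ball v 0 \<and>
     (\<forall>z\<in>ball v 0. \<exists>!c. c \<in> R \<rightarrow>\<^sub>E UNIV \<and> z - (\<Sum>b\<in>R. \<kappa> (c b) * b) \<in> ball v 1)"

lemma residue_basis_finite: "residue_basis v R \<Longrightarrow> finite R"
  and residue_basis_subset: "residue_basis v R \<Longrightarrow> R \<subseteq> ball v 0"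
  unfolding residue_basis_def by blast+

lemma residue_basis_ex1:
  assumes "residue_basis v R" "z \<in> ball v 0"
  shows "\<exists>!c. c \<in> R \<rightarrow>\<^sub>E UNIV \<and> z - (\<Sum>b\<in>R. \<kappa> (c b) * b) \<in> ball v 1"
  using assms unfolding residue_basis_def by blast

lemma residue_basis_imp_independent:
  assumes v: "v \<in> pl" and R: "residue_basis v R"
  shows "residue_independent v R"
  unfolding residue_independent_def
proof (intro conjI allI impI)
  fix c assume c: "(\<Sum>b\<in>R. \<kappa> (c b) * b) \<in> ball v 1"
  have ex1: "\<exists>!c. c \<in> R \<rightarrow>\<^sub>E UNIV \<and> 0 - (\<Sum>b\<in>R. \<kappa> (c b) * b) \<in> ball v 1"
    by (rule residue_basis_ex1[OF R]) simp
  have "restrict c R \<in> R \<rightarrow>\<^sub>E UNIV \<and> 0 - (\<Sum>b\<in>R. \<kappa> (restrict c R b) * b) \<in> ball v 1"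
    using ball_minus[OF v c] by (simp cong: sum.cong)
  moreover have "restrict (\<lambda>_. 0) R \<in> R \<rightarrow>\<^sub>E UNIV \<and>
      0 - (\<Sum>b\<in>R. \<kappa> (restrict (\<lambda>_. 0) R b) * b) \<in> ball v 1"
    by (simp cong: sum.cong)
  ultimately have "restrict c R = restrict (\<lambda>_. 0) R"
    using ex1 by blast
  then show "\<forall>b\<in>R. c b = 0"
    by (metis restrict_apply')
qed (use residue_basis_finite[OF R] residue_basis_subset[OF R] in auto)

text \<open>
  With \<open>t\<close> a uniformizer, independent sets of residues have at most \<open>[F : k(t)]\<close> elements, and one
  of maximal size is a basis.
\<close>

lemma residue_basis_exists:
  assumes v: "v \<in> pl"
  shows "\<exists>R. residue_basis v R"
proof -
  obtain t where t: "t \<in> F" "t \<noteq> 0" "v t = 1"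
    using place_unif[OF v] by blast
  obtain d where d: "degree_over_le \<kappa> F t d"
    using finite_degree t by blast
  have "card R \<le> d" if "residue_independent v R" for R
    using residue_independent_sum_le[OF t(1) d, of "{v}" "\<lambda>_. R"] t v that by simp
  moreover have "residue_independent v {}"
    by (simp add: residue_independent_def)
  ultimately obtain R where R: "residue_independent v R"
    and max: "\<And>R'. residue_independent v R' \<Longrightarrow> card R' \<le> card R"
    using ex_has_greatest_nat[of "residue_independent v" "{}" card "Suc d"]
    by (metis less_Suc_eq_le)
  have Rfin: "finite R" and RB: "R \<subseteq> ball v 0"
    using R by (auto simp: residue_independent_def)
  have "\<exists>!c. c \<in> R \<rightarrow>\<^sub>E UNIV \<and> z - (\<Sum>b\<in>R. \<kappa> (c b) * b) \<in> ball v 1" if z: "z \<in> ball v 0" for z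
  proof (rule ex_ex1I)
    show "\<exists>c. c \<in> R \<rightarrow>\<^sub>E UNIV \<and> z - (\<Sum>b\<in>R. \<kappa> (c b) * b) \<in> ball v 1"
    proof (rule ccontr)
      assume none: "\<not> ?thesis"
      have none': "z - (\<Sum>b\<in>R. \<kappa> (c b) * b) \<notin> ball v 1" for c
      proof
        assume "z - (\<Sum>b\<in>R. \<kappa> (c b) * b) \<in> ball v 1"
        then have "restrict c R \<in> R \<rightarrow>\<^sub>E UNIV \<and> z - (\<Sum>b\<in>R. \<kappa> (restrict c R b) * b) \<in> ball v 1"
          by (simp cong: sum.cong)
        then show False using none by blast
      qed
      have "z \<notin> R"
      proof
        assume "z \<in> R"
        then have "(\<Sum>b\<in>R. \<kappa> (if b = z then 1 else 0) * b) = z"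
          using Rfin by (subst sum.remove) (auto intro!: sum.neutral)
        then show False
          using none'[of "\<lambda>b. if b = z then 1 else 0"] by simp
      qed
      have "residue_independent v (insert z R)"
        unfolding residue_independent_def
      proof (intro conjI allI impI)
        fix c assume c: "(\<Sum>b\<in>insert z R. \<kappa> (c b) * b) \<in> ball v 1"
        then have sum: "\<kappa> (c z) * z + (\<Sum>b\<in>R. \<kappa> (c b) * b) \<in> ball v 1"
          using Rfin \<open>z \<notin> R\<close> by simp
        have "c z = 0"
        proof (rule ccontr)
          assume cz: "c z \<noteq> 0"
          have "\<kappa> (inverse (c z)) * (\<kappa> (c z) * z + (\<Sum>b\<in>R. \<kappa> (c b) * b)) \<in> ball v 1"
            by (intro ball_scale v sum)
          also have "\<kappa> (inverse (c z)) * (\<kappa> (c z) * z + (\<Sum>b\<in>R. \<kappa> (c b) * b)) =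
              z - (\<Sum>b\<in>R. \<kappa> (- inverse (c z) * c b) * b)"
            using cz by (simp add: distrib_left sum_distrib_left sum_negf mult.assoc)
          finally show False
            using none'[of "\<lambda>b. - inverse (c z) * c b"] by blast
        qed
        then show "\<forall>b\<in>insert z R. c b = 0"
          using sum R by (auto simp: residue_independent_def)
      qed (use Rfin RB z in auto)
      then show False
        using max[of "insert z R"] Rfin \<open>z \<notin> R\<close> by simp
    qed
  next
    fix c c' assume c: "c \<in> R \<rightarrow>\<^sub>E UNIV \<and> z - (\<Sum>b\<in>R. \<kappa> (c b) * b) \<in> ball v 1"
      and c': "c' \<in> R \<rightarrow>\<^sub>E UNIV \<and> z - (\<Sum>b\<in>R. \<kappa> (c' b) * b) \<in> ball v 1"
    have "(z - (\<Sum>b\<in>R. \<kappa> (c' b) * b)) - (z - (\<Sum>b\<in>R. \<kappa> (c b) * b)) \<in> ball v 1"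
      by (intro ball_diff[OF v] conjunct2[OF c] conjunct2[OF c'])
    then have "(\<Sum>b\<in>R. \<kappa> (c b - c' b) * b) \<in> ball v 1"
      by (simp add: left_diff_distrib sum_subtractf)
    then have "\<forall>b\<in>R. c b - c' b = 0"
      using R unfolding residue_independent_def by (elim conjE allE[of _ "\<lambda>b. c b - c' b"]) simp
    then show "c = c'"
      using c c' by (intro PiE_ext[of c R _ c']) auto
  qed
  then have "\<forall>z\<in>ball v 0. \<exists>!c. c \<in> R \<rightarrow>\<^sub>E UNIV \<and> z - (\<Sum>b\<in>R. \<kappa> (c b) * b) \<in> ball v 1"
    by (rule ballI)
  then have "residue_basis v R"
    unfolding residue_basis_def using Rfin RB by (intro conjI)
  then show ?thesis by (rule exI)
qed

lemma card_funcset_UNIV: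
  assumes "finite R"
  shows "card (R \<rightarrow>\<^sub>E (UNIV :: 'a set)) = CARD('a) ^ card R"
  using assms by (simp add: card_PiE)

text \<open>
  The residue field is finite, and both bases determine the number of its elements.
\<close>

lemma residue_basis_card_le:
  assumes v: "v \<in> pl" and R: "residue_basis v R" and R': "residue_basis v R'"
  shows "card R \<le> card R'"
proof -
  let ?f = "\<lambda>c. \<Sum>b\<in>R. \<kappa> (c b) * b"
  have fin: "?f c \<in> ball v 0" for c
    using residue_basis_subset[OF R] by (intro ball_sum v ball_scale) auto
  define g where "g c = (SOME c'. c' \<in> R' \<rightarrow>\<^sub>E UNIV \<and> ?f c - (\<Sum>b\<in>R'. \<kappa> (c' b) * b) \<in> ball v 1)" for c
  have "g c \<in> R' \<rightarrow>\<^sub>E UNIV \<and> ?f c - (\<Sum>b\<in>R'. \<kappa> (g c b) * b) \<in> ball v 1" for c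
    unfolding g_def by (rule someI_ex[OF ex1_implies_ex[OF residue_basis_ex1[OF R' fin]]])
  note g = conjunct1[OF this] conjunct2[OF this]
  have "inj_on g (R \<rightarrow>\<^sub>E UNIV)"
  proof (rule inj_onI)
    fix c c' assume c: "c \<in> R \<rightarrow>\<^sub>E UNIV" "c' \<in> R \<rightarrow>\<^sub>E UNIV" "g c = g c'"
    have "(?f c - (\<Sum>b\<in>R'. \<kappa> (g c b) * b)) - (?f c' - (\<Sum>b\<in>R'. \<kappa> (g c' b) * b)) \<in> ball v 1"
      by (rule ball_diff[OF v g(2) g(2)])
    then have "?f c - ?f c' \<in> ball v 1" using c by simp
    moreover have "?f c - ?f c \<in> ball v 1" by simp
    moreover have "\<exists>!d. d \<in> R \<rightarrow>\<^sub>E UNIV \<and> ?f c - ?f d \<in> ball v 1"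
      using residue_basis_ex1[OF R fin[of c]] by simp
    ultimately show "c = c'"
      using c(1,2) by (metis (no_types, lifting))
  qed
  then have "card (R \<rightarrow>\<^sub>E (UNIV :: 'a set)) \<le> card (R' \<rightarrow>\<^sub>E (UNIV :: 'a set))"
    using g(1) residue_basis_finite[OF R'] by (intro card_inj_on_le[of g]) (auto intro!: finite_PiE)
  then have "CARD('a) ^ card R \<le> CARD('a) ^ card R'"
    using residue_basis_finite[OF R] residue_basis_finite[OF R'] by (simp add: card_funcset_UNIV)
  then show ?thesis
    using card_field_gt_1 power_le_imp_le_exp by blast
qed

lemma place_degree_basis:
  assumes v: "v \<in> pl"
  obtains R where "residue_basis v R" "card R = place_degree \<kappa> F v"
proof -
  obtain R where R: "residue_basis v R"
    using residue_basis_exists[OF v] by blast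
  have "place_degree \<kappa> F v = (THE n. \<exists>R. card R = n \<and> residue_basis v R)"
    unfolding place_degree_def residue_basis_def valuation_ring_eq place_ideal_eq
    by (intro arg_cong[of _ _ The] ext) blast
  also have "\<dots> = card R"
    using R residue_basis_card_le[OF v] by (intro the_equality) (auto intro: antisym)
  finally show ?thesis using R that by simp
qed

lemma place_degree_pos:
  assumes v: "v \<in> pl"
  shows "0 < place_degree \<kappa> F v"
proof -
  obtain R where R: "residue_basis v R" "card R = place_degree \<kappa> F v"
    using place_degree_basis[OF v] by blast
  have "R \<noteq> {}"
  proof
    assume "R = {}"
    moreover have "1 \<in> ball v 0" using v by (simp add: ball_def)
    ultimately have "1 \<in> ball v 1"
      using residue_basis_ex1[OF R(1), of 1] by auto
    then show False using v by (simp add: ball_def)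
  qed
  then show ?thesis
    using R residue_basis_finite[OF R(1)] by (metis card_gt_0_iff)
qed

lemma zero_degree_le:
  assumes h: "h \<in> F" "degree_over_le \<kappa> F h d"
    and S: "finite S" "S \<subseteq> pl" "\<And>v. v \<in> S \<Longrightarrow> 0 < v h"
  shows "(\<Sum>v\<in>S. v h * int (place_degree \<kappa> F v)) \<le> int d"
proof -
  have "\<exists>R. residue_basis v R \<and> card R = place_degree \<kappa> F v" if "v \<in> S" for v
    using place_degree_basis[of v] S that by (metis subsetD)
  then obtain R where R: "\<And>v. v \<in> S \<Longrightarrow> residue_basis v (R v) \<and> card (R v) = place_degree \<kappa> F v"
    by metis
  have "(\<Sum>v\<in>S. v h * int (card (R v))) \<le> int d"
    using S R residue_basis_imp_independent
    by (intro residue_independent_sum_le[OF h]) auto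
  then show ?thesis using R by simp
qed

lemma finite_zeros:
  assumes h: "h \<in> F"
  shows "finite {v \<in> pl. 0 < v h}"
proof (rule ccontr)
  assume inf: "infinite {v \<in> pl. 0 < v h}"
  obtain d where d: "degree_over_le \<kappa> F h d"
    using finite_degree[OF h] by blast
  obtain S where S: "finite S" "card S = Suc d" "S \<subseteq> {v \<in> pl. 0 < v h}"
    using infinite_arbitrarily_large[OF inf] by blast
  have "int (card S) = (\<Sum>v\<in>S. 1)" by simp
  also have "\<dots> \<le> (\<Sum>v\<in>S. v h * int (place_degree \<kappa> F v))"
  proof (rule sum_mono)
    fix v assume "v \<in> S"
    then have "0 < v h" "0 < int (place_degree \<kappa> F v)"
      using S place_degree_pos by auto
    then have "0 < v h * int (place_degree \<kappa> F v)" by simp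
    then show "1 \<le> v h * int (place_degree \<kappa> F v)" by linarith
  qed
  also have "\<dots> \<le> int d"
    using S by (intro zero_degree_le[OF h d]) auto
  finally show False using S by simp
qed

end

section \<open>Existence of places\<close>

definition is_subring :: "'l::field set \<Rightarrow> bool" where
  "is_subring S \<longleftrightarrow> 1 \<in> S \<and> (\<forall>a\<in>S. \<forall>b\<in>S. a - b \<in> S \<and> a * b \<in> S)"

definition ring_adjoin :: "'l::field set \<Rightarrow> 'l \<Rightarrow> 'l set" where
  "ring_adjoin S z = {poly p z | p. \<forall>i. coeff p i \<in> S}"

context
  fixes S :: "'l::field set"
  assumes S: "is_subring S"
begin

lemma subring_one: "1 \<in> S"
  and subring_diff: "a \<in> S \<Longrightarrow> b \<in> S \<Longrightarrow> a - b \<in> S"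
  and subring_mult: "a \<in> S \<Longrightarrow> b \<in> S \<Longrightarrow> a * b \<in> S"
  using S by (auto simp: is_subring_def)

lemma subring_zero: "0 \<in> S"
  using subring_diff[OF subring_one subring_one] by simp

lemma subring_add: "a \<in> S \<Longrightarrow> b \<in> S \<Longrightarrow> a + b \<in> S"
  using subring_diff[of a "- b"] subring_diff[of 0 b] subring_zero by simp

lemma subring_sum: "(\<And>i. i \<in> I \<Longrightarrow> f i \<in> S) \<Longrightarrow> sum f I \<in> S"
  by (induction I rule: infinite_finite_induct) (auto simp: subring_zero subring_add)

lemma subring_power: "a \<in> S \<Longrightarrow> a ^ n \<in> S"
  by (induction n) (auto simp: subring_one subring_mult)

lemma is_subring_ring_adjoin: "is_subring (ring_adjoin S z)"
  unfolding is_subring_def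
proof (intro conjI ballI)
  show "1 \<in> ring_adjoin S z"
    unfolding ring_adjoin_def
    by (intro CollectI exI[of _ 1]) (auto simp: coeff_1 subring_one subring_zero)
next
  fix a b assume "a \<in> ring_adjoin S z" "b \<in> ring_adjoin S z"
  then obtain p q where p: "a = poly p z" "\<And>i. coeff p i \<in> S" and q: "b = poly q z" "\<And>i. coeff q i \<in> S"
    by (auto simp: ring_adjoin_def)
  show "a - b \<in> ring_adjoin S z"
    unfolding ring_adjoin_def
    by (intro CollectI exI[of _ "p - q"]) (auto simp: p q subring_diff)
  show "a * b \<in> ring_adjoin S z"
    unfolding ring_adjoin_def
    by (intro CollectI exI[of _ "p * q"])
      (auto simp: p q coeff_mult intro!: subring_sum subring_mult)
qed

lemma subset_ring_adjoin: "S \<subseteq> ring_adjoin S z"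
proof
  fix a assume "a \<in> S"
  then show "a \<in> ring_adjoin S z"
    unfolding ring_adjoin_def
    by (intro CollectI exI[of _ "[:a:]"]) (auto simp: coeff_pCons subring_zero split: nat.split)
qed

lemma generator_in_ring_adjoin: "z \<in> ring_adjoin S z"
  unfolding ring_adjoin_def
  by (intro CollectI exI[of _ "[:0, 1:]"])
    (auto simp: coeff_pCons subring_zero subring_one split: nat.split)

end

lemma ring_adjoin_subset:
  assumes "is_subring T" "S \<subseteq> T" "z \<in> T"
  shows "ring_adjoin S z \<subseteq> T"
  using assms by (auto simp: ring_adjoin_def poly_altdef
      intro!: subring_sum subring_mult subring_power)

context function_field
begin

lemma is_subring_F: "is_subring F"
  by (simp add: is_subring_def)

definition valuation_subring :: "'l set \<Rightarrow> bool" where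
  "valuation_subring V \<longleftrightarrow> is_subring V \<and> range \<kappa> \<subseteq> V \<and> V \<subseteq> F \<and> (\<forall>z\<in>F. z \<in> V \<or> inverse z \<in> V)"

text \<open>
  Chevalley's argument: a subring containing \<open>1 / f\<close> and maximal among those not containing
  \<open>f\<close> is a valuation ring. If neither \<open>z\<close> nor \<open>1 / z\<close> belonged to it, then adjoining either one
  would produce \<open>f\<close>, that is, an expression of \<open>1\<close> as a polynomial in it with coefficients
  in the ideal generated by \<open>1 / f\<close>; two such expressions can be combined to one of smaller degree.
\<close>

lemma valuation_subring_exists:
  assumes R: "is_subring R" "range \<kappa> \<subseteq> R" "R \<subseteq> F" and f: "f \<in> F" "f \<notin> R" "inverse f \<in> R"
  shows "\<exists>V. valuation_subring V \<and> R \<subseteq> V \<and> f \<notin> V"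
proof -
  define Rs where "Rs = {V. is_subring V \<and> R \<subseteq> V \<and> V \<subseteq> F \<and> f \<notin> V}"
  have "\<exists>M\<in>Rs. (\<forall>N\<in>Rs. M \<subseteq> N \<longrightarrow> N = M)"
  proof (rule subset_Zorn_nonempty)
    show "Rs \<noteq> {}" using R f by (auto simp: Rs_def)
  next
    fix C assume C: "C \<noteq> {}" "subset.chain Rs C"
    then have sub: "\<And>M. M \<in> C \<Longrightarrow> M \<in> Rs" by (auto simp: subset.chain_def)
    have common: "\<exists>M\<in>C. a \<in> M \<and> b \<in> M" if "a \<in> \<Union>C" "b \<in> \<Union>C" for a b
    proof -
      obtain M N where XY: "M \<in> C" "a \<in> M" "N \<in> C" "b \<in> N" using \<open>a \<in> \<Union>C\<close> \<open>b \<in> \<Union>C\<close> by auto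
      then have "M \<subseteq> N \<or> N \<subseteq> M" using C by (auto simp: subset.chain_def)
      then show ?thesis using XY by blast
    qed
    have closed: "a - b \<in> M \<and> a * b \<in> M" if "M \<in> C" "a \<in> M" "b \<in> M" for a b M
      using sub[OF that(1)] that(2,3) by (auto simp: Rs_def is_subring_def)
    have "a - b \<in> \<Union>C \<and> a * b \<in> \<Union>C" if ab: "a \<in> \<Union>C" "b \<in> \<Union>C" for a b
    proof -
      obtain M where "M \<in> C" "a \<in> M" "b \<in> M" using common[OF ab] by blast
      then show ?thesis using closed[of M a b] by blast
    qed
    moreover have "1 \<in> \<Union>C"
      using C sub by (fastforce simp: Rs_def is_subring_def)
    ultimately have "is_subring (\<Union>C)"
      by (simp add: is_subring_def)
    moreover have "R \<subseteq> \<Union>C" "\<Union>C \<subseteq> F" "f \<notin> \<Union>C"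
      using C sub by (fastforce simp: Rs_def)+
    ultimately show "\<Union>C \<in> Rs" by (simp add: Rs_def)
  qed
  then obtain V where V: "is_subring V" "R \<subseteq> V" "V \<subseteq> F" "f \<notin> V"
    and max: "\<And>N. is_subring N \<Longrightarrow> V \<subseteq> N \<Longrightarrow> N \<subseteq> F \<Longrightarrow> f \<notin> N \<Longrightarrow> N = V"
    by (auto simp: Rs_def)
  have f0: "f \<noteq> 0" using V subring_zero[OF V(1)] by auto
  define g where "g = inverse f"
  have gV: "g \<in> V" using f V by (auto simp: g_def)
  define I where "I = {g * a | a. a \<in> V}"
  have IV: "a \<in> V" if "a \<in> I" for a
    using that gV subring_mult[OF V(1)] by (auto simp: I_def)
  have I0: "0 \<in> I"
    using subring_zero[OF V(1)] by (force simp: I_def)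
  have Iadd: "a + b \<in> I" if "a \<in> I" "b \<in> I" for a b
    using that subring_add[OF V(1)] by (force simp: I_def simp flip: distrib_left)
  have Imult: "a * b \<in> I" if ab: "a \<in> V" "b \<in> I" for a b
  proof -
    obtain c where "b = g * c" "c \<in> V" using ab by (auto simp: I_def)
    then show ?thesis
      unfolding I_def using ab subring_mult[OF V(1)]
      by (intro CollectI exI[of _ "a * c"]) (auto simp: mult_ac)
  qed
  have I1: "1 \<notin> I"
  proof
    assume "1 \<in> I"
    then obtain a where "1 = g * a" "a \<in> V" by (auto simp: I_def)
    then have "a = f" using f0 by (simp add: g_def field_simps)
    then show False using \<open>a \<in> V\<close> V by simp
  qed
  define Q where "Q n z \<longleftrightarrow> (\<exists>a. (\<forall>j. a j \<in> I) \<and> (\<Sum>j\<le>n. a j * z ^ j) = 1)" for n :: nat and z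
  have Q_exists: "\<exists>n. Q n z" if z: "z \<in> F" "z \<notin> V" for z
  proof -
    let ?A = "ring_adjoin V z"
    have "f \<in> ?A"
    proof (rule ccontr)
      assume "f \<notin> ?A"
      then have "?A = V"
        using is_subring_ring_adjoin[OF V(1)] subset_ring_adjoin[OF V(1)]
          ring_adjoin_subset[OF is_subring_F V(3) z(1)] by (intro max) auto
      then show False
        using generator_in_ring_adjoin[OF V(1)] z by auto
    qed
    then obtain p where p: "f = poly p z" "\<And>i. coeff p i \<in> V"
      using V(1) by (auto simp: ring_adjoin_def)
    have "(\<Sum>j\<le>degree p. (g * coeff p j) * z ^ j) = g * f"
      by (simp add: p poly_altdef sum_distrib_left mult.assoc)
    also have "\<dots> = 1" using f0 by (simp add: g_def)
    finally show ?thesis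
      unfolding Q_def using p by (intro exI[of _ "degree p"] exI[of _ "\<lambda>j. g * coeff p j"])
        (auto simp: I_def)
  qed
  have Q_mono: "Q n z" if Qm: "Q m z" and "m \<le> n" for m n z
  proof -
    obtain a where a: "\<And>j. a j \<in> I" "(\<Sum>j\<le>m. a j * z ^ j) = 1" using Qm by (auto simp: Q_def)
    have "(\<Sum>j\<le>n. (if j \<le> m then a j else 0) * z ^ j) = (\<Sum>j\<le>m. a j * z ^ j)"
      using \<open>m \<le> n\<close> by (intro sum.mono_neutral_cong_right) auto
    then show ?thesis
      unfolding Q_def using a I0 by (intro exI[of _ "\<lambda>j. if j \<le> m then a j else 0"]) auto
  qed
  have Q_0: "\<not> Q 0 z" for z
    using I1 unfolding Q_def by simp metis
  have Q_step: "Q k z" if Q1: "Q (Suc k) z" and Q2: "Q m (inverse z)" and "m \<le> Suc k" "z \<noteq> 0"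
    for k m z
  proof -
    obtain a where a: "\<And>j. a j \<in> I" "(\<Sum>j\<le>Suc k. a j * z ^ j) = 1" 
      using Q1 by (auto simp: Q_def)
    obtain b where b: "\<And>j. b j \<in> I" "(\<Sum>j\<le>Suc k. b j * inverse z ^ j) = 1"
      using Q_mono[OF Q2 \<open>m \<le> Suc k\<close>] by (auto simp: Q_def)
    have "z ^ Suc k = (\<Sum>j\<le>Suc k. b j * inverse z ^ j) * z ^ Suc k"
      using b by simp
    also have "\<dots> = (\<Sum>j\<le>Suc k. b j * z ^ (Suc k - j))"
      unfolding sum_distrib_right
    proof (rule sum.cong[OF refl])
      fix j assume "j \<in> {..Suc k}"
      then have "z ^ Suc k = z ^ j * z ^ (Suc k - j)"
        by (subst power_add[symmetric]) simp
      then show "b j * inverse z ^ j * z ^ Suc k = b j * z ^ (Suc k - j)"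
        using \<open>z \<noteq> 0\<close> by (simp add: power_inverse field_simps)
    qed
    also have "\<dots> = (\<Sum>j\<le>Suc k. b (Suc k - j) * z ^ j)"
      by (rule sum.reindex_bij_witness[of _ "\<lambda>j. Suc k - j" "\<lambda>j. Suc k - j"]) auto
    also have "\<dots> = (\<Sum>j\<le>k. b (Suc k - j) * z ^ j) + b 0 * z ^ Suc k"
      by simp
    finally have top: "(1 - b 0) * z ^ Suc k = (\<Sum>j\<le>k. b (Suc k - j) * z ^ j)"
      unfolding left_diff_distrib diff_eq_eq mult_1 .
    define c where "c j = (if j = 0 then b 0 else 0) + (1 - b 0) * a j + a (Suc k) * b (Suc k - j)" for j
    have "c j \<in> I" for j
      unfolding c_def using a b I0 IV subring_one[OF V(1)] subring_diff[OF V(1)]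
      by (intro Iadd Imult) auto
    moreover have "(\<Sum>j\<le>k. c j * z ^ j) = 1"
    proof -
      have "(\<Sum>j\<le>k. (if j = 0 then b 0 else 0) * z ^ j) = b 0"
        by (subst sum.remove[of _ 0]) (auto intro!: sum.neutral)
      then have "(\<Sum>j\<le>k. c j * z ^ j) =
          b 0 + (1 - b 0) * (\<Sum>j\<le>k. a j * z ^ j) + a (Suc k) * ((1 - b 0) * z ^ Suc k)"
        unfolding top by (simp add: c_def distrib_right sum.distrib sum_distrib_left mult.assoc)
      also have "\<dots> = b 0 + (1 - b 0) * ((\<Sum>j\<le>k. a j * z ^ j) + a (Suc k) * z ^ Suc k)"
        by (simp add: algebra_simps)
      also have "\<dots> = 1"
        using a(2) by simp
      finally show ?thesis .
    qed
    ultimately show ?thesis by (auto simp: Q_def)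
  qed
  have no_Q: "\<not> (Q n z \<and> Q m (inverse z))" if "z \<noteq> 0" for n m z
    using that
  proof (induction "n + m" arbitrary: n m z rule: less_induct)
    case less
    show ?case
    proof
      assume Q: "Q n z \<and> Q m (inverse z)"
      then obtain n' m' where n': "n = Suc n'" "m = Suc m'"
        using Q_0 by (metis not0_implies_Suc)
      show False
      proof (cases "m \<le> n")
        case True
        then have "Q n' z" using Q_step[of n' z m] Q n' less.prems by auto
        then show False using less.hyps[of n' m z] Q n' less.prems by auto
      next
        case False
        then have "Q m' (inverse z)" 
          using Q_step[of m' "inverse z" n] Q n' less.prems by auto
        then show False using less.hyps[of n m' z] Q n' less.prems by auto
      qed
    qed
  qed
  have "z \<in> V \<or> inverse z \<in> V" if z: "z \<in> F" for z
  proof (rule ccontr)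
    assume *: "\<not> ?thesis"
    then have "z \<noteq> 0" using subring_zero[OF V(1)] by auto
    then show False
      using Q_exists[of z] Q_exists[of "inverse z"] no_Q[of z] * z by auto
  qed
  then have "valuation_subring V"
    using V R by (auto simp: valuation_subring_def)
  then show ?thesis using V by blast
qed

text \<open>
  Valuation rings of a function field are discrete. A chain of nonunits, each a proper multiple of the
  next, is independent over the polynomials in its first member, so its length is bounded.
  Therefore the maximal ideal is generated by one element \<open>t\<close>, and no nonzero element is
  divisible by all powers of \<open>t\<close>; the exponent of \<open>t\<close> is the place.
\<close>

lemma valuation_subring_is_ball:
  assumes V: "valuation_subring V" and "V \<noteq> F"
  shows "\<exists>v\<in>pl. ball v 0 = V"
proof -
  have sub: "is_subring V" and cV: "\<And>c. \<kappa> c \<in> V" and VF: "V \<subseteq> F"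
    and total: "\<And>z. z \<in> F \<Longrightarrow> z \<in> V \<or> inverse z \<in> V"
    using V by (auto simp: valuation_subring_def)
  note V_simps = subring_one[OF sub] subring_zero[OF sub] subring_add[OF sub] 
    subring_mult[OF sub] subring_diff[OF sub] subring_power[OF sub]
  define P where "P = {z \<in> V. z = 0 \<or> inverse z \<notin> V}"
  have PV: "z \<in> V" if "z \<in> P" for z using that by (simp add: P_def)
  have PF: "z \<in> F" if "z \<in> P" for z using that VF by (auto simp: P_def)
  have P0: "0 \<in> P" using V_simps by (simp add: P_def)
  have P_mult: "a * b \<in> P" if "a \<in> V" "b \<in> P" for a b
  proof (cases "a * b = 0")
    case False
    have eq: "a * inverse (a * b) = inverse b" using False by (simp add: field_simps)
    have "inverse (a * b) \<notin> V"
      using subring_mult[OF sub, of a "inverse (a * b)"] that False unfolding eq P_def by auto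
    moreover have "a * b \<in> V"
      using subring_mult[OF sub, of a b] that by (simp add: P_def)
    ultimately show ?thesis unfolding P_def by blast
  qed (use P0 in auto)
  have P_add_aux: "a + b \<in> P" if "a \<in> P" "b \<in> P" "a / b \<in> V" "a + b \<noteq> 0" "b \<noteq> 0" for a b
  proof -
    have eq: "(1 + a / b) * inverse (a + b) = inverse b"
      using that by (simp add: field_simps)
    have "1 + a / b \<in> V"
      using subring_add[OF sub] subring_one[OF sub] that by blast
    then have "inverse (a + b) \<notin> V"
      using subring_mult[OF sub, of "1 + a / b" "inverse (a + b)"] that unfolding eq P_def by auto
    moreover have "a + b \<in> V"
      using subring_add[OF sub, of a b] that by (simp add: P_def)
    ultimately show ?thesis unfolding P_def by blast
  qed
  have P_add: "a + b \<in> P" if ab: "a \<in> P" "b \<in> P" for a b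
  proof (cases "a = 0 \<or> b = 0 \<or> a + b = 0")
    case False
    have "a / b \<in> V \<or> b / a \<in> V"
      using total[of "a / b"] PF ab by (auto simp: divide_in)
    then show ?thesis
      using P_add_aux[OF ab] P_add_aux[OF ab(2,1)] False by (auto simp: add.commute)
  qed (use ab P0 in auto)
  have P_sum: "sum f J \<in> P" if "\<And>i. i \<in> J \<Longrightarrow> f i \<in> P" for f and J :: "nat set"
    using that by (induction J rule: infinite_finite_induct) (auto simp: P0 P_add)
  have P_minus: "- a \<in> P" if "a \<in> P" for a
    using P_mult[of "- 1" a] that cV[of "- 1"] by simp
  have const_notin: "\<kappa> c \<notin> P" if "c \<noteq> 0" for c
    using cV[of "inverse c"] that by (simp add: P_def)
  have notin_V: "inverse z \<in> P" "z \<noteq> 0" if "z \<in> F" "z \<notin> V" for z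
    using that total[OF that(1)] V_simps by (auto simp: P_def)
  have evV: "ev h p \<in> V" if "h \<in> V" for h p
    using that by (induction p) (auto simp: V_simps cV)

  \<comment> \<open>The members of a chain of strict divisibilities are independent over the polynomials in its
     first member, so chains are finite.\<close>
  have chain: "Suc n \<le> d" if x: "\<And>i. i \<le> n \<Longrightarrow> x i \<in> P \<and> x i \<noteq> 0"
      and step: "\<And>i. i < n \<Longrightarrow> x i / x (Suc i) \<in> P" and d: "degree_over_le \<kappa> F (x 0) d"
    for x :: "nat \<Rightarrow> 'l" and n d
  proof -
    have ratio: "x i / x j \<in> P" if "i < j" "j \<le> n" for i j
      using that
    proof (induction j)
      case (Suc j)
      show ?case
      proof (cases "i = j")
        case False
        then have "x i / x j \<in> P" using Suc by simp
        then have "(x i / x j) * (x j / x (Suc j)) \<in> P"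
          using step[of j] Suc.prems by (intro P_mult PV) auto
        then show ?thesis using x[of j] Suc.prems by simp
      qed (use step[of j] Suc.prems in simp)
    qed simp
    have "card {..n} \<le> d"
    proof (rule degree_over_le_family[OF d])
      show "finite {..n}" "x ` {..n} \<subseteq> F" using x PF by auto
      fix \<phi> assume rel: "(\<Sum>i\<le>n. ev (x 0) (\<phi> i) * x i) = 0"
      show "\<forall>i\<in>{..n}. \<phi> i = 0"
      proof (rule independent_over_if_mod[OF _ _ _ rel])
        fix \<phi> \<psi> assume rel: "(\<Sum>i\<le>n. ev (x 0) (\<phi> i) * x i) = 0"
          and \<psi>: "\<And>i. \<phi> i = pCons (coeff (\<phi> i) 0) (\<psi> i)"
        define c where "c i = coeff (\<phi> i) 0" for i
        show "\<forall>i\<in>{..n}. coeff (\<phi> i) 0 = 0"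
        proof (rule ccontr)
          assume "\<not> ?thesis"
          then have ne: "{i. i \<le> n \<and> c i \<noteq> 0} \<noteq> {}" by (auto simp: c_def)
          define j where "j = Max {i. i \<le> n \<and> c i \<noteq> 0}"
          have "j \<in> {i. i \<le> n \<and> c i \<noteq> 0}"
            unfolding j_def using ne by (intro Max_in) auto
          then have j: "j \<le> n" "c j \<noteq> 0" by auto
          have jmax: "c i = 0" if "i \<le> n" "j < i" for i
          proof (rule ccontr)
            assume "c i \<noteq> 0"
            then have "i \<le> j" unfolding j_def using that by (intro Max_ge) auto
            then show False using that by simp
          qed
          have xj: "x j \<noteq> 0" using x j by auto
          have "ev (x 0) (\<phi> i) = \<kappa> (c i) + x 0 * ev (x 0) (\<psi> i)" for i
            using arg_cong[OF \<psi>[of i], of "ev (x 0)"] by (simp add: c_def)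
          then have "(\<Sum>i\<le>n. \<kappa> (c i) * x i) + x 0 * (\<Sum>i\<le>n. ev (x 0) (\<psi> i) * x i) = 0"
            using rel by (simp add: algebra_simps sum.distrib sum_distrib_left)
          moreover have "(\<Sum>i\<le>n. \<kappa> (c i) * x i) = \<kappa> (c j) * x j + (\<Sum>i\<in>{..n} - {j}. \<kappa> (c i) * x i)"
            using j by (simp add: sum.remove)
          ultimately have "\<kappa> (c j) * x j =
              - ((\<Sum>i\<in>{..n} - {j}. \<kappa> (c i) * x i) + x 0 * (\<Sum>i\<le>n. ev (x 0) (\<psi> i) * x i))"
            by (simp only: eq_neg_iff_add_eq_0 add.assoc)
          then have "\<kappa> (c j) =
              - ((\<Sum>i\<in>{..n} - {j}. \<kappa> (c i) * x i) + x 0 * (\<Sum>i\<le>n. ev (x 0) (\<psi> i) * x i)) / x j"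
            by (metis nonzero_mult_div_cancel_right xj)
          then have "\<kappa> (c j) =
              - ((\<Sum>i\<in>{..n} - {j}. \<kappa> (c i) * (x i / x j)) + x 0 / x j * (\<Sum>i\<le>n. ev (x 0) (\<psi> i) * x i))"
            by (simp add: add_divide_distrib diff_divide_distrib sum_divide_distrib)
          moreover have "(\<Sum>i\<in>{..n} - {j}. \<kappa> (c i) * (x i / x j)) \<in> P"
          proof (rule P_sum)
            fix i assume "i \<in> {..n} - {j}"
            then consider "i < j" | "c i = 0" using jmax[of i] by fastforce
            then show "\<kappa> (c i) * (x i / x j) \<in> P"
              by cases (use P_mult[OF cV ratio[of i j], of "c i"] j P0 in auto)
          qed
          moreover have "x 0 / x j \<in> V"
            using ratio[of 0 j] j xj PV V_simps by (cases "j = 0") auto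
          then have "x 0 / x j * (\<Sum>i\<le>n. ev (x 0) (\<psi> i) * x i) \<in> P"
            using x evV PV by (intro P_mult P_sum) auto
          ultimately have "\<kappa> (c j) \<in> P"
            by (simp only: P_add P_minus)
          then show False using const_notin[OF j(2)] by blast
        qed
      qed (use x in auto)
    qed
    then show ?thesis by simp
  qed

  have "\<exists>t. t \<in> P \<and> t \<noteq> 0 \<and> (\<forall>z\<in>P. z / t \<in> V)"
  proof (rule ccontr)
    assume none: "\<not> ?thesis"
    obtain z0 where z0: "z0 \<in> F" "z0 \<notin> V" using \<open>V \<noteq> F\<close> VF by auto
    have "\<exists>z'. (z' \<in> P \<and> z' \<noteq> 0) \<and> z / z' \<in> P" if z: "z \<in> P \<and> z \<noteq> 0" for z
    proof -
      obtain z' where z': "z' \<in> P" "z' / z \<notin> V" using none z by blast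
      then have "inverse (z' / z) \<in> P"
        using notin_V[of "z' / z"] PF z by simp
      moreover have "z' \<noteq> 0" using z' V_simps by auto
      ultimately show ?thesis using z' by auto
    qed
    then obtain x where x: "\<And>i::nat. x i \<in> P \<and> x i \<noteq> 0" "\<And>i. x i / x (Suc i) \<in> P"
      using dependent_nat_choice[of "\<lambda>_ z. z \<in> P \<and> z \<noteq> 0" "\<lambda>_ z z'. z / z' \<in> P"]
        notin_V[OF z0] by (metis inverse_nonzero_iff_nonzero)
    obtain d where "degree_over_le \<kappa> F (x 0) d"
      using finite_degree PF x by blast
    then show False using chain[of d x d] x by simp
  qed
  then obtain t where t: "t \<in> P" "t \<noteq> 0" and gen: "\<And>z. z \<in> P \<Longrightarrow> z / t \<in> V" by blast
  define U where "U = {u \<in> V. u \<noteq> 0 \<and> inverse u \<in> V}"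
  have U: "u \<in> U \<longleftrightarrow> u \<in> V \<and> u \<notin> P" for u
    using P0 by (auto simp: U_def P_def)
  have U_mult: "a * b \<in> U" if "a \<in> U" "b \<in> U" for a b
    using that V_simps by (auto simp: U_def)
  have U_inv: "inverse a \<in> U" if "a \<in> U" for a
    using that by (auto simp: U_def)
  have order_nat: "\<exists>m. z / t ^ m \<in> U" if z: "z \<in> V" "z \<noteq> 0" for z
  proof (rule ccontr)
    assume none: "\<not> ?thesis"
    have all: "z / t ^ m \<in> P" for m
    proof (induction m)
      case 0
      then show ?case using none[unfolded not_ex, rule_format, of 0] z U by auto
    next
      case (Suc m)
      have "z / t ^ Suc m = z / t ^ m / t" by (simp add: field_simps)
      then have "z / t ^ Suc m \<in> V" using gen[OF Suc] by (simp add: mult.commute)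
      then show ?case using none U by blast
    qed
    have zP: "z \<in> P" using all[of 0] by simp
    obtain d where d: "degree_over_le \<kappa> F z d" using finite_degree PF[OF zP] by blast
    define x where "x i = (if i = 0 then z else t ^ (Suc d - i))" for i
    have tP: "t ^ Suc i \<in> P" for i
      using P_mult[of "t ^ i" t] t PV V_simps by (simp add: mult.commute)
    have "Suc d \<le> d"
    proof (rule chain[of d x])
      show "x i \<in> P \<and> x i \<noteq> 0" if "i \<le> d" for i
        using tP[of "d - i"] that t z zP by (auto simp: x_def Suc_diff_le)
      show "x i / x (Suc i) \<in> P" if i: "i < d" for i
      proof (cases "i = 0")
        case True
        then show ?thesis using all[of d] by (simp add: x_def)
      next
        case False
        have "t ^ (Suc d - i) = t * t ^ (d - i)" using i by (simp add: Suc_diff_le)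
        then show ?thesis using False t by (simp add: x_def)
      qed
    qed (use d in \<open>simp add: x_def\<close>)
    then show False by simp
  qed
  have order_ex: "\<exists>k. z / t powi k \<in> U" if z: "z \<in> F" "z \<noteq> 0" for z
  proof (cases "z \<in> V")
    case True
    then show ?thesis
      using order_nat[OF True z(2)] by (metis power_int_of_nat)
  next
    case False
    then obtain m where "inverse z / t ^ m \<in> U"
      using order_nat[of "inverse z"] total[OF z(1)] z by auto
    then have "inverse (inverse z / t ^ m) \<in> U" by (rule U_inv)
    then show ?thesis
      by (intro exI[of _ "- int m"]) (simp add: power_int_minus field_simps)
  qed
  have t_pos: "t powi k \<notin> U" if "0 < k" for k
  proof -
    obtain n where n: "0 < n" "k = int n"
      using zero_less_imp_eq_int[OF \<open>0 < k\<close>] by auto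
    then obtain m where "k = int (Suc m)" by (cases n) auto
    then have "t powi k = t ^ m * t" by (simp only: power_int_of_nat power_Suc mult.commute)
    then show ?thesis
      using P_mult[OF subring_power[OF sub PV[OF t(1)]] t(1)] U by simp
  qed
  have t_unit: "k = 0" if "t powi k \<in> U" for k
  proof (rule ccontr)
    assume "k \<noteq> 0"
    then consider "0 < k" | "0 < - k" by linarith
    then show False
      using that t_pos[of k] t_pos[of "- k"] U_inv[OF that] by cases (auto simp: power_int_minus)
  qed
  have order_unique: "k = l" if "z / t powi k \<in> U" "z / t powi l \<in> U" for k l z
  proof -
    have "(z / t powi k) * inverse (z / t powi l) \<in> U" 
      using that by (intro U_mult U_inv)
    moreover have "z \<noteq> 0" using that by (auto simp: U_def)
    ultimately have "t powi (l - k) \<in> U" using t by (simp add: power_int_diff field_simps)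
    then show ?thesis using t_unit[of "l - k"] by simp
  qed
  define v where "v z = (if z \<in> F - {0} then THE k. z / t powi k \<in> U else 0)" for z
  have v: "z / t powi (v z) \<in> U" if z: "z \<in> F" "z \<noteq> 0" for z
  proof -
    have "\<exists>!k. z / t powi k \<in> U" using order_ex[OF z] order_unique by blast
    then show ?thesis using z theI'[of "\<lambda>k. z / t powi k \<in> U"] by (simp add: v_def)
  qed
  have v_eq: "v z = k" if "z / t powi k \<in> U" "z \<in> F" for z k
    using order_unique[OF v that(1)] that by (auto simp: U_def)
  have v_mult: "v (a * b) = v a + v b" if "a \<in> F" "a \<noteq> 0" "b \<in> F" "b \<noteq> 0" for a b
  proof (rule v_eq)
    have "(a / t powi v a) * (b / t powi v b) \<in> U" by (intro U_mult v that)
    then show "a * b / t powi (v a + v b) \<in> U" using t by (simp add: power_int_add)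
  qed (use that in simp)
  have V_iff: "z \<in> V \<longleftrightarrow> 0 \<le> v z" if z: "z \<in> F" "z \<noteq> 0" for z
  proof
    assume "z \<in> V"
    then obtain m where "z / t ^ m \<in> U" using order_nat z by blast
    then have "v z = int m" using z by (intro v_eq) auto
    then show "0 \<le> v z" by simp
  next
    assume "0 \<le> v z"
    then obtain m where m: "v z = int m" by (metis nonneg_int_cases)
    have "(z / t powi v z) * t ^ m \<in> V"
      using v[OF z] t PV by (intro V_simps) (auto simp: U_def)
    then show "z \<in> V" using t by (simp add: m)
  qed
  have v_inv: "v (b / a) = v b - v a" if "a \<in> F" "a \<noteq> 0" "b \<in> F" "b \<noteq> 0" for a b
    using v_mult[of "b / a" a] that by simp
  have v_add_aux: "v a \<le> v (a + b)" if "a \<in> F" "a \<noteq> 0" "b \<in> F" "b \<noteq> 0" "a + b \<noteq> 0" "v a \<le> v b"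
    for a b
  proof -
    have "b / a \<in> V" using that by (subst V_iff) (auto simp: v_inv)
    then have "1 + b / a \<in> V" using V_simps by simp
    moreover have eq: "a + b = a * (1 + b / a)" using that by (simp add: field_simps)
    moreover have "1 + b / a \<noteq> 0" using eq that by auto
    ultimately have "0 \<le> v (1 + b / a)" using V_iff[of "1 + b / a"] that by simp
    then show ?thesis unfolding eq using v_mult[of a "1 + b / a"] that \<open>1 + b / a \<noteq> 0\<close> by simp
  qed
  have v_add: "min (v a) (v b) \<le> v (a + b)" if "a \<in> F" "a \<noteq> 0" "b \<in> F" "b \<noteq> 0" "a + b \<noteq> 0" for a b
    using v_add_aux[of a b] v_add_aux[of b a] that by (cases "v a \<le> v b") (auto simp: add.commute)
  have "v \<in> pl"
    unfolding places_def
  proof (intro CollectI conjI)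
    show "\<forall>a\<in>F - {0}. \<forall>b\<in>F - {0}. v (a * b) = v a + v b" using v_mult by auto
    show "\<forall>a\<in>F - {0}. \<forall>b\<in>F - {0}. a + b \<noteq> 0 \<longrightarrow> min (v a) (v b) \<le> v (a + b)"
      using v_add by auto
    show "\<forall>c. c \<noteq> 0 \<longrightarrow> v (\<kappa> c) = 0"
      using const_notin cV U by (auto intro!: v_eq)
    have "v t = 1"
      using t PF V_simps by (intro v_eq) (auto simp: U_def)
    then show "\<exists>t\<in>F - {0}. v t = 1" using t PF by auto
    show "\<forall>z. z \<notin> F - {0} \<longrightarrow> v z = 0" by (simp add: v_def)
  qed
  moreover have "ball v 0 = V"
    using V_iff VF V_simps by (auto simp: ball_def)
  ultimately show ?thesis by blast
qed

text \<open>
  An element \<open>f\<close> is integral over \<open>S\<close> as soon as it lies in \<open>S[1 / f]\<close>: multiply such an expression by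
  a power of \<open>f\<close>. Otherwise \<open>S[1 / f]\<close> extends to a valuation ring without \<open>f\<close>.
\<close>

theorem pole_of_non_integral:
  assumes S: "is_subring S" "range \<kappa> \<subseteq> S" "S \<subseteq> F" and f: "f \<in> F"
    and non_integral: "\<And>n a. (\<And>i. a i \<in> S) \<Longrightarrow> f ^ n \<noteq> (\<Sum>i<n. a i * f ^ i)"
  shows "\<exists>v\<in>pl. S \<subseteq> ball v 0 \<and> v f < 0"
proof -
  have f0: "f \<noteq> 0"
    using non_integral[of "\<lambda>_. 0" 1] subring_zero[OF S(1)] by auto
  let ?R = "ring_adjoin S (inverse f)"
  have "f \<notin> ?R"
  proof
    assume "f \<in> ?R"
    then obtain p where p: "f = poly p (inverse f)" "\<And>i. coeff p i \<in> S"
      using S(1) by (auto simp: ring_adjoin_def)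
    let ?m = "degree p"
    have "f ^ Suc ?m = f ^ ?m * poly p (inverse f)"
      using p(1) by simp
    also have "\<dots> = (\<Sum>i\<le>?m. coeff p i * f ^ (?m - i))"
      unfolding poly_altdef sum_distrib_left
    proof (rule sum.cong[OF refl])
      fix i assume "i \<in> {..?m}"
      then have "f ^ ?m = f ^ i * f ^ (?m - i)"
        by (subst power_add[symmetric]) simp
      then show "f ^ ?m * (coeff p i * inverse f ^ i) = coeff p i * f ^ (?m - i)"
        using f0 by (simp add: power_inverse field_simps)
    qed
    also have "\<dots> = (\<Sum>i<Suc ?m. coeff p (?m - i) * f ^ i)"
      by (rule sum.reindex_bij_witness[of _ "\<lambda>i. ?m - i" "\<lambda>i. ?m - i"]) auto
    finally show False
      using non_integral[of "\<lambda>i. coeff p (?m - i)" "Suc ?m"] p(2) by blast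
  qed
  then obtain V where V: "valuation_subring V" "?R \<subseteq> V" "f \<notin> V"
    using valuation_subring_exists[of ?R f] is_subring_ring_adjoin[OF S(1)]
      subset_ring_adjoin[OF S(1)] generator_in_ring_adjoin[OF S(1)] S f
      ring_adjoin_subset[OF is_subring_F S(3)] by (metis inverse_in subset_trans)
  then obtain v where v: "v \<in> pl" "ball v 0 = V"
    using valuation_subring_is_ball[OF V(1)] f by blast
  moreover have "v f < 0"
    using V(3) f by (auto simp: v(2)[symmetric] ball_def)
  ultimately show ?thesis
    using V(2) subset_ring_adjoin[OF S(1)] by blast
qed

end

context function_field
begin

section \<open>Riemann-Roch spaces and the genus\<close>

definition Lsp :: "(('l \<Rightarrow> int) \<Rightarrow> int) \<Rightarrow> 'l set" where
  "Lsp D = {f \<in> F. \<forall>v\<in>pl. f \<in> ball v (- D v)}"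

lemma riemann_roch_space_eq: "riemann_roch_space \<kappa> F D = Lsp (Poly_Mapping.lookup D)"
  by (auto simp: riemann_roch_space_def Lsp_def ball_def)

lemma Lsp_mono: "(\<And>v. v \<in> pl \<Longrightarrow> D v \<le> D' v) \<Longrightarrow> Lsp D \<subseteq> Lsp D'"
  unfolding Lsp_def by (smt (verit) Collect_mono ball_mono)

lemma Lsp_cong: "(\<And>v. v \<in> pl \<Longrightarrow> D v = D' v) \<Longrightarrow> Lsp D = Lsp D'"
  by (simp add: Lsp_def)

sublocale V: vector_space "\<lambda>c z. \<kappa> c * z"
  by unfold_locales (auto simp: algebra_simps)

lemma subspace_Lsp: "V.subspace (Lsp D)"
  unfolding V.subspace_def Lsp_def by (auto intro: ball_add ball_scale)

text \<open>
  Over a finite field the dimension of a space can be recovered from its number of elements.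
\<close>

lemma card_finite_subspace:
  assumes W: "V.subspace W" "finite W"
  shows "card W = CARD('a) ^ V.dim W"
proof -
  obtain B where B: "B \<subseteq> W" "V.independent B" "W \<subseteq> V.span B" "card B = V.dim W"
    using V.basis_exists by metis
  have fin: "finite B" using B W finite_subset by blast
  have span: "V.span B = W"
    using B W V.span_subspace by blast
  let ?f = "\<lambda>c. \<Sum>b\<in>B. \<kappa> (c b) * b"
  have "bij_betw ?f (B \<rightarrow>\<^sub>E UNIV) W"
    unfolding bij_betw_def
  proof
    show "inj_on ?f (B \<rightarrow>\<^sub>E UNIV)"
    proof (rule inj_onI)
      fix c c' assume c: "c \<in> B \<rightarrow>\<^sub>E UNIV" "c' \<in> B \<rightarrow>\<^sub>E UNIV" "?f c = ?f c'"
      have "(\<Sum>b\<in>B. \<kappa> (c b - c' b) * b) = 0"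
        using c by (simp add: left_diff_distrib sum_subtractf)
      then have "c b - c' b = 0" if "b \<in> B" for b
        by (rule V.independentD[OF B(2) fin order_refl _ that])
      then show "c = c'"
        using c by (intro PiE_ext[of c B _ c']) auto
    qed
    have "?f ` (B \<rightarrow>\<^sub>E UNIV) = range ?f"
    proof (intro equalityI image_subsetI)
      fix c
      have "?f c = ?f (restrict c B)" by (simp cong: sum.cong)
      moreover have "restrict c B \<in> B \<rightarrow>\<^sub>E UNIV" by simp
      ultimately show "?f c \<in> ?f ` (B \<rightarrow>\<^sub>E UNIV)"
        by (rule image_eqI)
    qed auto
    then show "?f ` (B \<rightarrow>\<^sub>E UNIV) = W"
      using V.span_finite[OF fin] span by simp
  qed
  then have "card W = card (B \<rightarrow>\<^sub>E (UNIV :: 'a set))"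
    by (rule bij_betw_same_card[symmetric])
  then show ?thesis by (simp add: card_funcset_UNIV[OF fin] B)
qed

text \<open>
  The class of \<open>f\<close> modulo the smaller space is determined by the leading coefficient of \<open>f\<close>
  at \<open>v\<close>, an element of the residue field.
\<close>

lemma Lsp_add_place:
  assumes v: "v \<in> pl" and fin: "finite (Lsp D)"
  shows "finite (Lsp (D(v := D v + 1)))"
    and "card (Lsp (D(v := D v + 1))) \<le> card (Lsp D) * CARD('a) ^ place_degree \<kappa> F v"
proof -
  let ?D' = "D(v := D v + 1)"
  obtain t where t: "t \<in> F" "t \<noteq> 0" "v t = 1"
    using place_unif[OF v] by blast
  obtain R where R: "residue_basis v R" "card R = place_degree \<kappa> F v"
    using place_degree_basis[OF v] by blast
  let ?C = "R \<rightarrow>\<^sub>E (UNIV :: 'a set)"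
  have finC: "finite ?C"
    using residue_basis_finite[OF R(1)] by (intro finite_PiE) auto
  \<comment> \<open>Multiplication by \<open>s\<close> moves the allowed poles of the larger space at \<open>v\<close> to value \<open>0\<close>, where the
     residue is defined; the residue vanishes on the smaller space.\<close>
  define s where "s = t powi (D v + 1)"
  have s: "s \<in> F" "s \<noteq> 0" "v s = D v + 1"
  proof -
    show "s \<noteq> 0" using t by (simp add: s_def)
    show "s \<in> F" using t by (simp add: s_def power_int_def)
    show "v s = D v + 1"
      using t by (simp add: s_def power_int_def place_power place_inverse v)
  qed
  have s0: "s * f \<in> ball v 0" if "f \<in> Lsp ?D'" for f
  proof -
    have "f \<in> ball v (- (D v + 1))" using that v by (auto simp: Lsp_def dest: bspec[of _ _ v])
    moreover have "s \<in> ball v (D v + 1)" using s by (simp add: ball_def)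
    ultimately have "s * f \<in> ball v (D v + 1 + - (D v + 1))" by (intro ball_mult v)
    then show ?thesis by simp
  qed
  define \<gamma> where "\<gamma> f = (SOME c. c \<in> ?C \<and> s * f - (\<Sum>b\<in>R. \<kappa> (c b) * b) \<in> ball v 1)" for f
  have \<gamma>: "\<gamma> f \<in> ?C \<and> s * f - (\<Sum>b\<in>R. \<kappa> (\<gamma> f b) * b) \<in> ball v 1" if "f \<in> Lsp ?D'" for f
    unfolding \<gamma>_def by (rule someI_ex[OF ex1_implies_ex[OF residue_basis_ex1[OF R(1) s0[OF that]]]])
  have diff: "f - g \<in> Lsp D" if fg: "f \<in> Lsp ?D'" "g \<in> Lsp ?D'" "\<gamma> f = \<gamma> g" for f g
  proof -
    have "f - g \<in> Lsp ?D'"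
      by (rule V.subspace_diff[OF subspace_Lsp fg(1,2)])
    moreover have "f - g \<in> ball v (- D v)"
    proof -
      have "(s * f - (\<Sum>b\<in>R. \<kappa> (\<gamma> f b) * b)) - (s * g - (\<Sum>b\<in>R. \<kappa> (\<gamma> g b) * b)) \<in> ball v 1"
        by (rule ball_diff[OF v conjunct2[OF \<gamma>[OF fg(1)]] conjunct2[OF \<gamma>[OF fg(2)]]])
      then have "s * (f - g) \<in> ball v 1" using fg by (simp add: right_diff_distrib)
      then have "f - g \<in> ball v (1 - v s)"
        using s fg by (intro ball_cancel v) (auto simp: Lsp_def)
      then show ?thesis using s by simp
    qed
    ultimately show ?thesis
      unfolding Lsp_def by (auto split: if_splits)
  qed
  define W where "W c = {f \<in> Lsp ?D'. \<gamma> f = c}" for c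
  have W: "finite (W c) \<and> card (W c) \<le> card (Lsp D)" for c
  proof (cases "W c = {}")
    case False
    then obtain g where g: "g \<in> Lsp ?D'" "\<gamma> g = c" by (auto simp: W_def)
    have inj: "inj_on (\<lambda>f. f - g) (W c)" by (auto intro: inj_onI)
    have sub: "(\<lambda>f. f - g) ` W c \<subseteq> Lsp D"
      using diff g by (auto simp: W_def)
    show ?thesis
      using inj_on_finite[OF inj sub fin] card_inj_on_le[OF inj sub fin] by simp
  qed simp
  have cover: "Lsp ?D' = (\<Union>c\<in>?C. W c)"
    using \<gamma> by (auto simp: W_def)
  show "finite (Lsp ?D')"
    unfolding cover using finC W by blast
  have "card (Lsp ?D') \<le> (\<Sum>c\<in>?C. card (W c))"
    unfolding cover by (rule card_UN_le[OF finC])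
  also have "\<dots> \<le> (\<Sum>c\<in>?C. card (Lsp D))"
    using W by (intro sum_mono) blast
  also have "\<dots> = card (Lsp D) * CARD('a) ^ place_degree \<kappa> F v"
    by (simp add: card_funcset_UNIV residue_basis_finite[OF R(1)] R(2))
  finally show "card (Lsp ?D') \<le> card (Lsp D) * CARD('a) ^ place_degree \<kappa> F v" .
qed

lemma Lsp_add_multiple:
  assumes v: "v \<in> pl" and fin: "finite (Lsp D)"
  shows "finite (Lsp (D(v := D v + int m))) \<and>
    card (Lsp (D(v := D v + int m))) \<le> card (Lsp D) * CARD('a) ^ (m * place_degree \<kappa> F v)"
proof (induction m)
  case (Suc m)
  let ?D = "D(v := D v + int m)"
  have eq: "D(v := D v + int (Suc m)) = ?D(v := ?D v + 1)"
    by (rule ext) simp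
  have "card (Lsp (?D(v := ?D v + 1))) \<le> card (Lsp ?D) * CARD('a) ^ place_degree \<kappa> F v"
    using Suc Lsp_add_place[OF v, of ?D] by blast
  also have "\<dots> \<le> card (Lsp D) * CARD('a) ^ (m * place_degree \<kappa> F v) * CARD('a) ^ place_degree \<kappa> F v"
    by (rule mult_right_mono[OF conjunct2[OF Suc]]) simp
  finally have "card (Lsp (?D(v := ?D v + 1))) \<le> card (Lsp D) * CARD('a) ^ (Suc m * place_degree \<kappa> F v)"
    by (simp add: power_add mult_ac)
  then show ?case
    unfolding eq using Suc Lsp_add_place(1)[OF v, of ?D] by blast
qed (use fin in simp)

text \<open>
  An upper bound for the growth of \<open>L(D)\<close>, obtained by adding the places of \<open>S\<close> one at a time.
\<close>

lemma Lsp_increase: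
  assumes "finite S" "S \<subseteq> pl" and fin: "finite (Lsp D)"
    and "\<And>v. v \<in> pl - S \<Longrightarrow> D' v = D v" "\<And>v. v \<in> S \<Longrightarrow> D v \<le> D' v"
  shows "finite (Lsp D')"
    and "card (Lsp D') \<le> card (Lsp D) * CARD('a) ^ nat (\<Sum>v\<in>S. (D' v - D v) * int (place_degree \<kappa> F v))"
proof -
  have "finite (Lsp D') \<and>
     card (Lsp D') \<le> card (Lsp D) * CARD('a) ^ nat (\<Sum>v\<in>S. (D' v - D v) * int (place_degree \<kappa> F v))"
    using assms(1,2,4,5)
  proof (induction S arbitrary: D' rule: finite_induct)
    case empty
    then have "Lsp D' = Lsp D" by (intro Lsp_cong) auto
    then show ?case using fin by simp
  next
    case (insert w S)
    let ?E = "D'(w := D w)"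
    have w: "w \<in> pl" "w \<notin> S" using insert by auto
    have IH: "finite (Lsp ?E) \<and>
        card (Lsp ?E) \<le> card (Lsp D) * CARD('a) ^ nat (\<Sum>v\<in>S. (?E v - D v) * int (place_degree \<kappa> F v))"
      using insert.prems insert.hyps by (intro insert.IH) auto
    let ?m = "nat (D' w - D w)"
    have w_le: "D w \<le> D' w" using insert.prems by simp
    have D': "D' = ?E(w := ?E w + int ?m)" by (rule ext) (simp add: w_le)
    have sumE: "(\<Sum>v\<in>S. (?E v - D v) * int (place_degree \<kappa> F v)) =
        (\<Sum>v\<in>S. (D' v - D v) * int (place_degree \<kappa> F v))"
      using w by (intro sum.cong) auto
    have nonneg: "0 \<le> (\<Sum>v\<in>S. (D' v - D v) * int (place_degree \<kappa> F v))"
      using insert.prems by (intro sum_nonneg) auto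
    have split: "nat (\<Sum>v\<in>insert w S. (D' v - D v) * int (place_degree \<kappa> F v)) =
        nat (\<Sum>v\<in>S. (D' v - D v) * int (place_degree \<kappa> F v)) + ?m * place_degree \<kappa> F w"
      using insert.hyps nonneg insert.prems
      by (simp add: nat_add_distrib nat_mult_distrib)
    have "finite (Lsp (?E(w := ?E w + int ?m))) \<and> card (Lsp (?E(w := ?E w + int ?m))) \<le>
        card (Lsp ?E) * CARD('a) ^ (?m * place_degree \<kappa> F w)"
      using IH by (intro Lsp_add_multiple w) blast
    then have "finite (Lsp D') \<and> card (Lsp D') \<le> card (Lsp ?E) * CARD('a) ^ (?m * place_degree \<kappa> F w)"
      by (subst (1 2) D')
    moreover have "card (Lsp ?E) * CARD('a) ^ (?m * place_degree \<kappa> F w) \<le>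
      (card (Lsp D) * CARD('a) ^ nat (\<Sum>v\<in>S. (D' v - D v) * int (place_degree \<kappa> F v)))
        * CARD('a) ^ (?m * place_degree \<kappa> F w)"
      using IH unfolding sumE by (intro mult_right_mono) auto
    ultimately show ?case
      unfolding split power_add mult.assoc by (meson order_trans)
  qed
  then show "finite (Lsp D')"
    and "card (Lsp D') \<le> card (Lsp D) * CARD('a) ^ nat (\<Sum>v\<in>S. (D' v - D v) * int (place_degree \<kappa> F v))"
    by auto
qed

text \<open>
  The divisor \<open>n (x)\<^sub>\<infinity>\<close>, as a function on the places.
\<close>

definition pole_multiple :: "'l \<Rightarrow> nat \<Rightarrow> ('l \<Rightarrow> int) \<Rightarrow> int" where
  "pole_multiple x n v = (if v \<in> pl \<and> v x < 0 then - (int n * v x) else 0)"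

text \<open>
  The genus is read off from the dimensions of the spaces belonging to multiples of the pole
  divisor of \<open>x\<close>. Every divisor is bounded, up to a principal divisor, by such a multiple,
  and \<open>deg D - dim L(D)\<close> increases with \<open>D\<close> because enlarging \<open>D\<close> by a place \<open>P\<close>
  enlarges \<open>L(D)\<close> by at most \<open>deg P\<close> dimensions.
\<close>

theorem genus_eqI:
  assumes x: "x \<in> F" "x \<noteq> 0"
    and deg_pole: "degree_over_le \<kappa> F (inverse x) e"
    and deg_poly: "\<And>p. p \<noteq> 0 \<Longrightarrow> degree_over_le \<kappa> F (ev x p) (e * degree p)"
    and transcendental: "\<And>p. p \<noteq> 0 \<Longrightarrow> ev x p \<noteq> 0"
    and finite_place: "\<And>v. v \<in> pl \<Longrightarrow> 0 \<le> v x \<Longrightarrow> \<exists>p. p \<noteq> 0 \<and> 0 < v (ev x p)"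
    and card: "\<And>n. n0 \<le> n \<Longrightarrow> card (Lsp (pole_multiple x n)) = CARD('a) ^ m n"
    and m: "\<And>n. n0 \<le> n \<Longrightarrow> int (m n) = int (e * n) + 1 - g"
  shows "genus \<kappa> F = g"
proof -
  let ?deg = "\<lambda>v. int (place_degree \<kappa> F v)"
  define dimL where "dimL D = V.dim (Lsp D)" for D
  have q0: "0 < CARD('a)" using card_field_gt_1 by simp
  have q_le: "a \<le> b" if "CARD('a) ^ a \<le> CARD('a) ^ b" for a b
    using card_field_gt_1 that by (rule power_le_imp_le_exp)
  have q_eq: "a = b" if "CARD('a) ^ a = CARD('a) ^ b" for a b
    using card_field_gt_1 that power_inject_exp by blast
  define Inf where "Inf = {v \<in> pl. v x < 0}"
  have Inf_eq: "Inf = {v \<in> pl. 0 < v (inverse x)}"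
    using x by (auto simp: Inf_def place_inverse)
  have Inf: "finite Inf" "Inf \<subseteq> pl"
    unfolding Inf_eq using x by (auto intro: finite_zeros)
  define E where "E = (\<Sum>v\<in>Inf. - v x * ?deg v)"
  have "E = (\<Sum>v\<in>Inf. v (inverse x) * ?deg v)"
    unfolding E_def using x Inf by (intro sum.cong) (auto simp: place_inverse)
  also have "\<dots> \<le> int e"
    using x Inf by (intro zero_degree_le[OF _ deg_pole]) (auto simp: Inf_eq)
  finally have E_le: "E \<le> int e" .
  have finL: "finite (Lsp (pole_multiple x n))" if "n0 \<le> n" for n
    using card[OF that] q0 by (intro card_ge_0_finite) simp
  \<comment> \<open>The pole divisor has full degree \<open>e\<close>, because the dimension grows by \<open>e\<close> from one multiple to
     the next.\<close>
  have "int e \<le> E"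
  proof -
    have "card (Lsp (pole_multiple x (Suc n0))) \<le> card (Lsp (pole_multiple x n0)) *
        CARD('a) ^ nat (\<Sum>v\<in>Inf. (pole_multiple x (Suc n0) v - pole_multiple x n0 v) * ?deg v)"
    proof (rule Lsp_increase(2)[OF Inf finL[OF order_refl]])
      show "pole_multiple x (Suc n0) v = pole_multiple x n0 v" if "v \<in> pl - Inf" for v
        using that by (simp add: pole_multiple_def Inf_def)
      show "pole_multiple x n0 v \<le> pole_multiple x (Suc n0) v" if "v \<in> Inf" for v
        using that by (simp add: pole_multiple_def Inf_def algebra_simps)
    qed
    also have "(\<Sum>v\<in>Inf. (pole_multiple x (Suc n0) v - pole_multiple x n0 v) * ?deg v) = E"
      unfolding E_def using Inf by (intro sum.cong) (auto simp: pole_multiple_def Inf_def algebra_simps)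
    finally have "CARD('a) ^ m (Suc n0) \<le> CARD('a) ^ (m n0 + nat E)"
      by (simp add: card power_add)
    then have "m (Suc n0) \<le> m n0 + nat E" by (rule q_le)
    moreover have "0 \<le> E"
      unfolding E_def by (intro sum_nonneg) (auto simp: Inf_def mult_nonpos_nonneg)
    ultimately show ?thesis using m[of n0] m[of "Suc n0"] by simp
  qed
  then have E: "E = int e" using E_le by simp

  have upper: "divisor_degree \<kappa> F D - int (dimL (Poly_Mapping.lookup D)) + 1 \<le> g"
    if D: "D \<in> divisors \<kappa> F" for D
  proof -
    define L where "L = Poly_Mapping.lookup D"
    define K where "K = Poly_Mapping.keys D"
    have K: "finite K" "K \<subseteq> pl" using D by (auto simp: K_def divisors_def)
    have L0: "L v = 0" if "v \<notin> K" for v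
      using that by (simp add: K_def L_def in_keys_iff)
    have ev_nonneg: "0 \<le> v (ev x p)" if "v \<in> pl" "0 \<le> v x" "p \<noteq> 0" for v p
    proof -
      have "x \<in> ball v 0" using that x by (simp add: ball_def)
      then have "ev x p \<in> ball v 0" using that by (intro ball_ev)
      then show ?thesis using transcendental[OF that(3)] by (simp add: ball_def)
    qed
    have "\<exists>p. p \<noteq> 0 \<and> (\<forall>v\<in>K. 0 \<le> v x \<longrightarrow> L v \<le> v (ev x p))"
      using K
    proof (induction K rule: finite_induct)
      case empty
      show ?case by (intro exI[of _ 1]) auto
    next
      case (insert w K)
      then obtain p where p: "p \<noteq> 0" "\<And>v. v \<in> K \<Longrightarrow> 0 \<le> v x \<Longrightarrow> L v \<le> v (ev x p)" by auto
      have w: "w \<in> pl" using insert by simp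
      show ?case
      proof (cases "0 \<le> w x")
        case True
        obtain r where r: "r \<noteq> 0" "0 < w (ev x r)" using finite_place[OF w True] by blast
        let ?p = "p * r ^ nat \<bar>L w\<bar>"
        have val: "v (ev x ?p) = v (ev x p) + int (nat \<bar>L w\<bar>) * v (ev x r)" if "v \<in> pl" for v
          using that x p r by (simp add: place_mult place_power transcendental)
        have "L v \<le> v (ev x ?p)" if "v \<in> insert w K" "0 \<le> v x" for v
        proof -
          have v: "v \<in> pl" using that insert by auto
          show ?thesis
          proof (cases "v = w")
            case True
            have "\<bar>L w\<bar> * 1 \<le> \<bar>L w\<bar> * w (ev x r)" 
              using r by (intro mult_left_mono) auto
            then have "L w \<le> \<bar>L w\<bar> * w (ev x r)" by linarith
            then show ?thesis
              unfolding val[OF v] using True ev_nonneg[OF v that(2) p(1)] by simp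
          next
            case False
            then have "L v \<le> v (ev x p)" using p that by auto
            then show ?thesis
              unfolding val[OF v] using ev_nonneg[OF v that(2) r(1)]
              by (simp add: add_increasing2)
          qed
        qed
        then show ?thesis using p r by (intro exI[of _ ?p]) auto
      next
        case False
        then show ?thesis using p by auto
      qed
    qed
    then obtain p where p: "p \<noteq> 0" "\<And>v. v \<in> K \<Longrightarrow> 0 \<le> v x \<Longrightarrow> L v \<le> v (ev x p)" by blast
    have p0: "ev x p \<noteq> 0" "ev x p \<in> F" using transcendental[OF p(1)] x by auto
    define n where "n = n0 + (\<Sum>v\<in>K. nat \<bar>L v\<bar>)"
    \<comment> \<open>\<open>D'\<close> dominates the given divisor: zeros of a polynomial take care of the places not above
       infinity, a multiple of the pole divisor of the others.\<close>
    define D' where "D' v = (if 0 \<le> v x then v (ev x p) else - (int n * v x))" for v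
    have LD': "L v \<le> D' v" if v: "v \<in> pl" for v
    proof (cases "v \<in> K")
      case True
      show ?thesis
      proof (cases "0 \<le> v x")
        case False
        have "nat \<bar>L v\<bar> \<le> (\<Sum>v\<in>K. nat \<bar>L v\<bar>)"
          using K True by (intro member_le_sum) auto
        then have "nat \<bar>L v\<bar> \<le> n" by (simp add: n_def)
        then have "L v \<le> int n" by linarith
        also have "int n * 1 \<le> int n * - v x" using False by (intro mult_left_mono) auto
        finally show ?thesis using False by (simp add: D'_def)
      qed (use p True in \<open>simp add: D'_def\<close>)
    next
      case False
      show ?thesis
        using L0[OF False] ev_nonneg[OF v _ p(1)] by (auto simp: D'_def mult_nonneg_nonpos)
    qed
    \<comment> \<open>Multiplication by the polynomial identifies \<open>L(D')\<close> with the space of a multiple of the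
       pole divisor.\<close>
    let ?k = "n + degree p"
    have shift: "(f \<in> Lsp D') = (ev x p * f \<in> Lsp (pole_multiple x ?k))" for f
    proof (cases "f \<in> F \<and> f \<noteq> 0")
      case True
      have "f \<in> ball v (- D' v) \<longleftrightarrow> ev x p * f \<in> ball v (- pole_multiple x ?k v)" if v: "v \<in> pl" for v
      proof (cases "0 \<le> v x")
        case True
        then show ?thesis
          using \<open>f \<in> F \<and> f \<noteq> 0\<close> p0 v
          by (auto simp: ball_def place_mult D'_def pole_multiple_def)
      next
        case False
        then have "v (ev x p) = int (degree p) * v x"
          using place_ev_pole[OF v x(1) _ p(1)] by simp
        then show ?thesis
          using \<open>f \<in> F \<and> f \<noteq> 0\<close> p0 v False
          by (auto simp: ball_def place_mult D'_def pole_multiple_def algebra_simps)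
      qed
      then show ?thesis using True p0 by (auto simp: Lsp_def)
    next
      case False
      have "ev x p * f \<notin> F" if "f \<notin> F"
      proof
        assume "ev x p * f \<in> F"
        then have "inverse (ev x p) * (ev x p * f) \<in> F"
          by (rule mult_in[OF inverse_in[OF p0(2)]])
        moreover have "inverse (ev x p) * (ev x p * f) = f" using p0 by (simp flip: mult.assoc)
        ultimately show False using that by simp
      qed
      then show ?thesis using False by (auto simp: Lsp_def)
    qed
    have "bij_betw (\<lambda>f. ev x p * f) (Lsp D') (Lsp (pole_multiple x ?k))"
      using p0(1) by (intro bij_betwI[where g = "\<lambda>f. f / ev x p"]) (auto simp: shift)
    then have cardD': "card (Lsp D') = CARD('a) ^ m ?k" and finD': "finite (Lsp D')"
      using card[of ?k] finL[of ?k] by (auto simp: n_def bij_betw_same_card bij_betw_finite)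
    have sub: "Lsp L \<subseteq> Lsp D'" using LD' by (rule Lsp_mono)
    have finLL: "finite (Lsp L)" using finD' sub finite_subset by blast
    define Z where "Z = {v \<in> pl. 0 < v (ev x p)}"
    have Z: "finite Z" "Z \<subseteq> pl" using finite_zeros[OF p0(2)] by (auto simp: Z_def)
    define S where "S = Z \<union> Inf \<union> K"
    have S: "finite S" "S \<subseteq> pl" using Z Inf K by (auto simp: S_def)
    have off: "D' v = L v" if "v \<in> pl - S" for v
    proof -
      have v: "v \<in> pl" "v \<notin> K" "0 \<le> v x" "\<not> 0 < v (ev x p)"
        using that by (auto simp: S_def Z_def Inf_def)
      then show ?thesis
        using ev_nonneg[OF v(1,3) p(1)] L0[OF v(2)] by (simp add: D'_def)
    qed
    have "card (Lsp D') \<le> card (Lsp L) * CARD('a) ^ nat (\<Sum>v\<in>S. (D' v - L v) * ?deg v)"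
      by (rule Lsp_increase(2)[OF S finLL]) (simp add: off, rule LD', use S in blast)
    then have "CARD('a) ^ m ?k \<le> CARD('a) ^ (dimL L + nat (\<Sum>v\<in>S. (D' v - L v) * ?deg v))"
      by (simp add: cardD' card_finite_subspace[OF subspace_Lsp finLL] dimL_def power_add)
    then have "m ?k \<le> dimL L + nat (\<Sum>v\<in>S. (D' v - L v) * ?deg v)" by (rule q_le)
    moreover have "0 \<le> (\<Sum>v\<in>S. (D' v - L v) * ?deg v)"
      using S LD' by (intro sum_nonneg) auto
    ultimately have main: "int (m ?k) \<le> int (dimL L) + (\<Sum>v\<in>S. (D' v - L v) * ?deg v)" by linarith
    have "(\<Sum>v\<in>S. (D' v - L v) * ?deg v) = (\<Sum>v\<in>S. D' v * ?deg v) - (\<Sum>v\<in>S. L v * ?deg v)"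
      by (simp add: left_diff_distrib sum_subtractf)
    moreover have "(\<Sum>v\<in>S. L v * ?deg v) = divisor_degree \<kappa> F D"
      unfolding divisor_degree_def L_def[symmetric] K_def[symmetric]
      using S L0 by (intro sum.mono_neutral_right) (auto simp: S_def)
    moreover have "(\<Sum>v\<in>S. D' v * ?deg v) \<le> int (e * degree p) + int n * int e"
    proof -
      have "(\<Sum>v\<in>S. D' v * ?deg v) = (\<Sum>v\<in>S - Inf. D' v * ?deg v) + (\<Sum>v\<in>Inf. D' v * ?deg v)"
        using S by (intro sum.subset_diff) (auto simp: S_def)
      moreover have "(\<Sum>v\<in>Inf. D' v * ?deg v) = int n * E"
        unfolding E_def sum_distrib_left by (intro sum.cong) (auto simp: D'_def Inf_def)
      moreover have "(\<Sum>v\<in>S - Inf. D' v * ?deg v) = (\<Sum>v\<in>Z - Inf. v (ev x p) * ?deg v)"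
      proof -
        have "(\<Sum>v\<in>S - Inf. D' v * ?deg v) = (\<Sum>v\<in>S - Inf. v (ev x p) * ?deg v)"
          using S by (intro sum.cong) (auto simp: D'_def Inf_def)
        also have "\<dots> = (\<Sum>v\<in>Z - Inf. v (ev x p) * ?deg v)"
        proof (rule sum.mono_neutral_right)
          show "\<forall>v\<in>S - Inf - (Z - Inf). v (ev x p) * ?deg v = 0"
          proof
            fix v assume v: "v \<in> S - Inf - (Z - Inf)"
            then have "v \<in> pl" "\<not> 0 < v (ev x p)" "0 \<le> v x" using S by (auto simp: Z_def Inf_def)
            then have "v (ev x p) = 0" using ev_nonneg[of v p] p(1) by simp
            then show "v (ev x p) * ?deg v = 0" by simp
          qed
        qed (use S in \<open>auto simp: S_def\<close>)
        finally show ?thesis .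
      qed
      moreover have "(\<Sum>v\<in>Z - Inf. v (ev x p) * ?deg v) \<le> int (e * degree p)"
        using Z by (intro zero_degree_le[OF p0(2) deg_poly[OF p(1)]]) (auto simp: Z_def)
      ultimately show ?thesis unfolding E by linarith
    qed
    moreover have "int (m ?k) = int (e * ?k) + 1 - g" by (intro m) (simp add: n_def)
    ultimately show ?thesis
      using main unfolding L_def by (simp add: algebra_simps)
  qed

  define L where "L = pole_multiple x n0"
  define D where "D = Abs_poly_mapping L"
  have "{v. L v \<noteq> 0} \<subseteq> Inf" by (auto simp: L_def pole_multiple_def Inf_def)
  then have finite_support: "finite {v. L v \<noteq> 0}" using Inf finite_subset by blast
  then have lookup: "Poly_Mapping.lookup D = L" by (simp add: D_def)
  have keys: "Poly_Mapping.keys D \<subseteq> Inf"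
    using \<open>{v. L v \<noteq> 0} \<subseteq> Inf\<close> by (auto simp: in_keys_iff lookup)
  then have D: "D \<in> divisors \<kappa> F" using Inf by (auto simp: divisors_def)
  have "divisor_degree \<kappa> F D = (\<Sum>v\<in>Inf. L v * ?deg v)"
    unfolding divisor_degree_def lookup
    using Inf keys by (intro sum.mono_neutral_left) (auto simp: in_keys_iff lookup)
  also have "\<dots> = int n0 * E"
    unfolding E_def sum_distrib_left
    by (intro sum.cong) (auto simp: L_def pole_multiple_def Inf_def)
  finally have degD: "divisor_degree \<kappa> F D = int (e * n0)" by (simp add: E)
  have "dimL L = m n0"
  proof (rule q_eq)
    have "card (Lsp L) = CARD('a) ^ dimL L"
      unfolding dimL_def L_def by (rule card_finite_subspace[OF subspace_Lsp finL[OF order_refl]])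
    then show "CARD('a) ^ dimL L = CARD('a) ^ m n0"
      using card[OF order_refl] by (simp only: L_def)
  qed
  then have attained: "g = divisor_degree \<kappa> F D - int (dimL (Poly_Mapping.lookup D)) + 1"
    using m[of n0] by (simp add: degD lookup)
  show ?thesis
    unfolding genus_def riemann_roch_space_eq dimL_def[symmetric]
    using attained D upper by (intro Greatest_equality) auto
qed

end

section \<open>The place at infinity of the rational function field\<close>

lemma fract_cases:
  fixes r :: "'a::field poly fract"
  obtains p q where "q \<noteq> 0" "r = to_fract p / to_fract q"
  by (cases r rule: Fract_cases) (auto simp: Fract_conv_to_fract)

lemma field_embedding_rat_const: "field_embedding rat_const"
proof -
  have "[:a * b:] = [:a:] * [:b:]" for a b :: 'a by simp
  moreover have "[:a + b:] = [:a:] + [:b:]" for a b :: 'a by simp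
  ultimately show ?thesis
    by (simp only: field_embedding_def rat_const_def to_fract_add to_fract_mult) (simp add: one_pCons[symmetric])
qed

interpretation rat: constant_field rat_const "UNIV :: 'a::field poly fract set"
  by unfold_locales (auto simp: is_subfield_def field_embedding_rat_const)

lemma rat_ev: "rat.ev rat_x p = to_fract p"
proof (induction p)
  case (pCons c p)
  have "pCons c p = [:c:] + [:0, 1:] * p" by simp
  then have "to_fract (pCons c p) = rat_const c + rat_x * to_fract p"
    by (simp only: rat_const_def rat_x_def to_fract_add to_fract_mult)
  then show ?case
    using pCons by simp
qed simp

text \<open>
  The degree of a fraction with the sign reversed, so that it becomes the place at infinity.
\<close>

definition neg_degree :: "'a::field poly fract \<Rightarrow> int" where
  "neg_degree r = (if r = 0 then 0 else
     (THE n. \<exists>p q. p \<noteq> 0 \<and> q \<noteq> 0 \<and> r = to_fract p / to_fract q \<and> n = int (degree q) - int (degree p)))"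

lemma neg_degree_eq:
  assumes "p \<noteq> 0" "q \<noteq> 0"
  shows "neg_degree (to_fract p / to_fract q) = int (degree q) - int (degree p)"
proof -
  let ?r = "to_fract p / to_fract q"
  have "?r \<noteq> 0" using assms by simp
  moreover have "(THE n. \<exists>p q. p \<noteq> 0 \<and> q \<noteq> 0 \<and> ?r = to_fract p / to_fract q \<and>
      n = int (degree q) - int (degree p)) = int (degree q) - int (degree p)"
  proof (rule the_equality)
    fix n assume "\<exists>p q. p \<noteq> 0 \<and> q \<noteq> 0 \<and> ?r = to_fract p / to_fract q \<and>
      n = int (degree q) - int (degree p)"
    then obtain p' q' where *: "p' \<noteq> 0" "q' \<noteq> 0" "?r = to_fract p' / to_fract q'"
      "n = int (degree q') - int (degree p')" by blast
    then have "to_fract (p * q') = to_fract (p' * q)"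
      using assms by (simp add: field_simps)
    then have "p * q' = p' * q" by (simp only: to_fract_eq_iff)
    then have "degree p + degree q' = degree p' + degree q"
      using assms * by (metis degree_mult_eq)
    then show "n = int (degree q) - int (degree p)" using * by linarith
  qed (use assms in blast)
  ultimately show ?thesis by (simp add: neg_degree_def)
qed

lemma neg_degree_to_fract: "p \<noteq> 0 \<Longrightarrow> neg_degree (to_fract p) = - int (degree p)"
  using neg_degree_eq[of p 1] by simp

lemma neg_degree_place: "neg_degree \<in> places rat_const UNIV"
proof -
  have mult: "neg_degree (a * b) = neg_degree a + neg_degree b" if ab: "a \<noteq> 0" "b \<noteq> 0" for a b :: "'a poly fract"
  proof -
    obtain p q where a: "q \<noteq> 0" "a = to_fract p / to_fract q" by (rule fract_cases)
    obtain p' q' where b: "q' \<noteq> 0" "b = to_fract p' / to_fract q'" by (rule fract_cases)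
    have p: "p \<noteq> 0" "p' \<noteq> 0" using a b ab by auto
    have "a * b = to_fract (p * p') / to_fract (q * q')" using a b by simp
    then show ?thesis
      using a b p neg_degree_eq[of "p * p'" "q * q'"] by (simp add: neg_degree_eq degree_mult_eq)
  qed
  have add: "min (neg_degree a) (neg_degree b) \<le> neg_degree (a + b)"
    if ab: "a \<noteq> 0" "b \<noteq> 0" "a + b \<noteq> 0" for a b :: "'a poly fract"
  proof -
    obtain p q where a: "q \<noteq> 0" "a = to_fract p / to_fract q" by (rule fract_cases)
    obtain p' q' where b: "q' \<noteq> 0" "b = to_fract p' / to_fract q'" by (rule fract_cases)
    have p: "p \<noteq> 0" "p' \<noteq> 0" using a b ab by auto
    have sum: "a + b = to_fract (p * q' + p' * q) / to_fract (q * q')"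
      using a b by (simp add: field_simps)
    have nz: "p * q' + p' * q \<noteq> 0"
    proof
      assume "p * q' + p' * q = 0"
      then have "a + b = 0" unfolding sum by (simp only: to_fract_0 div_0)
      then show False using ab by simp
    qed
    have "degree (p * q' + p' * q) \<le> max (degree (p * q')) (degree (p' * q))"
      by (rule degree_add_le_max)
    moreover have "degree (p * q') = degree p + degree q'" "degree (p' * q) = degree p' + degree q"
      "degree (q * q') = degree q + degree q'"
      using a b p by (auto simp: degree_mult_eq)
    moreover have "neg_degree (a + b) = int (degree (q * q')) - int (degree (p * q' + p' * q))"
      unfolding sum using nz a b by (intro neg_degree_eq) auto
    ultimately show ?thesis
      using a b p by (simp add: neg_degree_eq)
  qed
  have const: "neg_degree (rat_const c) = 0" if "c \<noteq> 0" for c :: 'a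
    using that neg_degree_to_fract[of "[:c:]"] by (simp add: rat_const_def)
  have "neg_degree (1 / rat_x :: 'a poly fract) = 1"
    using neg_degree_eq[of 1 "[:0, 1:] :: 'a poly"] by (simp add: rat_x_def)
  moreover have "1 / rat_x \<noteq> (0 :: 'a poly fract)" by (simp add: rat_x_def)
  ultimately have unif: "\<exists>t\<in>UNIV - {0 :: 'a poly fract}. neg_degree t = 1" by blast
  show ?thesis
    unfolding places_def using mult add const unif by (auto simp: neg_degree_def)
qed

text \<open>
  A place with \<open>w (1 / x) = 1\<close> has a simple pole at \<open>x\<close>, which determines it on polynomials.
\<close>

lemma infinite_place_eq: "infinite_place = (neg_degree :: 'a::field poly fract \<Rightarrow> int)"
  unfolding infinite_place_def
proof (rule the_equality)
  have "neg_degree (1 / rat_x :: 'a poly fract) = 1"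
    using neg_degree_eq[of 1 "[:0, 1:] :: 'a poly"] by (simp add: rat_x_def)
  then show "neg_degree \<in> places rat_const UNIV \<and> neg_degree (1 / rat_x :: 'a poly fract) = 1"
    using neg_degree_place by blast
next
  fix w :: "'a poly fract \<Rightarrow> int"
  assume w: "w \<in> places rat_const UNIV \<and> w (1 / rat_x) = 1"
  then have wp: "w \<in> places rat_const UNIV" by blast
  have "w (inverse rat_x) = 1" using w by (simp add: inverse_eq_divide)
  then have wx: "w rat_x = - 1" using rat.place_inverse[OF wp, of rat_x] by simp
  have poly: "w (to_fract p) = - int (degree p)" if "p \<noteq> 0" for p
    using rat.place_ev_pole[OF wp, of rat_x p] wx that by (simp add: rat_ev)
  show "w = neg_degree"
  proof
    fix r
    show "w r = neg_degree r"
    proof (cases "r = 0")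
      case False
      obtain p q where r: "q \<noteq> 0" "r = to_fract p / to_fract q" by (rule fract_cases)
      then have "p \<noteq> 0" using False by auto
      then show ?thesis
        using r by (simp add: rat.place_divide[OF wp] poly neg_degree_eq)
    qed (use rat.place_zero[OF wp] in \<open>simp add: neg_degree_def\<close>)
  qed
qed

text \<open>
  Degree bounds for rational functions are balls of the place at infinity; the ring of functions
  without a pole at infinity is \<open>deg_le 0\<close>.
\<close>

definition deg_le :: "int \<Rightarrow> 'a::field poly fract set" where
  "deg_le m = rat.ball neg_degree (- m)"

lemma deg_le_iff: "r \<in> deg_le m \<longleftrightarrow> r = 0 \<or> - neg_degree r \<le> m"
  by (auto simp: deg_le_def rat.ball_def)

lemma zero_deg_le [simp]: "0 \<in> deg_le m"
  by (simp add: deg_le_iff)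

lemma deg_le_mono: "r \<in> deg_le m \<Longrightarrow> m \<le> n \<Longrightarrow> r \<in> deg_le n"
  by (auto simp: deg_le_iff)

lemma deg_le_add: "r \<in> deg_le m \<Longrightarrow> s \<in> deg_le m \<Longrightarrow> r + s \<in> deg_le m"
  unfolding deg_le_def by (rule rat.ball_add[OF neg_degree_place])

lemma deg_le_diff: "r \<in> deg_le m \<Longrightarrow> s \<in> deg_le m \<Longrightarrow> r - s \<in> deg_le m"
  unfolding deg_le_def by (rule rat.ball_diff[OF neg_degree_place])

lemma deg_le_mult: "r \<in> deg_le m \<Longrightarrow> s \<in> deg_le n \<Longrightarrow> r * s \<in> deg_le (m + n)"
  unfolding deg_le_def using rat.ball_mult[OF neg_degree_place, of r "- m" s "- n"] by simp

lemma deg_le_to_fract: "to_fract p \<in> deg_le m \<longleftrightarrow> p = 0 \<or> int (degree p) \<le> m"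
  by (cases "p = 0") (auto simp: deg_le_iff neg_degree_to_fract)

lemma neg_degree_mult: "r \<noteq> 0 \<Longrightarrow> s \<noteq> 0 \<Longrightarrow> neg_degree (r * s) = neg_degree r + neg_degree s"
  using rat.place_mult[OF neg_degree_place] by auto

lemma deg_le_divide_to_fract:
  assumes "q \<noteq> 0"
  shows "r / to_fract q \<in> deg_le m \<longleftrightarrow> r \<in> deg_le (m + int (degree q))"
  using assms rat.place_divide[OF neg_degree_place, of r "to_fract q"]
  by (cases "r = 0") (auto simp: deg_le_iff neg_degree_to_fract)

lemma rational_root_is_polynomial:
  fixes r :: "'a::field poly fract"
  assumes root: "r ^ 3 - to_fract A * r + to_fract B = 0"
  shows "\<exists>p. r = to_fract p"
proof -
  \<comment> \<open>The common denominators of \<open>r\<close> and \<open>r\<^sup>2\<close> form an ideal stable under \<open>r\<close>; a generator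
     \<open>g\<close> of it then divides \<open>g * r\<close>.\<close>
  define J where "J g \<longleftrightarrow> (\<exists>h1 h2. to_fract g * r = to_fract h1 \<and> to_fract g * r\<^sup>2 = to_fract h2)" for g
  obtain p q where pq: "q \<noteq> 0" "r = to_fract p / to_fract q" by (rule fract_cases)
  have "to_fract (q\<^sup>2) * r = to_fract (p * q)" "to_fract (q\<^sup>2) * r\<^sup>2 = to_fract (p\<^sup>2)"
    using pq by (auto simp: power2_eq_square)
  then have "J (q\<^sup>2)" unfolding J_def by blast
  moreover have "q\<^sup>2 \<noteq> 0" using pq by simp
  ultimately obtain g where g: "J g" "g \<noteq> 0"
    and gmin: "\<And>h. J h \<Longrightarrow> h \<noteq> 0 \<Longrightarrow> degree g \<le> degree h"
    using ex_has_least_nat[of "\<lambda>g. J g \<and> g \<noteq> 0" "q\<^sup>2" degree] by blast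
  obtain h1 h2 where h: "to_fract g * r = to_fract h1" "to_fract g * r\<^sup>2 = to_fract h2"
    using g by (auto simp: J_def)
  have J_mult: "J (a * b)" if "J b" for a b
  proof -
    obtain u1 u2 where "to_fract b * r = to_fract u1" "to_fract b * r\<^sup>2 = to_fract u2"
      using \<open>J b\<close> by (auto simp: J_def)
    then have "to_fract (a * b) * r = to_fract (a * u1)" "to_fract (a * b) * r\<^sup>2 = to_fract (a * u2)"
      by (auto simp: mult.assoc)
    then show ?thesis unfolding J_def by blast
  qed
  have J_diff: "J (a - b)" if "J a" "J b" for a b
  proof -
    obtain u1 u2 where "to_fract a * r = to_fract u1" "to_fract a * r\<^sup>2 = to_fract u2"
      using \<open>J a\<close> by (auto simp: J_def)
    moreover obtain w1 w2 where "to_fract b * r = to_fract w1" "to_fract b * r\<^sup>2 = to_fract w2"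
      using \<open>J b\<close> by (auto simp: J_def)
    ultimately have "to_fract (a - b) * r = to_fract (u1 - w1)" "to_fract (a - b) * r\<^sup>2 = to_fract (u2 - w2)"
      by (auto simp: left_diff_distrib)
    then show ?thesis unfolding J_def by blast
  qed
  have "r ^ 3 = to_fract A * r - to_fract B" using root by (simp add: algebra_simps eq_neg_iff_add_eq_0)
  then have "to_fract h1 * r\<^sup>2 = to_fract g * (to_fract A * r - to_fract B)"
    unfolding h(1)[symmetric] by (simp add: power2_eq_square power3_eq_cube mult.assoc)
  also have "\<dots> = to_fract A * (to_fract g * r) - to_fract (g * B)"
    by (simp add: algebra_simps)
  also have "\<dots> = to_fract (A * h1 - g * B)" by (simp add: h)
  finally have "to_fract h1 * r\<^sup>2 = to_fract (A * h1 - g * B)" .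
  moreover have "to_fract h1 * r = to_fract h2"
    unfolding h(1)[symmetric] h(2)[symmetric] by (simp add: power2_eq_square)
  ultimately have "J h1" unfolding J_def by blast
  then have "J (h1 - (h1 div g) * g)" using J_mult[OF g(1)] J_diff by blast
  then have "J (h1 mod g)" by (simp add: minus_div_mult_eq_mod)
  then have "h1 mod g = 0"
    using gmin[of "h1 mod g"] degree_mod_less[of g h1] g(2) by fastforce
  then have "h1 = g * (h1 div g)" by (metis mult_div_mod_eq add.right_neutral)
  then have "to_fract g * r = to_fract g * to_fract (h1 div g)"
    using h(1) by (metis to_fract_mult)
  then show ?thesis using g(2) by auto
qed

text \<open>
  A root in \<open>k(x)\<close> is a polynomial, and splits off a linear factor over every field containing \<open>k\<close>.
\<close>

lemma no_root_if_absolutely_irreducible: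
  assumes "absolutely_irreducible (cubic A B)"
  shows "r ^ 3 - to_fract A * r + to_fract B \<noteq> 0"
proof
  assume "r ^ 3 - to_fract A * r + to_fract B = 0"
  then obtain p where "r = to_fract p" "r ^ 3 - to_fract A * r + to_fract B = 0"
    using rational_root_is_polynomial by blast
  then have "to_fract (p ^ 3 - A * p + B) = 0" by (simp add: power3_eq_cube)
  then have root: "p ^ 3 - A * p + B = 0" by (simp only: to_fract_eq_0_iff)
  interpret ac: embedding "to_ac :: 'a \<Rightarrow> _"
    by unfold_locales (simp add: field_embedding_def)
  let ?\<phi> = "map_poly to_ac"
  have \<phi>_add: "?\<phi> (a + b) = ?\<phi> a + ?\<phi> b" for a b :: "'a poly"
    by (intro poly_eqI) (simp add: coeff_map_poly)
  have \<phi>_minus: "?\<phi> (- a) = - ?\<phi> a" for a :: "'a poly"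
    by (intro poly_eqI) (simp add: coeff_map_poly)
  have \<phi>_mult: "?\<phi> (a * b) = ?\<phi> a * ?\<phi> b" for a b :: "'a poly"
    by (intro poly_eqI) (simp add: coeff_map_poly coeff_mult to_ac_sum)
  have B: "B = - (p * (p * p - A))" using root by (simp add: power3_eq_cube algebra_simps eq_neg_iff_add_eq_0)
  let ?s = "?\<phi> p"
  have "map_poly ?\<phi> (cubic A B) = [:?\<phi> B, - ?\<phi> A, 0, 1:]"
    by (simp add: cubic_def map_poly_pCons \<phi>_minus)
  also have "?\<phi> B = - (?s * (?s * ?s - ?\<phi> A))"
    unfolding B diff_conv_add_uminus by (simp only: \<phi>_add \<phi>_minus \<phi>_mult)
  also have "[:- (?s * (?s * ?s - ?\<phi> A)), - ?\<phi> A, 0, 1:] = [:- ?s, 1:] * [:?s * ?s - ?\<phi> A, ?s, 1:]"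
    by (simp add: algebra_simps)
  finally have factor: "map_poly ?\<phi> (cubic A B) = [:- ?s, 1:] * [:?s * ?s - ?\<phi> A, ?s, 1:]" .
  have "irreducible (map_poly ?\<phi> (cubic A B))"
    using assms by (simp add: absolutely_irreducible_def)
  then have "[:- ?s, 1:] dvd 1 \<or> [:?s * ?s - ?\<phi> A, ?s, 1:] dvd 1"
    unfolding factor by (rule irreducibleD[OF _ refl])
  then show False
    by (auto simp: is_unit_poly_iff)
qed


section \<open>Cubic extensions of the rational function field\<close>

locale cubic_extension = embedding \<iota>
  for \<iota> :: "'a::{finite, field} poly fract \<Rightarrow> 'l::field" +
  fixes A B :: "'a poly" and y :: 'l
  assumes root: "y ^ 3 = \<iota> (to_fract A) * y - \<iota> (to_fract B)"
    and no_root: "\<And>r. r ^ 3 - to_fract A * r + to_fract B \<noteq> 0"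
begin

definition j :: "'a poly \<Rightarrow> 'l" where "j p = \<iota> (to_fract p)"

lemma j_simps [simp]: "j 0 = 0" "j 1 = 1" "j (p + q) = j p + j q" "j (p - q) = j p - j q"
    "j (- p) = - j p" "j (p * q) = j p * j q" "j (p ^ n) = j p ^ n" "j p = 0 \<longleftrightarrow> p = 0" "j p = j q \<longleftrightarrow> p = q"
proof -
  show "j (p ^ n) = j p ^ n" by (induction n) (auto simp: j_def)
qed (auto simp: j_def)

definition elt :: "'a poly fract \<Rightarrow> 'a poly fract \<Rightarrow> 'a poly fract \<Rightarrow> 'l" where
  "elt a b c = \<iota> a + \<iota> b * y + \<iota> c * y\<^sup>2"

lemma y3: "y * (y * y) = j A * y - j B"
  using root by (simp add: power3_eq_cube j_def mult.assoc)

lemma not_rational: "\<iota> r \<noteq> y"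
proof
  assume "\<iota> r = y"
  then have "\<iota> (r ^ 3 - to_fract A * r + to_fract B) = 0"
    using root by simp
  then show False
    using no_root[of r] by (simp only: map_eq_0_iff)
qed

text \<open>
  A relation \<open>y\<^sup>2 = \<beta> y + \<gamma>\<close> would make \<open>T\<^sup>2 - \<beta> T - \<gamma>\<close> a factor of the cubic, with cofactor
  \<open>T + \<beta>\<close>, and \<open>- \<beta>\<close> would be a rational root.
\<close>

lemma elt_eq_0:
  assumes "elt a b c = 0"
  shows "a = 0 \<and> b = 0 \<and> c = 0"
proof -
  have lin: "b = 0 \<and> a = 0" if "\<iota> a + \<iota> b * y = 0" for a b
  proof (cases "b = 0")
    case False
    have "\<iota> b * y = - \<iota> a"
      using that by (simp add: eq_neg_iff_add_eq_0 add.commute)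
    then have "\<iota> (- (a / b)) = y"
      using False by (simp add: field_simps)
    then show ?thesis using not_rational by blast
  qed (use that in simp)
  have "c = 0"
  proof (rule ccontr)
    assume c: "c \<noteq> 0"
    define \<beta> \<gamma> where "\<beta> = - (b / c)" and "\<gamma> = - (a / c)"
    have y2: "y * y = \<iota> \<beta> * y + \<iota> \<gamma>"
    proof -
      have "(y * y) * \<iota> c = - (\<iota> b * y + \<iota> a)"
        using assms unfolding eq_neg_iff_add_eq_0 elt_def power2_eq_square by (simp only: ac_simps)
      then have "y * y = - (\<iota> b * y + \<iota> a) / \<iota> c"
        using c by (simp only: nonzero_eq_divide_eq map_eq_0_iff not_False_eq_True)
      then show ?thesis
        by (simp add: \<beta>_def \<gamma>_def add_divide_distrib diff_divide_distrib)
    qed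
    have "y * (y * y) = y * (\<iota> \<beta> * y + \<iota> \<gamma>)"
      by (simp only: y2)
    also have "\<dots> = \<iota> \<beta> * (y * y) + \<iota> \<gamma> * y"
      by (simp add: algebra_simps)
    also have "\<dots> = \<iota> (\<beta> * \<beta> + \<gamma>) * y + \<iota> (\<beta> * \<gamma>)"
      unfolding y2 by (simp add: algebra_simps)
    finally have "\<iota> (\<beta> * \<gamma> + to_fract B) + \<iota> (\<beta> * \<beta> + \<gamma> - to_fract A) * y = 0"
      unfolding y3 by (simp add: j_def algebra_simps)
    then have "\<beta> * \<beta> + \<gamma> - to_fract A = 0" "\<beta> * \<gamma> + to_fract B = 0"
      using lin by blast+
    then have A: "to_fract A = \<beta> * \<beta> + \<gamma>" and B: "to_fract B = - (\<beta> * \<gamma>)"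
      by (simp_all add: eq_neg_iff_add_eq_0 add.commute)
    have "(- \<beta>) ^ 3 - to_fract A * (- \<beta>) + to_fract B = 0"
      unfolding A B by (simp add: power3_eq_cube algebra_simps)
    then show False using no_root by blast
  qed
  then show ?thesis using lin[of a b] assms by (simp add: elt_def)
qed

lemma elt_add: "elt a b c + elt a' b' c' = elt (a + a') (b + b') (c + c')"
  and elt_diff: "elt a b c - elt a' b' c' = elt (a - a') (b - b') (c - c')"
  and elt_scale: "\<iota> r * elt a b c = elt (r * a) (r * b) (r * c)"
  by (auto simp: elt_def algebra_simps)

lemma elt_mult_y: "y * elt a b c = elt (- (c * to_fract B)) (a + c * to_fract A) b"
proof -
  have "y * elt a b c = \<iota> a * y + \<iota> b * y\<^sup>2 + \<iota> c * (y * (y * y))"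
    by (simp add: elt_def power2_eq_square algebra_simps)
  then show ?thesis
    unfolding y3 by (simp add: elt_def j_def algebra_simps)
qed

lemma elt_inject: "elt a b c = elt a' b' c' \<longleftrightarrow> a = a' \<and> b = b' \<and> c = c'"
proof
  assume "elt a b c = elt a' b' c'"
  then have "elt (a - a') (b - b') (c - c') = 0"
    by (simp flip: elt_diff)
  then show "a = a' \<and> b = b' \<and> c = c'"
    using elt_eq_0[of "a - a'" "b - b'" "c - c'"] by simp
qed simp

lemma elt_mult: "elt a b c * elt a' b' c' =
    elt (a * a') (a * b') (a * c') + y * (elt (b * a') (b * b') (b * c') + y * elt (c * a') (c * b') (c * c'))"
  by (simp add: elt_def power2_eq_square algebra_simps)

definition F :: "'l set" where "F = {elt a b c | a b c. True}"

lemma elt_in_F: "elt a b c \<in> F"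
  by (auto simp: F_def)

lemma F_cases:
  assumes "z \<in> F"
  obtains a b c where "z = elt a b c"
  using assms by (auto simp: F_def)

lemma F_mult: "z \<in> F \<Longrightarrow> w \<in> F \<Longrightarrow> z * w \<in> F"
  by (elim F_cases) (simp add: elt_mult elt_mult_y elt_add elt_in_F)

sublocale K: vector_space "\<lambda>c z. \<iota> c * z"
  by unfold_locales (auto simp: algebra_simps)

lemma span_three: "K.span {u, v, w} = {\<iota> a * u + \<iota> b * v + \<iota> c * w | a b c. True}"
proof -
  have "z \<in> K.span {u, v, w} \<longleftrightarrow> (\<exists>a b c. z = \<iota> a * u + \<iota> b * v + \<iota> c * w)" for z
  proof -
    have "z \<in> K.span {u, v, w} \<longleftrightarrow> (\<exists>a b c. z - \<iota> a * u - \<iota> b * v - \<iota> c * w = 0)"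
      by (simp add: K.span_insert)
    also have "\<dots> \<longleftrightarrow> (\<exists>a b c. z = \<iota> a * u + \<iota> b * v + \<iota> c * w)"
      by (intro arg_cong[of _ _ Ex] ext) (auto simp: algebra_simps)
    finally show ?thesis .
  qed
  then show ?thesis by blast
qed

lemma span_basis: "K.span {1, y, y\<^sup>2} = F"
  unfolding span_three F_def elt_def by simp

lemma independent_multiples:
  assumes "z \<noteq> 0"
  shows "K.independent {z, z * y, z * y\<^sup>2}" and "card {z, z * y, z * y\<^sup>2} = 3"
proof -
  have zero: "a = 0 \<and> b = 0 \<and> c = 0" if "\<iota> a * z + \<iota> b * (z * y) + \<iota> c * (z * y\<^sup>2) = 0" for a b c
  proof -
    have "z * elt a b c = 0" using that by (simp add: elt_def algebra_simps)
    then show ?thesis using assms elt_eq_0 by simp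
  qed
  have "z \<noteq> z * y"
    using zero[of 1 "- 1" 0] by auto
  moreover have "z \<noteq> z * y\<^sup>2"
    using zero[of 1 0 "- 1"] by auto
  moreover have "z * y \<noteq> z * y\<^sup>2"
    using zero[of 0 1 "- 1"] by auto
  ultimately have dist: "z \<noteq> z * y" "z \<noteq> z * y\<^sup>2" "z * y \<noteq> z * y\<^sup>2" by auto
  then show "card {z, z * y, z * y\<^sup>2} = 3"
    by (simp only: card_insert_if finite.intros insert_iff empty_iff card.empty) auto
  show "K.independent {z, z * y, z * y\<^sup>2}"
  proof (rule K.independent_if_scalars_zero)
    fix f u assume sum: "(\<Sum>v\<in>{z, z * y, z * y\<^sup>2}. \<iota> (f v) * v) = 0" and u: "u \<in> {z, z * y, z * y\<^sup>2}"
    have "\<iota> (f z) * z + \<iota> (f (z * y)) * (z * y) + \<iota> (f (z * y\<^sup>2)) * (z * y\<^sup>2) = 0"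
      using sum dist by (simp add: add.assoc del: mult_cancel_left1 mult_cancel_left)
    then show "f u = 0" using zero u by blast
  qed simp
qed

text \<open>
  The multiples \<open>z, z y, z y\<^sup>2\<close> are independent in a three-dimensional space, so \<open>1\<close> is one of their
  combinations.
\<close>

lemma F_inverse:
  assumes z: "z \<in> F"
  shows "inverse z \<in> F"
proof (cases "z = 0")
  case False
  let ?S = "{z, z * y, z * y\<^sup>2}"
  have yF: "y \<in> F" "y\<^sup>2 \<in> F" "1 \<in> F"
    using elt_in_F[of 0 1 0] elt_in_F[of 0 0 1] elt_in_F[of 1 0 0] by (auto simp: elt_def)
  have "1 \<in> K.span ?S"
  proof (rule ccontr)
    assume 1: "1 \<notin> K.span ?S"
    then have "K.independent (insert 1 ?S)"
      using independent_multiples(1)[OF False] by (rule K.independent_insertI)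
    moreover have "insert 1 ?S \<subseteq> K.span {1, y, y\<^sup>2}"
      unfolding span_basis using z yF F_mult by auto
    ultimately have "card (insert 1 ?S) \<le> card {1, y, y\<^sup>2}"
      using K.independent_span_bound[of "{1, y, y\<^sup>2}" "insert 1 ?S"] by simp
    moreover have "1 \<notin> ?S"
      using 1 K.span_superset[of ?S] by (rule contra_subsetD[rotated])
    then have "card (insert 1 ?S) = Suc (card ?S)"
      by (intro card_insert_disjoint) auto
    moreover have "card {1, y, y\<^sup>2} = 3" using independent_multiples(2)[of 1] by simp
    ultimately show False using independent_multiples(2)[OF False] by simp
  qed
  then obtain a b c where "1 = \<iota> a * z + \<iota> b * (z * y) + \<iota> c * (z * y\<^sup>2)"
    unfolding span_three by blast
  then have "z * elt a b c = 1" by (simp add: elt_def algebra_simps)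
  then have "inverse z = elt a b c" by (rule inverse_unique)
  then show ?thesis by (simp add: elt_in_F)
qed (use elt_in_F[of 0 0 0] in \<open>simp add: elt_def\<close>)

lemma is_subfield_F: "is_subfield F"
  unfolding is_subfield_def
proof (intro conjI ballI)
  show "1 \<in> F" using elt_in_F[of 1 0 0] by (simp add: elt_def)
  show "a - b \<in> F" if "a \<in> F" "b \<in> F" for a b
    using that by (elim F_cases) (simp add: elt_diff elt_in_F)
qed (auto intro: F_mult F_inverse)

lemma adjoin_eq_F: "adjoin \<iota> y = F"
proof
  have "range \<iota> \<subseteq> F" "y \<in> F"
    using elt_in_F[of _ 0 0] elt_in_F[of 0 1 0] by (auto simp: elt_def)
  then show "adjoin \<iota> y \<subseteq> F"
    unfolding adjoin_def using is_subfield_F by blast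
  show "F \<subseteq> adjoin \<iota> y"
    unfolding adjoin_def
  proof (intro Inter_greatest subsetI)
    fix S z assume S: "S \<in> {S. is_subfield S \<and> range \<iota> \<subseteq> S \<and> y \<in> S}" and "z \<in> F"
    interpret S: constant_field \<iota> S
      using S by unfold_locales auto
    obtain a b c where z: "z = elt a b c" using \<open>z \<in> F\<close> by (rule F_cases)
    show "z \<in> S"
      unfolding z elt_def using S by auto
  qed
qed

definition const :: "'a \<Rightarrow> 'l" where "const = \<iota> \<circ> rat_const"

lemma const_eq: "const c = \<iota> (rat_const c)"
  by (simp add: const_def)

sublocale ff: embedding const
  by unfold_locales (simp add: field_embedding_def const_eq rat.map_add rat.map_mult)

sublocale ff: constant_field const F
  using is_subfield_F elt_in_F[of _ 0 0] by unfold_locales (auto simp: elt_def const_eq)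

definition x :: 'l where "x = \<iota> rat_x"

lemma ev_x: "ff.ev x p = j p"
proof (induction p)
  case (pCons c p)
  have "pCons c p = [:c:] + [:0, 1:] * p" by simp
  then have "to_fract (pCons c p) = rat_const c + rat_x * to_fract p"
    by (simp only: rat_const_def rat_x_def to_fract_add to_fract_mult)
  then have "j (pCons c p) = const c + x * j p"
    by (simp add: j_def x_def const_eq)
  then show ?case
    using pCons by simp
qed simp

lemma x_in_F: "x \<in> F" and y_in_F: "y \<in> F" and iota_in_F: "\<iota> r \<in> F" and j_in_F: "j p \<in> F"
  using elt_in_F[of _ 0 0] elt_in_F[of 0 1 0] by (auto simp: elt_def x_def j_def)

lemma x_nonzero: "x \<noteq> 0"
  by (simp add: x_def rat_x_def)


subsection \<open>Finiteness over the subfields generated by one element\<close>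

definition polys_below :: "nat \<Rightarrow> 'a poly set" where
  "polys_below n = {p. \<forall>i\<ge>n. coeff p i = 0}"

lemma card_polys_below: "card (polys_below n) = CARD('a) ^ n" and finite_polys_below: "finite (polys_below n)"
proof -
  have "bij_betw Poly {xs. set xs \<subseteq> UNIV \<and> length xs = n} (polys_below n)"
  proof (rule bij_betwI[where g = "\<lambda>p. map (coeff p) [0..<n]"])
    show "Poly \<in> {xs. set xs \<subseteq> UNIV \<and> length xs = n} \<rightarrow> polys_below n"
      by (auto simp: polys_below_def coeff_Poly_eq nth_default_def)
    show "Poly (map (coeff p) [0..<n]) = p" if "p \<in> polys_below n" for p
      using that by (intro poly_eqI) (auto simp: polys_below_def coeff_Poly_eq nth_default_def)
    show "map (coeff (Poly xs)) [0..<n] = xs" if "xs \<in> {xs. set xs \<subseteq> UNIV \<and> length xs = n}" for xs :: "'a list"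
      using that by (intro nth_equalityI) (auto simp: coeff_Poly_eq nth_default_def)
  qed auto
  moreover have "card {xs. set xs \<subseteq> (UNIV :: 'a set) \<and> length xs = n} = CARD('a) ^ n"
    by (rule card_lists_length_eq) simp
  moreover have "finite {xs. set xs \<subseteq> (UNIV :: 'a set) \<and> length xs = n}"
    by (rule finite_lists_length_eq) simp
  ultimately show "card (polys_below n) = CARD('a) ^ n" "finite (polys_below n)"
    by (auto simp: bij_betw_same_card bij_betw_finite)
qed

lemma polys_below_iff: "p \<in> polys_below n \<longleftrightarrow> p = 0 \<or> degree p < n"
  unfolding polys_below_def using leading_coeff_0_iff[of p] by (auto simp: coeff_eq_0 not_less)

lemma polys_below_add: "p \<in> polys_below n \<Longrightarrow> q \<in> polys_below n \<Longrightarrow> p + q \<in> polys_below n"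
  and polys_below_minus: "p \<in> polys_below n \<Longrightarrow> - p \<in> polys_below n"
  and polys_below_mono: "p \<in> polys_below m \<Longrightarrow> m \<le> n \<Longrightarrow> p \<in> polys_below n"
  by (auto simp: polys_below_def)

lemma polys_below_mult: "p \<in> polys_below n \<Longrightarrow> degree q \<le> m \<Longrightarrow> p * q \<in> polys_below (n + m)"
  by (cases "p = 0 \<or> q = 0") (auto simp: polys_below_iff degree_mult_eq)

text \<open>
  The elements of \<open>k[x] + k[x] y + k[x] y\<^sup>2\<close> with coefficients of degree less than \<open>n\<close>: a space of
  dimension at most \<open>3 n\<close> in which denominators have been cleared.
\<close>

definition W :: "nat \<Rightarrow> 'l set" where
  "W n = {j p + j q * y + j r * y\<^sup>2 | p q r. p \<in> polys_below n \<and> q \<in> polys_below n \<and> r \<in> polys_below n}"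

lemma W_I: "p \<in> polys_below n \<Longrightarrow> q \<in> polys_below n \<Longrightarrow> r \<in> polys_below n \<Longrightarrow> j p + j q * y + j r * y\<^sup>2 \<in> W n"
  by (auto simp: W_def)

lemma W_E:
  assumes "z \<in> W n"
  obtains p q r where "z = j p + j q * y + j r * y\<^sup>2" "p \<in> polys_below n" "q \<in> polys_below n" "r \<in> polys_below n"
  using assms by (auto simp: W_def)

lemma finite_W: "finite (W n)" and card_W: "card (W n) \<le> CARD('a) ^ (3 * n)"
proof -
  let ?P = "polys_below n \<times> polys_below n \<times> polys_below n"
  have W: "W n = (\<lambda>(p, q, r). j p + j q * y + j r * y\<^sup>2) ` ?P"
    by (force simp: W_def)
  have fin: "finite ?P" by (simp add: finite_polys_below)
  then show "finite (W n)" unfolding W by blast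
  have "card (W n) \<le> card ?P" unfolding W by (rule card_image_le[OF fin])
  also have "\<dots> = CARD('a) ^ (3 * n)"
  proof -
    have "3 * n = n + (n + n)" by simp
    then show ?thesis by (simp only: card_cartesian_product card_polys_below power_add)
  qed
  finally show "card (W n) \<le> CARD('a) ^ (3 * n)" .
qed

lemma W_mono:
  assumes "z \<in> W m" "m \<le> n"
  shows "z \<in> W n"
proof -
  obtain p q r where "z = j p + j q * y + j r * y\<^sup>2"
    "p \<in> polys_below m" "q \<in> polys_below m" "r \<in> polys_below m"
    using assms(1) by (rule W_E)
  then show ?thesis
    using polys_below_mono[OF _ assms(2)] W_I by simp
qed

lemma W_add: "z \<in> W n \<Longrightarrow> w \<in> W n \<Longrightarrow> z + w \<in> W n"
proof (elim W_E)
  fix p q r p' q' r'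
  assume z: "z = j p + j q * y + j r * y\<^sup>2" "w = j p' + j q' * y + j r' * y\<^sup>2"
    and "p \<in> polys_below n" "q \<in> polys_below n" "r \<in> polys_below n"
      "p' \<in> polys_below n" "q' \<in> polys_below n" "r' \<in> polys_below n"
  then have "j (p + p') + j (q + q') * y + j (r + r') * y\<^sup>2 \<in> W n"
    by (intro W_I polys_below_add)
  then show "z + w \<in> W n" by (simp add: z algebra_simps)
qed

lemma W_zero: "0 \<in> W n"
  using W_I[of 0 n 0 0] by (simp add: polys_below_def)

lemma W_sum: "(\<And>i. i \<in> I \<Longrightarrow> f i \<in> W n) \<Longrightarrow> sum f I \<in> W n"
  by (induction I rule: infinite_finite_induct) (auto simp: W_zero W_add)

lemma W_mult_poly: "z \<in> W n \<Longrightarrow> degree m \<le> d \<Longrightarrow> j m * z \<in> W (n + d)"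
proof (elim W_E)
  fix p q r
  assume z: "z = j p + j q * y + j r * y\<^sup>2" "degree m \<le> d"
    and "p \<in> polys_below n" "q \<in> polys_below n" "r \<in> polys_below n"
  then have "j (p * m) + j (q * m) * y + j (r * m) * y\<^sup>2 \<in> W (n + d)"
    by (intro W_I polys_below_mult)
  then show "j m * z \<in> W (n + d)" by (simp add: z algebra_simps)
qed

lemma W_const: "const c * z \<in> W n" if "z \<in> W n"
  using W_mult_poly[OF that, of "[:c:]" 0] by (simp add: j_def rat_const_def const_eq)

lemma W_mult_y: "z \<in> W n \<Longrightarrow> y * z \<in> W (n + max (degree A) (degree B))"
proof (elim W_E)
  fix p q r
  assume z: "z = j p + j q * y + j r * y\<^sup>2"
    and pqr: "p \<in> polys_below n" "q \<in> polys_below n" "r \<in> polys_below n"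
  have "j (- (r * B)) + j (p + r * A) * y + j q * y\<^sup>2 \<in> W (n + max (degree A) (degree B))"
    using pqr
    by (intro W_I polys_below_minus polys_below_add polys_below_mult) (auto intro: polys_below_mono)
  also have "j (- (r * B)) + j (p + r * A) * y + j q * y\<^sup>2 = j p * y + j q * y\<^sup>2 + j r * (y * (y * y))"
    unfolding y3 by (simp add: algebra_simps)
  also have "\<dots> = y * z"
    by (simp add: z power2_eq_square algebra_simps)
  finally show "y * z \<in> W (n + max (degree A) (degree B))" .
qed

lemma integral_multiple:
  assumes "z \<in> F"
  shows "\<exists>s n. s \<noteq> 0 \<and> j s * z \<in> W n"
proof -
  obtain a b c where z: "z = elt a b c" using assms by (rule F_cases)
  obtain p q where a: "q \<noteq> 0" "a = to_fract p / to_fract q" by (rule fract_cases)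
  obtain p' q' where b: "q' \<noteq> 0" "b = to_fract p' / to_fract q'" by (rule fract_cases)
  obtain p'' q'' where c: "q'' \<noteq> 0" "c = to_fract p'' / to_fract q''" by (rule fract_cases)
  let ?s = "q * q' * q''" and ?a = "p * q' * q''" and ?b = "p' * q * q''" and ?c = "p'' * q * q'"
  let ?n = "Suc (degree ?a + degree ?b + degree ?c)"
  have "j ?a + j ?b * y + j ?c * y\<^sup>2 \<in> W ?n"
    by (intro W_I) (auto simp: polys_below_iff)
  also have "j ?a + j ?b * y + j ?c * y\<^sup>2 = j ?s * z"
  proof -
    have "j ?s * \<iota> a = j ?a" "j ?s * \<iota> b = j ?b" "j ?s * \<iota> c = j ?c"
      using a b c by (simp_all add: j_def)
    then show ?thesis
      by (simp only: z elt_def distrib_left mult.assoc[symmetric])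
  qed
  finally show ?thesis using a b c by (intro exI[of _ ?s] exI[of _ ?n]) auto
qed

lemma integral_multiple_finite:
  assumes "finite U" "U \<subseteq> F"
  shows "\<exists>s n. s \<noteq> 0 \<and> (\<forall>u\<in>U. j s * u \<in> W n)"
  using assms
proof (induction U rule: finite_induct)
  case empty
  then show ?case by (intro exI[of _ 1]) auto
next
  case (insert u U)
  then obtain s n where s: "s \<noteq> 0" "\<And>u. u \<in> U \<Longrightarrow> j s * u \<in> W n" by auto
  obtain s' n' where s': "s' \<noteq> 0" "j s' * u \<in> W n'" using integral_multiple insert by blast
  let ?n = "(n + degree s') + (n' + degree s)"
  have "j (s * s') * v \<in> W ?n" if "v \<in> insert u U" for v
  proof (cases "v = u")
    case True
    have "j s * (j s' * u) \<in> W (n' + degree s)" by (rule W_mult_poly[OF s'(2) order_refl])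
    then show ?thesis using True by (auto simp: mult.assoc intro: W_mono)
  next
    case False
    then have "j s' * (j s * v) \<in> W (n + degree s')"
      using that s by (intro W_mult_poly) auto
    then show ?thesis by (auto simp: mult_ac intro: W_mono)
  qed
  then show ?case using s s' by (intro exI[of _ "s * s'"] exI[of _ ?n]) auto
qed

lemma ev_eq_sum: "(\<And>i. n \<le> i \<Longrightarrow> coeff p i = 0) \<Longrightarrow> ff.ev h p = (\<Sum>i<n. const (coeff p i) * h ^ i)"
proof (induction n arbitrary: p)
  case 0
  then have "p = 0" by (intro poly_eqI) auto
  then show ?case by simp
next
  case (Suc n)
  obtain c q where p: "p = pCons c q" by (cases p)
  have "coeff q i = 0" if "n \<le> i" for i
    using Suc.prems[of "Suc i"] that by (simp add: p)
  then have "ff.ev h q = (\<Sum>i<n. const (coeff q i) * h ^ i)" by (rule Suc.IH)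
  then show ?case
    by (simp add: p sum.lessThan_Suc_shift sum_distrib_left mult_ac del: sum.lessThan_Suc)
qed

text \<open>
  Counting bounds the degree over \<open>k(h)\<close>: if \<open>N\<close> elements are independent over \<open>k[h]\<close>, their
  combinations with coefficients of degree below \<open>d\<close> in \<open>h\<close> form a space of dimension \<open>d N\<close>,
  which fits, after clearing denominators, into one of dimension \<open>3 c d + O(1)\<close>.
\<close>

lemma degree_over_le_if_growth:
  assumes a: "\<And>n z. z \<in> W n \<Longrightarrow> a * z \<in> W (n + c)" and m: "m \<noteq> 0"
  shows "degree_over_le const F (a / j m) (3 * (c + degree m))"
  unfolding degree_over_le_def
proof (intro allI impI)
  fix U assume U: "finite U" "U \<subseteq> F" and indep: "independent_over const (a / j m) U"
  let ?h = "a / j m" and ?c = "c + degree m"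
  obtain s C where s: "s \<noteq> 0" "\<And>u. u \<in> U \<Longrightarrow> j s * u \<in> W C"
    using integral_multiple_finite[OF U] by blast
  have jm: "j m \<noteq> 0" using m by simp
  have powers: "a ^ i * z \<in> W (n + c * i)" if "z \<in> W n" for i n z
  proof (induction i)
    case (Suc i)
    then have "a * (a ^ i * z) \<in> W (n + c * i + c)" by (rule a)
    moreover have "n + c * i + c = n + c * Suc i" by simp
    ultimately show ?case by (simp only: power_Suc mult.assoc)
  qed (use that in simp)
  have term_in_W: "j (m ^ d * s) * (?h ^ i * u) \<in> W (C + ?c * d)" if "i < d" "u \<in> U" for d i u
  proof -
    have "a ^ i * (j s * u) \<in> W (C + c * i)" using s that by (intro powers)
    then have "j (m ^ (d - i)) * (a ^ i * (j s * u)) \<in> W (C + c * i + degree m * (d - i))"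
      by (rule W_mult_poly) (metis degree_power_le mult.commute)
    moreover have "j (m ^ (d - i)) * (a ^ i * (j s * u)) = j (m ^ d * s) * (?h ^ i * u)"
    proof -
      have "j m ^ d = j m ^ (d - i) * j m ^ i" 
        using that by (subst power_add[symmetric]) simp
      then show ?thesis using jm by (simp add: power_divide field_simps)
    qed
    moreover have "C + c * i + degree m * (d - i) \<le> C + ?c * d"
    proof -
      have "c * i \<le> c * d" "degree m * (d - i) \<le> degree m * d" using that by auto
      then have "c * i + degree m * (d - i) \<le> c * d + degree m * d" by (rule add_mono)
      then show ?thesis unfolding add_mult_distrib add.assoc by (rule add_left_mono)
    qed
    ultimately show ?thesis by (metis W_mono)
  qed
  have bound: "d * card U \<le> 3 * (C + ?c * d)" for d
  proof -
    let ?\<Phi> = "\<lambda>\<phi>. j (m ^ d * s) * (\<Sum>u\<in>U. ff.ev ?h (\<phi> u) * u)"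
    let ?E = "U \<rightarrow>\<^sub>E polys_below d"
    have inj: "inj_on ?\<Phi> ?E"
    proof (rule inj_onI)
      fix \<phi> \<psi> assume \<phi>: "\<phi> \<in> ?E" and \<psi>: "\<psi> \<in> ?E" and eq: "?\<Phi> \<phi> = ?\<Phi> \<psi>"
      have "(\<Sum>u\<in>U. ff.ev ?h (\<phi> u) * u) = (\<Sum>u\<in>U. ff.ev ?h (\<psi> u) * u)"
        using eq s m by simp
      then have "(\<Sum>u\<in>U. ff.ev ?h (\<phi> u - \<psi> u) * u) = 0"
        by (simp add: left_diff_distrib sum_subtractf)
      then have "\<forall>u\<in>U. \<phi> u - \<psi> u = 0"
        using indep unfolding independent_over_def ff.ev_def[symmetric]
        by (elim allE[of _ "\<lambda>u. \<phi> u - \<psi> u"]) simp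
      then show "\<phi> = \<psi>"
        using \<phi> \<psi> by (intro PiE_ext[of \<phi> U _ \<psi>]) auto
    qed
    have sub: "?\<Phi> ` ?E \<subseteq> W (C + ?c * d)"
    proof (rule image_subsetI)
      fix \<phi> assume \<phi>: "\<phi> \<in> ?E"
      have "j (m ^ d * s) * (ff.ev ?h (\<phi> u) * u) \<in> W (C + ?c * d)" if u: "u \<in> U" for u
      proof -
        have "\<phi> u \<in> polys_below d" using \<phi> u by auto
        then have "ff.ev ?h (\<phi> u) = (\<Sum>i<d. const (coeff (\<phi> u) i) * ?h ^ i)"
          by (intro ev_eq_sum) (simp add: polys_below_def)
        then have "j (m ^ d * s) * (ff.ev ?h (\<phi> u) * u) =
            (\<Sum>i<d. const (coeff (\<phi> u) i) * (j (m ^ d * s) * (?h ^ i * u)))"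
          by (simp add: sum_distrib_left sum_distrib_right mult_ac)
        also have "\<dots> \<in> W (C + ?c * d)"
          by (rule W_sum, rule W_const, rule term_in_W) (use u in auto)
        finally show ?thesis .
      qed
      then show "?\<Phi> \<phi> \<in> W (C + ?c * d)"
        unfolding sum_distrib_left by (intro W_sum)
    qed
    have "card ?E \<le> card (W (C + ?c * d))"
      by (rule card_inj_on_le[OF inj sub finite_W])
    also have "\<dots> \<le> CARD('a) ^ (3 * (C + ?c * d))" by (rule card_W)
    also have "card ?E = CARD('a) ^ (d * card U)"
      using U by (simp add: card_PiE card_polys_below power_mult)
    finally show ?thesis
      using power_le_imp_le_exp[OF card_field_gt_1] by blast
  qed
  show "card U \<le> 3 * ?c"
  proof (rule ccontr)
    \<comment> \<open>With one more element, \<open>d = 3 C + 1\<close> makes the part growing with \<open>d\<close> exceed the constant \<open>3 C\<close>.\<close>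
    assume "\<not> card U \<le> 3 * ?c"
    then have "Suc (3 * ?c) \<le> card U" by simp
    then have "(3 * C + 1) * Suc (3 * ?c) \<le> (3 * C + 1) * card U" by (rule mult_left_mono) simp
    also have "\<dots> \<le> 3 * (C + ?c * (3 * C + 1))" by (rule bound)
    finally show False by (simp add: algebra_simps)
  qed
qed

lemma degree_over_poly: "degree_over_le const F (ff.ev x p) (3 * degree p)"
  using degree_over_le_if_growth[of "j p" "degree p" 1] W_mult_poly[of _ _ p "degree p"]
  by (simp add: ev_x)

lemma degree_over_inverse_x: "degree_over_le const F (inverse x) 3"
  using degree_over_le_if_growth[of 1 0 "[:0, 1:]"]
  by (simp add: x_def rat_x_def j_def inverse_eq_divide)

lemma W_mult_bounded:
  assumes "a \<in> W k"
  shows "\<exists>c. \<forall>n z. z \<in> W n \<longrightarrow> a * z \<in> W (n + c)"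
proof -
  obtain p q r where a: "a = j p + j q * y + j r * y\<^sup>2"
    using assms by (rule W_E)
  let ?e = "max (degree A) (degree B)"
  let ?c = "degree p + degree q + degree r + 2 * ?e"
  have "a * z \<in> W (n + ?c)" if z: "z \<in> W n" for n z
  proof -
    have yz: "y * z \<in> W (n + ?e)" using z by (rule W_mult_y)
    then have yyz: "y * (y * z) \<in> W (n + ?e + ?e)" by (rule W_mult_y)
    have "j p * z + j q * (y * z) + j r * (y * (y * z)) \<in> W (n + ?c)"
      by (intro W_add W_mono[OF W_mult_poly[OF z order_refl]] W_mono[OF W_mult_poly[OF yz order_refl]]
        W_mono[OF W_mult_poly[OF yyz order_refl]]) auto
    then show ?thesis by (simp add: a power2_eq_square algebra_simps)
  qed
  then show ?thesis by blast
qed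

lemma finite_degree_F:
  assumes "h \<in> F"
  shows "\<exists>c. degree_over_le const F h c"
proof -
  obtain m n where m: "m \<noteq> 0" "j m * h \<in> W n" using integral_multiple[OF assms] by blast
  obtain c where "\<And>n z. z \<in> W n \<Longrightarrow> (j m * h) * z \<in> W (n + c)"
    using W_mult_bounded[OF m(2)] by blast
  then have "degree_over_le const F (j m * h / j m) (3 * (c + degree m))"
    using m(1) by (rule degree_over_le_if_growth)
  then show ?thesis using m by auto
qed

sublocale ff: function_field const F
  by unfold_locales (rule finite_degree_F)

end

section \<open>Places of a cubic extension above infinity\<close>

context cubic_extension
begin

text \<open>
  The place is determined on \<open>k(x)\<close> by its value at \<open>x\<close>, with ramification index \<open>- v x\<close>.
\<close>

lemma place_iota:
  assumes v: "v \<in> ff.pl" "v x < 0"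
  shows "v (\<iota> r) = - v x * neg_degree r"
proof (cases "r = 0")
  case False
  obtain p q where r: "q \<noteq> 0" "r = to_fract p / to_fract q" by (rule fract_cases)
  have p: "p \<noteq> 0" using r False by auto
  have val: "v (j s) = int (degree s) * v x" if "s \<noteq> 0" for s
    using ff.place_ev_pole[OF v(1) x_in_F v(2) that] by (simp add: ev_x)
  have "v (\<iota> r) = v (j p / j q)" by (simp add: r j_def)
  also have "\<dots> = v (j p) - v (j q)"
    using p r by (intro ff.place_divide v(1) j_in_F) auto
  finally show ?thesis
    using p r by (simp add: val neg_degree_eq algebra_simps)
qed (simp add: ff.place_zero[OF v(1)] neg_degree_def)

lemma place_above_infinity:
  assumes v: "v \<in> ff.pl" "v x < 0"
  shows "lies_over \<iota> v infinite_place" and "int (ramification_index \<iota> v infinite_place) = - v x"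
proof -
  show "lies_over \<iota> v infinite_place"
    unfolding lies_over_def infinite_place_eq using place_iota[OF v] v(2)
    by (simp add: mult_neg_pos)
  have "ramification_index \<iota> v infinite_place = nat (- v x)"
    unfolding ramification_index_def infinite_place_eq
  proof (rule the_equality)
    show "0 < nat (- v x) \<and> (\<forall>f. v (\<iota> f) = int (nat (- v x)) * neg_degree f)"
      using place_iota[OF v] v(2) by simp
    fix e assume e: "0 < e \<and> (\<forall>f. v (\<iota> f) = int e * neg_degree f)"
    then have "v (\<iota> rat_x) = int e * neg_degree (rat_x :: 'a poly fract)" by blast
    moreover have "neg_degree (rat_x :: 'a poly fract) = - 1"
      using neg_degree_to_fract[of "[:0, 1 :: 'a:]"] by (simp add: rat_x_def)
    ultimately show "e = nat (- v x)" by (simp add: x_def)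
  qed
  then show "int (ramification_index \<iota> v infinite_place) = - v x"
    using v(2) by simp
qed

lemma is_subring_integers_at_infinity: "is_subring (\<iota> ` deg_le 0)"
  unfolding is_subring_def
proof (intro conjI ballI)
  have "(1 :: 'a poly fract) \<in> deg_le 0" using deg_le_to_fract[of 1 0] by simp
  then show "1 \<in> \<iota> ` deg_le 0" by (metis image_eqI map_one)
next
  fix a b assume "a \<in> \<iota> ` deg_le 0" "b \<in> \<iota> ` deg_le 0"
  then obtain r s where rs: "a = \<iota> r" "b = \<iota> s" "r \<in> deg_le 0" "s \<in> deg_le 0" by blast
  have "r - s \<in> deg_le 0" "r * s \<in> deg_le 0"
    using rs deg_le_diff deg_le_mult[of r 0 s 0] by auto
  then show "a - b \<in> \<iota> ` deg_le 0" "a * b \<in> \<iota> ` deg_le 0"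
    using rs by (metis image_eqI map_diff, metis image_eqI map_mult)
qed

text \<open>
  The place obtained from the ring of functions regular at infinity need not lie above infinity a
  priori; all that is known is that \<open>1 / x\<close> is regular there.
\<close>

lemma pole_at_infinity:
  assumes z: "z \<in> F"
    and non_integral: "\<And>n a. (\<And>i. a i \<in> deg_le 0) \<Longrightarrow> z ^ n \<noteq> (\<Sum>i<n. \<iota> (a i) * z ^ i)"
  shows "\<exists>v\<in>ff.pl. v x \<le> 0 \<and> v z < 0"
proof -
  let ?S = "\<iota> ` deg_le 0"
  have "\<exists>v\<in>ff.pl. ?S \<subseteq> ff.ball v 0 \<and> v z < 0"
  proof (rule ff.pole_of_non_integral[OF is_subring_integers_at_infinity _ _ z])
    have "rat_const c \<in> deg_le 0" for c :: 'a
      using deg_le_to_fract[of "[:c:]" 0] by (simp add: rat_const_def)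
    then show "range const \<subseteq> ?S" by (auto simp: const_eq)
    show "?S \<subseteq> F" using iota_in_F by auto
    fix n :: nat and a assume "\<And>i :: nat. a i \<in> ?S"
    then have "\<forall>i. \<exists>r. r \<in> deg_le 0 \<and> a i = \<iota> r" by blast
    then obtain r where "\<And>i. r i \<in> deg_le 0 \<and> a i = \<iota> (r i)" by metis
    then show "z ^ n \<noteq> (\<Sum>i<n. a i * z ^ i)"
      using non_integral[of r n] by simp
  qed
  then obtain v where v: "v \<in> ff.pl" "?S \<subseteq> ff.ball v 0" "v z < 0" by blast
  have "(inverse rat_x :: 'a poly fract) \<in> deg_le 0"
    using deg_le_divide_to_fract[of "[:0, 1:] :: 'a poly" 1 0] deg_le_to_fract[of "1 :: 'a poly" 1]
    by (simp add: rat_x_def inverse_eq_divide)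
  then have "\<iota> (inverse rat_x) \<in> ff.ball v 0" using v(2) by blast
  then have "inverse x \<in> ff.ball v 0" by (simp add: x_def)
  then have "0 \<le> v (inverse x)" using x_nonzero by (simp add: ff.ball_def)
  then have "v x \<le> 0" using ff.place_inverse[OF v(1) x_in_F] by simp
  then show ?thesis using v by blast
qed

text \<open>
  The function \<open>x\<close> is not integral over the ring of functions regular at infinity: in an equation
  of integrality the degree of \<open>x ^ n\<close> exceeds that of all other terms.
\<close>

lemma infinite_place_exists: "\<exists>v\<in>ff.pl. v x < 0"
proof -
  have "\<exists>v\<in>ff.pl. v x \<le> 0 \<and> v x < 0"
  proof (rule pole_at_infinity[OF x_in_F])
    fix n :: nat and a :: "nat \<Rightarrow> 'a poly fract"
    assume a: "\<And>i. a i \<in> deg_le 0"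
    have rat_x_power: "rat_x ^ i = (to_fract (monom 1 i) :: 'a poly fract)" for i
      by (induction i) (auto simp: rat_x_def monom_Suc simp flip: to_fract_mult)
    show "x ^ n \<noteq> (\<Sum>i<n. \<iota> (a i) * x ^ i)"
    proof
      assume "x ^ n = (\<Sum>i<n. \<iota> (a i) * x ^ i)"
      then have "\<iota> (rat_x ^ n) = \<iota> (\<Sum>i<n. a i * rat_x ^ i)"
        by (simp add: x_def map_sum)
      then have "rat_x ^ n = (\<Sum>i<n. a i * rat_x ^ i)" by (simp only: map_eq_iff)
      moreover have "(\<Sum>i<n. a i * rat_x ^ i) \<in> deg_le (int n - 1)"
        unfolding deg_le_def
      proof (rule rat.ball_sum[OF neg_degree_place])
        fix i assume i: "i \<in> {..<n}"
        have "rat_x ^ i \<in> (deg_le (int i) :: 'a poly fract set)"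
          by (simp add: rat_x_power deg_le_to_fract degree_monom_eq)
        then have "a i * rat_x ^ i \<in> deg_le (0 + int i)" by (rule deg_le_mult[OF a])
        then show "a i * rat_x ^ i \<in> rat.ball neg_degree (- (int n - 1))"
          unfolding deg_le_def[symmetric] by (rule deg_le_mono) (use i in simp)
      qed
      ultimately have "(rat_x ^ n :: 'a poly fract) \<in> deg_le (int n - 1)" by simp
      then show False by (simp add: rat_x_power deg_le_to_fract degree_monom_eq)
    qed
  qed
  then show ?thesis by blast
qed

text \<open>
  If \<open>2 deg B > 3 deg A\<close>, the terms \<open>y\<^sup>3\<close> and \<open>B\<close> dominate at every place above infinity, so that
  the value of \<open>B\<close> is divisible by \<open>3\<close> there.
\<close>

lemma wildly_ramified_at_infinity:
  assumes v: "v \<in> ff.pl" "v x < 0"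
    and A0: "A \<noteq> 0" and deg: "\<not> 3 dvd degree B" "3 * degree A < 2 * degree B"
  shows "3 dvd v x"
proof -
  have B0: "B \<noteq> 0" using deg by auto
  have y0: "y \<noteq> 0"
    using not_rational[of 0] by auto
  have vA: "v (j A) = int (degree A) * v x" and vB: "v (j B) = int (degree B) * v x"
    using ff.place_ev_pole[OF v(1) x_in_F v(2)] A0 B0 by (auto simp: ev_x)
  have vAy: "v (j A * y) = int (degree A) * v x + v y"
    using A0 y0 by (simp add: ff.place_mult[OF v(1)] j_in_F y_in_F vA)
  have vy3: "v (y ^ 3) = 3 * v y"
    using ff.place_power[OF v(1) y_in_F, of 3] by simp
  have eq: "y ^ 3 + j B = j A * y"
    using root by (simp add: j_def)
  have small: "int (2 * degree B) * v x < int (3 * degree A) * v x"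
    using deg(2) v(2) by (intro mult_strict_right_mono_neg) auto
  have "3 * v y = v (j B)"
  proof (rule ccontr)
    assume ne: "3 * v y \<noteq> v (j B)"
    then consider "v (y ^ 3) < v (j B)" | "v (j B) < v (y ^ 3)" using vy3 by linarith
    then show False
    proof cases
      case 1
      then have "v (j A * y) = v (y ^ 3)"
        using ff.place_add_eq(2)[OF v(1) _ _ _ _ 1] y0 B0 y_in_F j_in_F by (simp add: eq)
      then have "2 * v y = int (degree A) * v x" using vAy vy3 by simp
      then show False using 1 small vB vy3 by simp
    next
      case 2
      then have "v (j A * y) = v (j B)"
        using ff.place_add_eq(2)[OF v(1) _ _ _ _ 2] y0 B0 y_in_F j_in_F
        by (simp add: eq add.commute[of "j B"])
      then have "v y = int (degree B) * v x - int (degree A) * v x" using vAy vB by simp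
      then show False using 2 small vB vy3 by simp
    qed
  qed
  then have "3 dvd int (degree B) * v x" using vB by (metis dvd_triv_left)
  moreover have "coprime 3 (int (degree B))"
    using deg(1) by (subst prime_imp_coprime_int) (auto simp: int_dvd_int_iff[of 3, simplified])
  ultimately show ?thesis by (simp add: coprime_dvd_mult_right_iff)
qed

text \<open>
  In standard form, a violation of the inequality leads to the case of wild ramification, and there
  is a place above infinity at which it occurs.
\<close>

lemma degrees_if_tame:
  assumes A0: "A \<noteq> 0" and "standard_form A B" and tame: "tame_or_unramified_at_infinity \<iota> F"
  shows "2 * degree B \<le> 3 * degree A"
proof (rule ccontr)
  assume "\<not> ?thesis"
  then have deg: "\<not> 3 dvd degree B" "3 * degree A < 2 * degree B"
    using assms(2) by (auto simp: standard_form_def)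
  obtain v where v: "v \<in> ff.pl" "v x < 0" using infinite_place_exists by blast
  have "3 dvd int (ramification_index \<iota> v infinite_place)"
    using wildly_ramified_at_infinity[OF v A0 deg] place_above_infinity(2)[OF v] by simp
  then have "3 dvd ramification_index \<iota> v infinite_place"
    by (simp add: int_dvd_int_iff[of 3, simplified])
  then show False
    using tame place_above_infinity(1)[OF v] v(1)
    by (auto simp: tame_or_unramified_at_infinity_def const_def)
qed

end


section \<open>The integral elements at infinity\<close>

text \<open>
  Membership in \<open>hdeg n\<close> means \<open>2 deg r \<le> n\<close>; doubling the degrees keeps the weight \<open>d / 2\<close> of \<open>y\<close>
  integral when \<open>d\<close> is odd.
\<close>

definition hdeg :: "int \<Rightarrow> 'a::field poly fract set" where
  "hdeg n = deg_le (n div 2)"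

lemma hdeg_iff: "r \<in> hdeg n \<longleftrightarrow> r = 0 \<or> - (2 * neg_degree r) \<le> n"
  by (auto simp: hdeg_def deg_le_iff)

lemma hdeg_zero [simp]: "0 \<in> hdeg n"
  by (simp add: hdeg_def)

lemma hdeg_add: "r \<in> hdeg n \<Longrightarrow> s \<in> hdeg n \<Longrightarrow> r + s \<in> hdeg n"
  and hdeg_diff: "r \<in> hdeg n \<Longrightarrow> s \<in> hdeg n \<Longrightarrow> r - s \<in> hdeg n"
  unfolding hdeg_def by (rule deg_le_add deg_le_diff; assumption)+

lemma hdeg_mono: "r \<in> hdeg m \<Longrightarrow> m \<le> n \<Longrightarrow> r \<in> hdeg n"
  by (auto simp: hdeg_iff)

lemma hdeg_mult:
  assumes "r \<in> hdeg m" "s \<in> hdeg n" "l = m + n"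
  shows "r * s \<in> hdeg l"
  using assms neg_degree_mult[of r s] by (cases "r = 0 \<or> s = 0") (auto simp: hdeg_iff)

lemma hdeg_to_fract: "to_fract p \<in> hdeg n \<longleftrightarrow> p = 0 \<or> 2 * int (degree p) \<le> n"
  by (cases "p = 0") (auto simp: hdeg_iff neg_degree_to_fract)

lemma neg_degree_power: "r \<noteq> 0 \<Longrightarrow> neg_degree (r ^ n) = int n * neg_degree r"
  using rat.place_power[OF neg_degree_place, of r n] by simp

lemma hdeg_cube:
  assumes "r \<in> hdeg n" "m = 3 * n"
  shows "r ^ 3 \<in> hdeg m"
  using assms by (cases "r = 0") (auto simp: hdeg_iff neg_degree_power)

locale balanced_cubic = cubic_extension +
  assumes char3: "(3 :: 'a) = 0"
    and A_nonzero: "A \<noteq> 0"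
    and balanced: "2 * degree B \<le> 3 * degree A"
begin

abbreviation d :: int where "d \<equiv> int (degree A)"

lemma A_hdeg: "to_fract A \<in> hdeg (2 * d)"
  by (simp add: hdeg_to_fract)

lemma B_hdeg: "to_fract B \<in> hdeg (3 * d)"
  using balanced by (auto simp: hdeg_to_fract)

text \<open>
  The gauge gives \<open>y\<close> the weight \<open>d / 2\<close>; all degrees are doubled to stay within the integers. By
  \<open>2 deg B \<le> 3 d\<close>, neither \<open>A y\<close> nor \<open>B\<close> outweighs \<open>y\<^sup>3\<close>.
\<close>

definition G :: "int \<Rightarrow> 'b set" where
  "G n = {elt a b c | a b c. a \<in> hdeg n \<and> b \<in> hdeg (n - d) \<and> c \<in> hdeg (n - 2 * d)}"

lemma elt_in_G: "elt a b c \<in> G n \<longleftrightarrow> a \<in> hdeg n \<and> b \<in> hdeg (n - d) \<and> c \<in> hdeg (n - 2 * d)"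
  by (auto simp: G_def elt_inject)

lemma G_in_F: "z \<in> G n \<Longrightarrow> z \<in> F"
  by (auto simp: G_def elt_in_F)

lemma G_cases:
  assumes "z \<in> G n"
  obtains a b c where "z = elt a b c" "a \<in> hdeg n" "b \<in> hdeg (n - d)" "c \<in> hdeg (n - 2 * d)"
  using assms by (auto simp: G_def)

lemma G_mono: "z \<in> G m \<Longrightarrow> m \<le> n \<Longrightarrow> z \<in> G n"
  by (erule G_cases) (auto simp: elt_in_G elim: hdeg_mono)

lemma G_add: "z \<in> G n \<Longrightarrow> w \<in> G n \<Longrightarrow> z + w \<in> G n"
  by (elim G_cases) (simp add: elt_add elt_in_G hdeg_add)

lemma G_zero: "0 \<in> G n"
  using elt_in_G[of 0 0 0 n] by (simp add: elt_def)

lemma G_sum: "(\<And>i. i \<in> I \<Longrightarrow> f i \<in> G n) \<Longrightarrow> sum f I \<in> G n"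
  by (induction I rule: infinite_finite_induct) (auto simp: G_zero G_add)

lemma G_scale:
  assumes "r \<in> hdeg m" "z \<in> G n" "l = m + n"
  shows "\<iota> r * z \<in> G l"
proof -
  obtain a b c where z: "z = elt a b c" "a \<in> hdeg n" "b \<in> hdeg (n - d)" "c \<in> hdeg (n - 2 * d)"
    using assms(2) by (rule G_cases)
  show ?thesis
    unfolding z elt_scale elt_in_G using assms(3)
    by (intro conjI hdeg_mult[OF assms(1) z(2)] hdeg_mult[OF assms(1) z(3)] hdeg_mult[OF assms(1) z(4)]) auto
qed

lemma three_eq_0: "(3 :: 'b) = 0"
proof -
  have "const (1 + 1 + 1) = 1 + 1 + 1" by (simp only: ff.map_add ff.map_one)
  moreover have "(1 + 1 + 1 :: 'a) = 0" using char3 by simp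
  ultimately show ?thesis by (simp add: ff.map_zero)
qed

lemma cube_add: "(u + w) ^ 3 = u ^ 3 + w ^ 3" for u w :: 'b
proof -
  have "(u + w) ^ 3 = u ^ 3 + w ^ 3 + 3 * (u\<^sup>2 * w + u * w\<^sup>2)"
    by (simp add: power3_eq_cube power2_eq_square algebra_simps)
  then show ?thesis by (simp only: three_eq_0 mult_zero_left add_0_right)
qed

text \<open>
  Cubing is additive in characteristic \<open>3\<close>, and \<open>y\<^sup>6 = A\<^sup>2 y\<^sup>2 + A B y + B\<^sup>2\<close> because \<open>- 2 = 1\<close>.
\<close>

lemma cube_elt:
  "elt a b c ^ 3 = elt (a ^ 3 - b ^ 3 * to_fract B + c ^ 3 * (to_fract B * to_fract B))
     (to_fract A * b ^ 3 + c ^ 3 * (to_fract A * to_fract B)) (c ^ 3 * (to_fract A * to_fract A))"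
proof -
  have "(y\<^sup>2) ^ 3 = (y ^ 3)\<^sup>2" by (simp only: power_mult[symmetric] mult.commute)
  also have "\<dots> = (j A)\<^sup>2 * y\<^sup>2 + j A * j B * y + (j B)\<^sup>2 - 3 * (j A * j B * y)"
    unfolding root j_def[symmetric] by (simp add: power2_eq_square algebra_simps)
  finally have y6: "(y\<^sup>2) ^ 3 = (j A)\<^sup>2 * y\<^sup>2 + j A * j B * y + (j B)\<^sup>2"
    by (simp only: three_eq_0 mult_zero_left diff_zero)
  have "elt a b c ^ 3 = \<iota> (a ^ 3) + \<iota> (b ^ 3) * y ^ 3 + \<iota> (c ^ 3) * (y\<^sup>2) ^ 3"
    by (simp only: elt_def cube_add power_mult_distrib map_power)
  also have "\<dots> = \<iota> (a ^ 3) + \<iota> (b ^ 3) * (\<iota> (to_fract A) * y - \<iota> (to_fract B)) +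
      \<iota> (c ^ 3) * ((j A)\<^sup>2 * y\<^sup>2 + j A * j B * y + (j B)\<^sup>2)"
    by (simp only: y6 root)
  also have "\<dots> = elt (a ^ 3 - b ^ 3 * to_fract B + c ^ 3 * (to_fract B * to_fract B))
     (to_fract A * b ^ 3 + c ^ 3 * (to_fract A * to_fract B)) (c ^ 3 * (to_fract A * to_fract A))"
    unfolding elt_def j_def map_add map_diff map_mult power2_eq_square
    by (simp only: algebra_simps)
  finally show ?thesis .
qed

text \<open>
  The gauge of a cube is three times the gauge: in characteristic \<open>3\<close> the cube of \<open>a + b y + c y\<^sup>2\<close>
  has no mixed terms, and the coefficient that determines the gauge cannot cancel.
\<close>

lemma G_if_cube_in_G:
  assumes "z \<in> F" "z ^ 3 \<in> G (3 * n + 2)"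
  shows "z \<in> G n"
proof -
  obtain a b c where z: "z = elt a b c" using assms(1) by (rule F_cases)
  let ?A = "to_fract A" and ?B = "to_fract B"
  have 0: "a ^ 3 - b ^ 3 * ?B + c ^ 3 * (?B * ?B) \<in> hdeg (3 * n + 2)"
    and 1: "?A * b ^ 3 + c ^ 3 * (?A * ?B) \<in> hdeg (3 * n + 2 - d)"
    and 2: "c ^ 3 * (?A * ?A) \<in> hdeg (3 * n + 2 - 2 * d)"
    using assms(2) by (auto simp: z cube_elt elt_in_G)
  have A: "?A \<noteq> 0" "neg_degree ?A = - d"
    using A_nonzero by (auto simp: neg_degree_to_fract)
  have c: "c \<in> hdeg (n - 2 * d)"
    using 2 A by (cases "c = 0") (auto simp: hdeg_iff neg_degree_mult neg_degree_power)
  have c3: "c ^ 3 \<in> hdeg (3 * n - 6 * d)" by (rule hdeg_cube[OF c]) simp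
  have "?A * ?B \<in> hdeg (5 * d)" "?B * ?B \<in> hdeg (6 * d)"
    by (rule hdeg_mult[OF A_hdeg B_hdeg] hdeg_mult[OF B_hdeg B_hdeg]; simp)+
  then have cAB: "c ^ 3 * (?A * ?B) \<in> hdeg (3 * n + 2 - d)" and cBB: "c ^ 3 * (?B * ?B) \<in> hdeg (3 * n + 2)"
    using hdeg_mono[OF hdeg_mult[OF c3 _ refl]] by auto
  have "?A * b ^ 3 \<in> hdeg (3 * n + 2 - d)"
    using hdeg_diff[OF 1 cAB] by simp
  then have b: "b \<in> hdeg (n - d)"
    using A by (cases "b = 0") (auto simp: hdeg_iff neg_degree_mult neg_degree_power)
  have b3: "b ^ 3 \<in> hdeg (3 * n - 3 * d)" by (rule hdeg_cube[OF b]) simp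
  have bB: "b ^ 3 * ?B \<in> hdeg (3 * n + 2)"
    by (rule hdeg_mono[OF hdeg_mult[OF b3 B_hdeg refl]]) simp
  have "a ^ 3 \<in> hdeg (3 * n + 2)"
    using hdeg_add[OF hdeg_diff[OF 0 cBB] bB] by simp
  then have "a \<in> hdeg n"
    by (cases "a = 0") (auto simp: hdeg_iff neg_degree_power)
  then show ?thesis using b c by (simp add: z elt_in_G)
qed

lemma G_exists:
  assumes "z \<in> F"
  shows "\<exists>n. z \<in> G n"
proof -
  obtain a b c where z: "z = elt a b c" using assms by (rule F_cases)
  \<comment> \<open>The sum of all weights is a bound for each of them.\<close>
  let ?n = "2 * d + \<bar>2 * neg_degree a\<bar> + \<bar>2 * neg_degree b\<bar> + \<bar>2 * neg_degree c\<bar>"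
  have "z \<in> G ?n"
    by (auto simp: z elt_in_G hdeg_iff)
  then show ?thesis by blast
qed

text \<open>
  The powers of an integral element are combinations of finitely many of them with coefficients of
  degree at most \<open>0\<close>. This is incompatible with a positive gauge, which cubing multiplies by \<open>3\<close>.
\<close>

lemma integral_at_infinity_imp_G:
  assumes z: "z \<in> F" and a: "\<And>i. a i \<in> deg_le 0" and eq: "z ^ n = (\<Sum>i<n. \<iota> (a i) * z ^ i)"
  shows "z \<in> G 0"
proof (rule ccontr)
  assume nz: "z \<notin> G 0"
  have zi: "z ^ i \<in> F" for i using z by (rule ff.power_in)
  have "\<forall>i. \<exists>n. z ^ i \<in> G n" using G_exists[OF zi] by blast
  then obtain C where C: "\<And>i. z ^ i \<in> G (C i)" by metis
  define M where "M = (\<Sum>i<n. \<bar>C i\<bar>)"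
  have a0: "a i \<in> hdeg 0" for i using a by (simp add: hdeg_def)
  have bounded: "z ^ m \<in> G M" for m
  proof (induction m rule: less_induct)
    case (less m)
    show ?case
    proof (cases "m < n")
      case True
      have "\<bar>C m\<bar> \<le> M" unfolding M_def using True by (intro member_le_sum) auto
      then show ?thesis by (intro G_mono[OF C]) simp
    next
      case False
      have "z ^ m = z ^ (m - n) * z ^ n" using False by (simp flip: power_add)
      also have "\<dots> = (\<Sum>i<n. \<iota> (a i) * z ^ (m - n + i))"
        unfolding eq sum_distrib_left by (intro sum.cong) (auto simp: power_add)
      also have "\<dots> \<in> G M"
      proof (rule G_sum)
        fix i assume i: "i \<in> {..<n}"
        then have "z ^ (m - n + i) \<in> G M" using False by (intro less.IH) auto
        then show "\<iota> (a i) * z ^ (m - n + i) \<in> G M" by (rule G_scale[OF a0]) simp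
      qed
      finally show ?thesis .
    qed
  qed
  \<comment> \<open>Iterated cubing makes a positive gauge grow without bound.\<close>
  have "z ^ 3 ^ s \<notin> G (3 ^ s - 1)" for s
  proof (induction s)
    case (Suc s)
    show ?case
    proof
      assume "z ^ 3 ^ Suc s \<in> G (3 ^ Suc s - 1)"
      moreover have "z ^ 3 ^ Suc s = (z ^ 3 ^ s) ^ 3"
        by (simp only: power_mult[symmetric] power_Suc mult.commute)
      moreover have "(3 ^ Suc s - 1 :: int) = 3 * (3 ^ s - 1) + 2" by simp
      ultimately have "z ^ 3 ^ s \<in> G (3 ^ s - 1)"
        using G_if_cube_in_G[OF zi, of "3 ^ s" "3 ^ s - 1"] by simp
      then show False using Suc by blast
    qed
  qed (use nz in simp)
  moreover have "int s < 3 ^ s" for s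
  proof (induction s)
    case (Suc s)
    have "(3 :: int) ^ Suc s = 3 * 3 ^ s" "int (Suc s) = int s + 1" by simp_all
    then show ?case using Suc by linarith
  qed simp
  from this[of "nat M"] have "M \<le> 3 ^ nat M - 1" by linarith
  then have "z ^ 3 ^ nat M \<in> G (3 ^ nat M - 1)" by (rule G_mono[OF bounded])
  ultimately show False by blast
qed


section \<open>Riemann-Roch spaces of multiples of the pole divisor of x\<close>

lemma eval_j: "(\<And>i. n < i \<Longrightarrow> coeff p i = 0) \<Longrightarrow> poly (map_poly j p) z = (\<Sum>i\<le>n. j (coeff p i) * z ^ i)"
proof (induction n arbitrary: p)
  case 0
  then have "p = [:coeff p 0:]" by (intro poly_eqI) (auto simp: coeff_pCons split: nat.split)
  then have "poly (map_poly j p) z = j (coeff p 0)"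
    by (metis map_poly_pCons j_simps(1) map_poly_0 poly_pCons poly_0 mult_zero_right add_0_right)
  then show ?case by simp
next
  case (Suc n)
  obtain c q where p: "p = pCons c q" by (cases p)
  have "coeff q i = 0" if "n < i" for i
    using Suc.prems[of "Suc i"] that by (simp add: p)
  then have "poly (map_poly j q) z = (\<Sum>i\<le>n. j (coeff q i) * z ^ i)" by (rule Suc.IH)
  then show ?case
    by (simp add: p map_poly_pCons sum.atMost_Suc_shift sum_distrib_left mult_ac del: sum.atMost_Suc)
qed

abbreviation integers :: "'b set" where "integers \<equiv> integral_closure \<iota> F"

lemma integral_iff:
  "z \<in> integers \<longleftrightarrow> z \<in> F \<and> (\<exists>n a. z ^ n = (\<Sum>i<n. j (a i) * z ^ i))"
proof -
  have "(\<exists>p :: 'a poly poly. lead_coeff p = 1 \<and> poly (map_poly j p) z = 0) \<longleftrightarrow>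
      (\<exists>n a. z ^ n = (\<Sum>i<n. j (a i) * z ^ i))"
  proof
    assume "\<exists>p :: 'a poly poly. lead_coeff p = 1 \<and> poly (map_poly j p) z = 0"
    then obtain p :: "'a poly poly" where p: "lead_coeff p = 1" "poly (map_poly j p) z = 0" by blast
    have "0 = (\<Sum>i\<le>degree p. j (coeff p i) * z ^ i)"
      using eval_j[of "degree p" p z] p(2) by (simp add: coeff_eq_0)
    also have "\<dots> = (\<Sum>i<degree p. j (coeff p i) * z ^ i) + z ^ degree p"
      using p(1) by (simp add: lessThan_Suc_atMost[symmetric])
    finally have "z ^ degree p = (\<Sum>i<degree p. j (- coeff p i) * z ^ i)"
      by (simp add: sum_negf eq_neg_iff_add_eq_0 add.commute)
    then show "\<exists>n a. z ^ n = (\<Sum>i<n. j (a i) * z ^ i)"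
      by (intro exI[of _ "degree p"] exI[of _ "\<lambda>i. - coeff p i"])
  next
    assume "\<exists>n a. z ^ n = (\<Sum>i<n. j (a i) * z ^ i)"
    then obtain n a where eq: "z ^ n = (\<Sum>i<n. j (a i) * z ^ i)" by blast
    define p where "p = monom 1 n - (\<Sum>i<n. monom (a i) i)"
    have coeff: "coeff p i = (if i = n then 1 else if i < n then - a i else 0)" for i
    proof -
      have "(\<Sum>k<n. coeff (monom (a k) k) i) = (if i < n then a i else 0)"
        by (simp add: sum.delta')
      then show ?thesis by (simp add: p_def coeff_sum)
    qed
    have "degree p = n"
      by (rule antisym[OF degree_le le_degree]) (auto simp: coeff)
    then have "lead_coeff p = 1" by (simp add: coeff)
    moreover have "poly (map_poly j p) z = (\<Sum>i\<le>n. j (coeff p i) * z ^ i)"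
      by (intro eval_j) (simp add: coeff)
    then have "poly (map_poly j p) z = (\<Sum>i<n. j (coeff p i) * z ^ i) + z ^ n"
      by (simp add: lessThan_Suc_atMost[symmetric] coeff)
    then have "poly (map_poly j p) z = 0"
      unfolding eq by (simp add: coeff sum_negf flip: sum.distrib)
    ultimately show "\<exists>p :: 'a poly poly. lead_coeff p = 1 \<and> poly (map_poly j p) z = 0" by blast
  qed
  moreover have "j = (\<lambda>a. \<iota> (to_fract a))" by (simp add: fun_eq_iff j_def)
  ultimately show ?thesis by (simp add: integral_closure_def)
qed

text \<open>
  At a pole of \<open>z\<close>, the power \<open>z ^ n\<close> has a strictly smaller value than the lower powers.
\<close>

lemma ball_if_integral:
  assumes v: "v \<in> ff.pl" and z: "z \<in> F" and a: "\<And>i. a i \<in> ff.ball v 0"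
    and eq: "z ^ n = (\<Sum>i<n. a i * z ^ i)"
  shows "z \<in> ff.ball v 0"
proof (rule ccontr)
  assume "\<not> ?thesis"
  then have neg: "z \<noteq> 0" "v z < 0" using z by (auto simp: ff.ball_def)
  have n: "n \<noteq> 0" using eq by (cases n) auto
  have "(\<Sum>i<n. a i * z ^ i) \<in> ff.ball v (int (n - 1) * v z)"
  proof (rule ff.ball_sum[OF v])
    fix i assume i: "i \<in> {..<n}"
    have "int (n - 1) * v z \<le> int i * v z"
      using i neg by (intro mult_right_mono_neg) auto
    then have "z ^ i \<in> ff.ball v (int (n - 1) * v z)"
      using z by (simp add: ff.ball_def ff.place_power[OF v z])
    then have "a i * z ^ i \<in> ff.ball v (0 + int (n - 1) * v z)"
      by (intro ff.ball_mult v a)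
    then show "a i * z ^ i \<in> ff.ball v (int (n - 1) * v z)" by simp
  qed
  then have "int (n - 1) * v z \<le> v (z ^ n)"
    using neg unfolding eq[symmetric] by (simp add: ff.ball_def)
  then show False
    using n neg by (simp add: ff.place_power[OF v z] of_nat_diff left_diff_distrib)
qed

lemma integral_imp_ball:
  assumes v: "v \<in> ff.pl" "0 \<le> v x" and z: "z \<in> integers"
  shows "z \<in> ff.ball v 0"
proof -
  obtain n a where eq: "z ^ n = (\<Sum>i<n. j (a i) * z ^ i)" and zF: "z \<in> F"
    using z by (auto simp: integral_iff)
  have "x \<in> ff.ball v 0" using v x_in_F by (simp add: ff.ball_def)
  then have "j p \<in> ff.ball v 0" for p
    using ff.ball_ev[OF v(1), of x p] by (simp add: ev_x)
  then show ?thesis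
    using eq by (intro ball_if_integral[OF v(1) zF, of "\<lambda>i. j (a i)" n]) auto
qed

text \<open>
  A place that is nonnegative on all polynomials does not lie above infinity.
\<close>

lemma finite_pole_if_not_integral:
  assumes z: "z \<in> F" "z \<notin> integers"
  shows "\<exists>v\<in>ff.pl. 0 \<le> v x \<and> v z < 0"
proof -
  have "\<exists>v\<in>ff.pl. range j \<subseteq> ff.ball v 0 \<and> v z < 0"
  proof (rule ff.pole_of_non_integral[OF _ _ _ z(1)])
    have "j p - j q \<in> range j" "j p * j q \<in> range j" "1 \<in> range j" for p q
      using rangeI[of j "p - q"] rangeI[of j "p * q"] rangeI[of j 1] by auto
    then show "is_subring (range j)" by (auto simp: is_subring_def)
    have "const c = j [:c:]" for c by (simp add: const_eq rat_const_def j_def)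
    then show "range const \<subseteq> range j" by auto
    show "range j \<subseteq> F" using j_in_F by auto
    fix n :: nat and a assume "\<And>i :: nat. a i \<in> range j"
    then have "\<forall>i. \<exists>p. a i = j p" by blast
    then obtain p where "\<And>i. a i = j (p i)" by metis
    then show "z ^ n \<noteq> (\<Sum>i<n. a i * z ^ i)"
      using z by (auto simp: integral_iff)
  qed
  then obtain v where v: "v \<in> ff.pl" "range j \<subseteq> ff.ball v 0" "v z < 0" by blast
  have "x = j [:0, 1:]" by (simp add: x_def rat_x_def j_def)
  then have "x \<in> ff.ball v 0" using v(2) by auto
  then show ?thesis using v x_nonzero by (auto simp: ff.ball_def)
qed

text \<open>
  If \<open>v y\<close> were smaller, \<open>y\<^sup>3\<close> would be the only term of least value in the equation of \<open>y\<close>, by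
  \<open>2 deg B \<le> 3 deg A\<close>.
\<close>

lemma place_y_infinity:
  assumes v: "v \<in> ff.pl" "v x < 0"
  shows "d * v x \<le> 2 * v y"
proof (rule ccontr)
  assume "\<not> ?thesis"
  then have less: "2 * v y < d * v x" by simp
  have y0: "y \<noteq> 0" using not_rational[of 0] by auto
  have vy3: "v (y ^ 3) = 3 * v y"
    using ff.place_power[OF v(1) y_in_F, of 3] by simp
  have "v (j A) = d * v x"
    using ff.place_ev_pole[OF v(1) x_in_F v(2) A_nonzero] by (simp add: ev_x)
  then have "v (j A * y) = d * v x + v y"
    using A_nonzero y0 by (simp add: ff.place_mult[OF v(1)] j_in_F y_in_F)
  then have "j A * y \<in> ff.ball v (3 * v y + 1)"
    using less j_in_F y_in_F by (simp add: ff.ball_def)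
  moreover have "j B \<in> ff.ball v (3 * v y + 1)"
  proof (cases "B = 0")
    case False
    have "v (j B) = int (degree B) * v x"
      using ff.place_ev_pole[OF v(1) x_in_F v(2) False] by (simp add: ev_x)
    moreover have "int (3 * degree A) * v x \<le> int (2 * degree B) * v x"
      using balanced v(2) by (intro mult_right_mono_neg) auto
    ultimately show ?thesis using less j_in_F by (simp add: ff.ball_def)
  qed simp
  ultimately have "j A * y - j B \<in> ff.ball v (3 * v y + 1)" by (rule ff.ball_diff[OF v(1)])
  then have "y ^ 3 \<in> ff.ball v (3 * v y + 1)" by (simp add: root j_def)
  then show False using y0 vy3 by (simp add: ff.ball_def)
qed

lemma G_imp_ball:
  assumes v: "v \<in> ff.pl" "v x < 0" and z: "z \<in> G (2 * n)"
  shows "z \<in> ff.ball v (n * v x)"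
proof -
  obtain a b c where abc: "z = elt a b c" "a \<in> hdeg (2 * n)" "b \<in> hdeg (2 * n - d)" "c \<in> hdeg (2 * n - 2 * d)"
    using z by (rule G_cases)
  have y0: "y \<noteq> 0" using not_rational[of 0] by auto
  note vy = place_y_infinity[OF v]
  have val: "m * v x \<le> 2 * v (\<iota> r)" if "r \<noteq> 0" "r \<in> hdeg m" for m r
  proof -
    have "- (2 * neg_degree r) \<le> m" using that by (simp add: hdeg_iff)
    then have "m * v x \<le> - (2 * neg_degree r) * v x"
      using v(2) by (intro mult_right_mono_neg) auto
    then show ?thesis by (simp add: place_iota[OF v] mult_ac)
  qed
  have "\<iota> a \<in> ff.ball v (n * v x)"
    using val[OF _ abc(2)] iota_in_F[of a] by (auto simp: ff.ball_def)
  moreover have "\<iota> b * y \<in> ff.ball v (n * v x)"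
  proof (cases "b = 0")
    case False
    then show ?thesis
      using val[OF False abc(3)] vy iota_in_F y_in_F y0
      by (simp add: ff.ball_def ff.place_mult[OF v(1)] left_diff_distrib)
  qed simp
  moreover have "\<iota> c * y\<^sup>2 \<in> ff.ball v (n * v x)"
  proof (cases "c = 0")
    case False
    then show ?thesis
      using val[OF False abc(4)] vy iota_in_F y_in_F y0
      by (simp add: ff.ball_def ff.place_mult[OF v(1)] ff.place_power[OF v(1)] left_diff_distrib)
  qed simp
  ultimately show ?thesis
    unfolding abc(1) elt_def by (intro ff.ball_add[OF v(1)])
qed

text \<open>
  The conditions at the places not above infinity say that \<open>f\<close> is integral over \<open>k[x]\<close>. Those at the
  places above infinity say that \<open>f / x ^ n\<close> is integral over the functions regular at infinity,
  which is a bound on the gauge.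
\<close>

theorem Lsp_pole_multiple: "ff.Lsp (ff.pole_multiple x n) = integers \<inter> G (2 * int n)"
proof (intro equalityI subsetI)
  fix f assume f: "f \<in> ff.Lsp (ff.pole_multiple x n)"
  then have fF: "f \<in> F"
    and ball: "\<And>v. v \<in> ff.pl \<Longrightarrow> f \<in> ff.ball v (- ff.pole_multiple x n v)"
    by (auto simp: ff.Lsp_def)
  have "f \<in> integers"
  proof (rule ccontr)
    assume "f \<notin> integers"
    then obtain v where v: "v \<in> ff.pl" "0 \<le> v x" "v f < 0"
      using finite_pole_if_not_integral[OF fF] by blast
    then show False
      using ball[OF v(1)] ff.place_zero[OF v(1)] by (auto simp: ff.ball_def ff.pole_multiple_def)
  qed
  define z where "z = f / x ^ n"
  have zF: "z \<in> F" using fF x_in_F by (simp add: z_def)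
  have "z \<in> G 0"
  proof (rule ccontr)
    assume nz: "z \<notin> G 0"
    then have "z \<noteq> 0" using G_zero by auto
    then have f0: "f \<noteq> 0" by (auto simp: z_def)
    obtain v where v: "v \<in> ff.pl" "v x \<le> 0" "v z < 0"
      using pole_at_infinity[OF zF] integral_at_infinity_imp_G[OF zF] nz by blast
    have "v z = v f - int n * v x"
      using f0 fF x_in_F x_nonzero by (simp add: z_def ff.place_divide[OF v(1)] ff.place_power[OF v(1)])
    moreover have "- ff.pole_multiple x n v = int n * v x"
      using v by (simp add: ff.pole_multiple_def)
    ultimately show False
      using ball[OF v(1)] v(3) f0 by (simp add: ff.ball_def)
  qed
  have "rat_x ^ n \<in> (hdeg (2 * int n) :: 'a poly fract set)"
  proof -
    have "rat_x \<noteq> (0 :: 'a poly fract)" "neg_degree (rat_x :: 'a poly fract) = - 1"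
      using neg_degree_to_fract[of "[:0, 1 :: 'a:]"] by (auto simp: rat_x_def)
    then show ?thesis by (simp add: hdeg_iff neg_degree_power)
  qed
  then have "\<iota> (rat_x ^ n) * z \<in> G (2 * int n)"
    using \<open>z \<in> G 0\<close> by (rule G_scale) simp
  moreover have "\<iota> (rat_x ^ n) * z = f" using x_nonzero by (simp add: z_def x_def)
  ultimately show "f \<in> integers \<inter> G (2 * int n)" using \<open>f \<in> integers\<close> by simp
next
  fix f assume f: "f \<in> integers \<inter> G (2 * int n)"
  then have "f \<in> F" using G_in_F by blast
  moreover have "f \<in> ff.ball v (- ff.pole_multiple x n v)" if v: "v \<in> ff.pl" for v
    using integral_imp_ball[OF v, of f] G_imp_ball[OF v, of f "int n"] f v
    by (cases "v x < 0") (auto simp: ff.pole_multiple_def)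
  ultimately show "f \<in> ff.Lsp (ff.pole_multiple x n)" by (auto simp: ff.Lsp_def)
qed

text \<open>
  Take the denominator of the inverse of a uniformizer: the numerator is integral, so the
  pole comes from a zero of the denominator.
\<close>

lemma finite_place_polynomial:
  assumes v: "v \<in> ff.pl" "0 \<le> v x"
  shows "\<exists>p. p \<noteq> 0 \<and> 0 < v (ff.ev x p)"
proof -
  obtain t where t: "t \<in> F" "t \<noteq> 0" "v t = 1" using ff.place_unif[OF v(1)] by blast
  then have "inverse t \<in> F" by (intro ff.inverse_in)
  then obtain s n where s: "s \<noteq> 0" "j s * inverse t \<in> W n" using integral_multiple by blast
  obtain p q r where w: "j s * inverse t = j p + j q * y + j r * y\<^sup>2"
    using s(2) by (rule W_E)
  have "x \<in> ff.ball v 0" using v x_in_F by (simp add: ff.ball_def)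
  then have jb: "j p \<in> ff.ball v 0" for p
    using ff.ball_ev[OF v(1), of x p] by (simp add: ev_x)
  have yb: "y \<in> ff.ball v 0"
  proof (rule ball_if_integral[OF v(1) y_in_F, of "\<lambda>i. if i = 0 then - j B else if i = 1 then j A else 0" 3])
    show "y ^ 3 = (\<Sum>i<3. (if i = 0 then - j B else if i = 1 then j A else 0) * y ^ i)"
      by (simp add: numeral_3_eq_3 y3 add.commute)
  qed (use jb ff.ball_minus[OF v(1)] in auto)
  have "j q * y \<in> ff.ball v (0 + 0)" "j r * y\<^sup>2 \<in> ff.ball v (0 + 0)"
    by (intro ff.ball_mult v(1) jb yb ff.ball_power)+
  then have "j s * inverse t \<in> ff.ball v 0"
    unfolding w by (intro ff.ball_add v(1) jb) auto
  then have "0 \<le> v (j s * inverse t)"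
    using s t by (simp add: ff.ball_def)
  then have "1 \<le> v (j s)"
    using s t j_in_F by (simp add: ff.place_mult[OF v(1)] ff.place_inverse[OF v(1)])
  then show ?thesis using s by (intro exI[of _ s]) (simp add: ev_x)
qed

end

context cubic_extension
begin

section \<open>Traces and discriminants\<close>

text \<open>
  Expanding the elements of one basis in the other turns both sides into the same double sum.
\<close>

lemma trace_basis_independent:
  assumes S: "finite S" "K.independent S" "K.span S = F"
    and T: "finite T" "K.independent T" "K.span T = F" and z: "z \<in> F"
  shows "(\<Sum>b\<in>S. K.representation S (z * b) b) = (\<Sum>c\<in>T. K.representation T (z * c) c)"
proof -
  have expand: "w = (\<Sum>b\<in>D. \<iota> (K.representation D w b) * b)"
    if "finite D" "K.independent D" "K.span D = F" "w \<in> F" for D w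
    using K.sum_representation_eq[of D w D] that by simp
  have rep: "K.representation D (z * b) d = (\<Sum>e\<in>E. K.representation E b e * K.representation D (z * e) d)"
    if D: "finite D" "K.independent D" "K.span D = F" and E: "finite E" "K.independent E" "K.span E = F"
      and b: "b \<in> F" for D E b d
  proof -
    have inF: "e \<in> F" if "e \<in> E" for e using K.span_base[OF that] E by simp
    have "z * b = (\<Sum>e\<in>E. \<iota> (K.representation E b e) * (z * e))"
      by (subst expand[OF E b]) (simp add: sum_distrib_left mult_ac)
    then have "K.representation D (z * b) d =
        (\<Sum>e\<in>E. K.representation D (\<iota> (K.representation E b e) * (z * e)) d)"
      using D E z inF iota_in_F by (simp add: K.representation_sum F_mult)
    also have "\<dots> = (\<Sum>e\<in>E. K.representation E b e * K.representation D (z * e) d)"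
      using D z inF by (intro sum.cong) (auto simp: K.representation_scale F_mult)
    finally show ?thesis .
  qed
  have BF: "b \<in> F" if "b \<in> S" for b using K.span_base[OF that] S by simp
  have CF: "c \<in> F" if "c \<in> T" for c using K.span_base[OF that] T by simp
  have "(\<Sum>b\<in>S. K.representation S (z * b) b) =
      (\<Sum>b\<in>S. \<Sum>c\<in>T. K.representation T b c * K.representation S (z * c) b)"
    by (intro sum.cong refl rep S T BF)
  also have "\<dots> = (\<Sum>c\<in>T. \<Sum>b\<in>S. K.representation S (z * c) b * K.representation T b c)"
    by (subst sum.swap) (simp add: mult.commute)
  also have "\<dots> = (\<Sum>c\<in>T. K.representation T (z * c) c)"
  proof (rule sum.cong[OF refl])
    fix c assume c: "c \<in> T"
    have zc: "z * c \<in> F" using z CF[OF c] by (rule F_mult)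
    have "K.representation T (z * c) c =
        K.representation T (\<Sum>b\<in>S. \<iota> (K.representation S (z * c) b) * b) c"
      using expand[OF S zc] by simp
    also have "\<dots> = (\<Sum>b\<in>S. K.representation T (\<iota> (K.representation S (z * c) b) * b) c)"
      using T BF iota_in_F by (simp add: K.representation_sum F_mult)
    also have "\<dots> = (\<Sum>b\<in>S. K.representation S (z * c) b * K.representation T b c)"
      using T BF by (intro sum.cong) (auto simp: K.representation_scale)
    finally show "(\<Sum>b\<in>S. K.representation S (z * c) b * K.representation T b c) =
        K.representation T (z * c) c" ..
  qed
  finally show ?thesis .
qed

abbreviation power_basis :: "'l set" where "power_basis \<equiv> {1, y, y\<^sup>2}"

lemma power_basis: "finite power_basis" "K.independent power_basis" "K.span power_basis = F"
  using independent_multiples(1)[of 1] span_basis by auto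

lemma power_basis_distinct: "1 \<noteq> y" "1 \<noteq> y\<^sup>2" "y \<noteq> y\<^sup>2"
  using elt_eq_0[of 1 "- 1" 0] elt_eq_0[of 1 0 "- 1"] elt_eq_0[of 0 1 "- 1"]
  by (auto simp: elt_def)

lemma field_trace_eq:
  assumes "z \<in> F"
  shows "field_trace \<iota> F z = (\<Sum>b\<in>power_basis. K.representation power_basis (z * b) b)"
proof -
  let ?B = "SOME B. K.independent B \<and> K.span B = F"
  have B: "K.independent ?B" "K.span ?B = F"
    using someI_ex[of "\<lambda>B. K.independent B \<and> K.span B = F"] power_basis by blast+
  then have "finite ?B"
    using K.independent_span_bound[OF power_basis(1), of ?B] power_basis(3) K.span_superset[of ?B] by simp
  then show ?thesis
    unfolding field_trace_def Let_def
    using trace_basis_independent[OF _ B power_basis assms] by simp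
qed

lemma representation_elt:
  "K.representation power_basis (elt a b c) =
     (\<lambda>u. if u = 1 then a else if u = y then b else if u = y\<^sup>2 then c else 0)"
proof -
  have in_span: "u \<in> K.span power_basis" if "u \<in> power_basis" for u
    using that by (rule K.span_base)
  have rep: "K.representation power_basis (\<iota> r * u) = (\<lambda>v. if v = u then r else 0)"
    if "u \<in> power_basis" for r u
    using K.representation_scale[OF power_basis(2) in_span[OF that], of r]
      K.representation_basis[OF power_basis(2) that] by (auto simp: fun_eq_iff)
  have "elt a b c = (\<iota> a * 1 + \<iota> b * y) + \<iota> c * y\<^sup>2" by (simp add: elt_def)
  then have "K.representation power_basis (elt a b c) =
      (\<lambda>u. (K.representation power_basis (\<iota> a * 1) u + K.representation power_basis (\<iota> b * y) u)
        + K.representation power_basis (\<iota> c * y\<^sup>2) u)"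
    using in_span by (simp only: K.representation_add[OF power_basis(2)] K.span_add K.span_scale insert_iff simp_thms)
  also have "\<dots> = (\<lambda>u. if u = 1 then a else if u = y then b else if u = y\<^sup>2 then c else 0)"
    using power_basis_distinct by (simp only: rep insert_iff simp_thms) auto
  finally show ?thesis .
qed

lemma field_trace_elt:
  "field_trace \<iota> F (elt a b c) = 3 * a + 2 * (c * to_fract A)"
proof -
  have y_elt: "elt a b c * y = elt (- (c * to_fract B)) (a + c * to_fract A) b"
    using elt_mult_y by (simp add: mult.commute)
  have "elt a b c * y\<^sup>2 = y * (elt a b c * y)"
    by (simp add: power2_eq_square mult_ac)
  also have "\<dots> = elt (- (b * to_fract B)) (- (c * to_fract B) + b * to_fract A) (a + c * to_fract A)"
    unfolding y_elt elt_mult_y ..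
  finally have y2_elt: "elt a b c * y\<^sup>2 =
    elt (- (b * to_fract B)) (- (c * to_fract B) + b * to_fract A) (a + c * to_fract A)" .
  have "field_trace \<iota> F (elt a b c) =
     K.representation power_basis (elt a b c * 1) 1 +
     (K.representation power_basis (elt a b c * y) y + K.representation power_basis (elt a b c * y\<^sup>2) (y\<^sup>2))"
    unfolding field_trace_eq[OF elt_in_F] using power_basis_distinct
    by (subst sum.insert, simp, simp, subst sum.insert, simp, simp) simp
  also have "\<dots> = a + ((a + c * to_fract A) + (a + c * to_fract A))"
    unfolding y_elt y2_elt mult_1_right representation_elt using power_basis_distinct by simp
  finally show ?thesis by simp
qed

lemma field_trace_add: "z \<in> F \<Longrightarrow> w \<in> F \<Longrightarrow> field_trace \<iota> F (z + w) = field_trace \<iota> F z + field_trace \<iota> F w"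
  and field_trace_scale: "z \<in> F \<Longrightarrow> field_trace \<iota> F (\<iota> r * z) = r * field_trace \<iota> F z"
  by (elim F_cases, simp add: elt_add elt_scale field_trace_elt algebra_simps)+

lemma field_trace_sum: "finite S \<Longrightarrow> (\<And>i. i \<in> S \<Longrightarrow> f i \<in> F) \<Longrightarrow>
    field_trace \<iota> F (sum f S) = (\<Sum>i\<in>S. field_trace \<iota> F (f i))"
proof (induction S rule: finite_induct)
  case empty
  then show ?case using field_trace_elt[of 0 0 0] by (simp add: elt_def)
qed (simp add: field_trace_add ff.sum_in)

text \<open>
  By linearity of the trace, the Gram matrix \<open>g\<close> becomes \<open>M g M\<^sup>T\<close>.
\<close>

lemma discriminant_change_basis:
  fixes b b' :: "'l ^ 'n" and M :: "'a poly fract ^ 'n ^ 'n"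
  assumes b: "\<And>i. b $ i \<in> F" and b': "\<And>i. b' $ i = (\<Sum>k\<in>UNIV. \<iota> (M $ i $ k) * b $ k)"
  shows "discriminant \<iota> F b' = (det M)\<^sup>2 * discriminant \<iota> F b"
proof -
  let ?T = "field_trace \<iota> F"
  let ?g = "(\<chi> i j. ?T (b $ i * b $ j)) :: 'a poly fract ^ 'n ^ 'n"
  have "(\<chi> i j. ?T (b' $ i * b' $ j)) = M ** ?g ** transpose M"
  proof -
    have "?T (b' $ p * b' $ q) = (M ** ?g ** transpose M) $ p $ q" for p q
    proof -
      have "?T (b' $ p * b' $ q) = ?T
          (\<Sum>k\<in>UNIV. \<Sum>l\<in>UNIV. \<iota> (M $ p $ k) * (\<iota> (M $ q $ l) * (b $ k * b $ l)))"
        by (simp add: b' sum_product mult_ac)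
      also have "\<dots> =
          (\<Sum>k\<in>UNIV. ?T (\<Sum>l\<in>UNIV. \<iota> (M $ p $ k) * (\<iota> (M $ q $ l) * (b $ k * b $ l))))"
        by (rule field_trace_sum) (auto intro!: ff.sum_in ff.mult_in iota_in_F b)
      also have "\<dots> =
          (\<Sum>k\<in>UNIV. \<Sum>l\<in>UNIV. ?T (\<iota> (M $ p $ k) * (\<iota> (M $ q $ l) * (b $ k * b $ l))))"
        by (intro sum.cong refl field_trace_sum) (auto intro!: ff.mult_in iota_in_F b)
      also have "\<dots> =
          (\<Sum>k\<in>UNIV. \<Sum>l\<in>UNIV. M $ p $ k * (M $ q $ l * ?T (b $ k * b $ l)))"
      proof (intro sum.cong refl)
        fix k l
        have "b $ k * b $ l \<in> F" "\<iota> (M $ q $ l) * (b $ k * b $ l) \<in> F"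
          by (intro ff.mult_in iota_in_F b)+
        then show "?T (\<iota> (M $ p $ k) * (\<iota> (M $ q $ l) * (b $ k * b $ l))) =
            M $ p $ k * (M $ q $ l * ?T (b $ k * b $ l))"
          by (simp only: field_trace_scale)
      qed
      also have "\<dots> = (\<Sum>l\<in>UNIV. \<Sum>k\<in>UNIV. M $ p $ k * (M $ q $ l * ?T (b $ k * b $ l)))"
        by (rule sum.swap)
      also have "\<dots> = (M ** ?g ** transpose M) $ p $ q"
        by (simp add: matrix_matrix_mult_def transpose_def sum_distrib_right sum_distrib_left mult_ac)
      finally show ?thesis .
    qed
    then show ?thesis by (simp add: vec_eq_iff)
  qed
  then show ?thesis
    by (simp add: discriminant_def det_mul det_transpose power2_eq_square mult_ac)
qed

end


context balanced_cubic
begin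

lemma three_fract_eq_0: "(3 :: 'a poly fract) = 0"
proof -
  have "\<iota> (1 + 1 + 1) = 1 + 1 + 1" by (simp only: map_add map_one)
  also have "\<dots> = 0" using three_eq_0 by simp
  finally have "(1 + 1 + 1 :: 'a poly fract) = 0" by (simp only: map_eq_0_iff)
  then show ?thesis by simp
qed

text \<open>
  Since \<open>3 = 0\<close>, the trace of \<open>a + b y + c y\<^sup>2\<close> is \<open>2 A c\<close>; the Gram matrix of \<open>1, y, y\<^sup>2\<close> therefore
  vanishes above the antidiagonal, whose entries are all \<open>2 A\<close>.
\<close>

lemma discriminant_power_basis_nonzero: "discriminant \<iota> F (vector [1, y, y\<^sup>2] :: 'b ^ 3) \<noteq> 0"
proof -
  let ?A = "to_fract A"
  have trace: "field_trace \<iota> F (elt a b c) = 2 * (c * ?A)" for a b c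
    by (simp only: field_trace_elt three_fract_eq_0 mult_zero_left add_0_left)
  have powers: "1 = elt 1 0 0" "y = elt 0 1 0" "y * y = elt 0 0 1"
    by (auto simp: elt_def power2_eq_square)
  have y3_elt: "y * (y * y) = elt (- to_fract B) ?A 0"
    unfolding powers(3) elt_mult_y by simp
  have y4_elt: "y * (y * (y * y)) = elt 0 (- to_fract B) ?A"
    unfolding y3_elt elt_mult_y by simp
  have T: "field_trace \<iota> F 1 = 0" "field_trace \<iota> F y = 0" "field_trace \<iota> F (y * y) = 2 * ?A"
    "field_trace \<iota> F (y * (y * y)) = 0" "field_trace \<iota> F (y * (y * (y * y))) = 2 * (?A * ?A)"
  proof -
    show "field_trace \<iota> F 1 = 0" using trace[of 1 0 0] by (simp flip: powers(1))
    show "field_trace \<iota> F y = 0" using trace[of 0 1 0] by (simp flip: powers(2))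
    show "field_trace \<iota> F (y * y) = 2 * ?A" using trace[of 0 0 1] by (simp flip: powers(3))
    show "field_trace \<iota> F (y * (y * y)) = 0" unfolding y3_elt trace by simp
    show "field_trace \<iota> F (y * (y * (y * y))) = 2 * (?A * ?A)" unfolding y4_elt trace by simp
  qed
  have "discriminant \<iota> F (vector [1, y, y\<^sup>2] :: 'b ^ 3) = - (2 * ?A * (2 * ?A) * (2 * ?A))"
    by (simp add: discriminant_def det_3 power2_eq_square mult.assoc T power3_eq_cube)
  moreover have "(2 :: 'a poly fract) \<noteq> 0"
  proof
    assume "(2 :: 'a poly fract) = 0"
    then have "(3 :: 'a poly fract) - 2 = 0" using three_fract_eq_0 by simp
    then show False by simp
  qed
  then have "2 * ?A \<noteq> 0" using A_nonzero by simp
  then have "2 * ?A * (2 * ?A) * (2 * ?A) \<noteq> 0" by (simp only: mult_eq_0_iff simp_thms)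
  ultimately show ?thesis by (simp only: neg_equal_0_iff_equal not_False_eq_True)
qed


section \<open>A triangular integral basis\<close>

text \<open>
  Integrality is a condition on places, from which the ring properties of the integral closure
  follow at once.
\<close>

lemma integers_iff: "z \<in> integers \<longleftrightarrow> z \<in> F \<and> (\<forall>v\<in>ff.pl. 0 \<le> v x \<longrightarrow> z \<in> ff.ball v 0)"
proof
  assume z: "z \<in> integers"
  then show "z \<in> F \<and> (\<forall>v\<in>ff.pl. 0 \<le> v x \<longrightarrow> z \<in> ff.ball v 0)"
    using integral_imp_ball by (auto simp: integral_iff)
next
  assume z: "z \<in> F \<and> (\<forall>v\<in>ff.pl. 0 \<le> v x \<longrightarrow> z \<in> ff.ball v 0)"
  show "z \<in> integers"
  proof (rule ccontr)
    assume "z \<notin> integers"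
    then obtain v where v: "v \<in> ff.pl" "0 \<le> v x" "v z < 0"
      using finite_pole_if_not_integral z by blast
    then have "z \<in> ff.ball v 0" using z by blast
    then show False using v(3) ff.place_zero[OF v(1)] by (auto simp: ff.ball_def)
  qed
qed

lemma integers_add: "z \<in> integers \<Longrightarrow> w \<in> integers \<Longrightarrow> z + w \<in> integers"
  and integers_diff: "z \<in> integers \<Longrightarrow> w \<in> integers \<Longrightarrow> z - w \<in> integers"
  and integers_mult: "z \<in> integers \<Longrightarrow> w \<in> integers \<Longrightarrow> z * w \<in> integers"
  using ff.ball_add ff.ball_diff ff.ball_mult[of _ z 0 w 0] by (auto simp: integers_iff)

lemma j_integral: "j p \<in> integers"
  unfolding integral_iff
  using j_in_F by (auto intro!: exI[of _ 1] exI[of _ "\<lambda>_. p"])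

lemma y_integral: "y \<in> integers"
  unfolding integral_iff
proof (intro conjI exI)
  show "y ^ 3 = (\<Sum>i<3. j (if i = 0 then - B else if i = 1 then A else 0) * y ^ i)"
    by (simp add: numeral_3_eq_3 y3 add.commute)
qed (rule y_in_F)

text \<open>
  The numerators over the common denominator \<open>\<delta>\<close> form an ideal of \<open>k[x]\<close>, generated by an
  element \<open>g\<close> of least degree. As \<open>1\<close> belongs to \<open>J\<close>, \<open>g\<close> divides \<open>\<delta>\<close>, and \<open>g / \<delta> = 1 / d\<close>.
\<close>

lemma fractional_ideal_principal:
  fixes J :: "'k::field poly fract set"
  assumes diff: "\<And>a b. a \<in> J \<Longrightarrow> b \<in> J \<Longrightarrow> a - b \<in> J"
    and scale: "\<And>r a. a \<in> J \<Longrightarrow> to_fract r * a \<in> J" and one: "1 \<in> J"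
    and \<delta>: "\<delta> \<noteq> 0" "\<And>a. a \<in> J \<Longrightarrow> \<exists>p. to_fract \<delta> * a = to_fract p"
  shows "\<exists>d. d \<noteq> 0 \<and> 1 / to_fract d \<in> J \<and> (\<forall>a\<in>J. \<exists>r. a = to_fract r / to_fract d)"
proof -
  define P where "P p \<longleftrightarrow> to_fract p / to_fract \<delta> \<in> J" for p
  have "P \<delta> \<and> \<delta> \<noteq> 0" using one \<delta> by (simp add: P_def)
  then obtain g where g: "P g" "g \<noteq> 0" and gmin: "\<And>h. P h \<Longrightarrow> h \<noteq> 0 \<Longrightarrow> degree g \<le> degree h"
    using ex_has_least_nat[of "\<lambda>g. P g \<and> g \<noteq> 0" \<delta> degree] by blast
  have dvd: "\<exists>r. p = g * r" if p: "P p" for p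
  proof -
    have "to_fract p / to_fract \<delta> - to_fract (p div g) * (to_fract g / to_fract \<delta>) \<in> J"
      by (rule diff[OF p[unfolded P_def] scale[OF g(1)[unfolded P_def]]])
    also have "to_fract p / to_fract \<delta> - to_fract (p div g) * (to_fract g / to_fract \<delta>) =
        to_fract (p - p div g * g) / to_fract \<delta>"
      by (simp add: diff_divide_distrib)
    finally have "P (p mod g)" by (simp only: P_def minus_div_mult_eq_mod)
    then have "p mod g = 0"
      using gmin[of "p mod g"] degree_mod_less[of g p] g(2) by fastforce
    then show ?thesis by (metis mult_div_mod_eq add.right_neutral)
  qed
  obtain d where d: "\<delta> = g * d" using dvd[of \<delta>] \<open>P \<delta> \<and> \<delta> \<noteq> 0\<close> by blast
  then have "d \<noteq> 0" using \<delta> by auto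
  moreover have "to_fract g / to_fract \<delta> = 1 / to_fract d"
    using d g by simp
  then have "1 / to_fract d \<in> J" using g by (simp add: P_def)
  moreover have "\<exists>r. a = to_fract r / to_fract d" if a: "a \<in> J" for a
  proof -
    obtain p where p: "to_fract \<delta> * a = to_fract p" using \<delta> a by blast
    then have a_eq: "a = to_fract p / to_fract \<delta>" using \<delta>(1) by (simp add: field_simps)
    then obtain r where "p = g * r" using dvd[of p] a by (auto simp: P_def)
    then show ?thesis using a_eq d g by (intro exI[of _ r]) simp
  qed
  ultimately show ?thesis by blast
qed

lemma W_coordinates:
  assumes "elt a b c \<in> W n"
  shows "\<exists>p q r. a = to_fract p \<and> b = to_fract q \<and> c = to_fract r"
proof -
  obtain p q r where "elt a b c = j p + j q * y + j r * y\<^sup>2" using assms by (rule W_E)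
  then have "elt a b c = elt (to_fract p) (to_fract q) (to_fract r)" by (simp add: elt_def j_def)
  then show ?thesis unfolding elt_inject by blast
qed

lemma common_denominator:
  fixes b :: "'b ^ 3"
  assumes b: "is_integral_basis \<iota> F b"
  shows "\<exists>\<delta>. \<delta> \<noteq> 0 \<and> (\<forall>p q r. elt p q r \<in> integers \<longrightarrow>
    (\<exists>p' q' r'. to_fract \<delta> * p = to_fract p' \<and> to_fract \<delta> * q = to_fract q' \<and> to_fract \<delta> * r = to_fract r'))"
proof -
  have bF: "b $ i \<in> F" for i
    using b by (auto simp: is_integral_basis_def integral_iff)
  then have "range (($) b) \<subseteq> F" by auto
  then obtain \<delta> n where \<delta>: "\<delta> \<noteq> 0" "\<And>i. j \<delta> * b $ i \<in> W n"
    using integral_multiple_finite[of "range (($) b)"] by auto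
  have "\<exists>p' q' r'. to_fract \<delta> * p = to_fract p' \<and> to_fract \<delta> * q = to_fract q' \<and> to_fract \<delta> * r = to_fract r'"
    if z: "elt p q r \<in> integers" for p q r
  proof -
    obtain c :: "'a poly ^ 3" where c: "elt p q r = (\<Sum>i\<in>UNIV. j (c $ i) * b $ i)"
      using b z unfolding is_integral_basis_def j_def by blast
    have "j (c $ i) * (j \<delta> * b $ i) \<in> W (n + (\<Sum>i\<in>UNIV. degree (c $ i)))" for i
      by (rule W_mult_poly[OF \<delta>(2)]) (rule member_le_sum, auto)
    then have "(\<Sum>i\<in>UNIV. j (c $ i) * (j \<delta> * b $ i)) \<in> W (n + (\<Sum>i\<in>UNIV. degree (c $ i)))"
      by (rule W_sum)
    also have "(\<Sum>i\<in>UNIV. j (c $ i) * (j \<delta> * b $ i)) = \<iota> (to_fract \<delta>) * elt p q r"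
      by (simp add: c sum_distrib_left j_def mult_ac)
    also have "\<dots> = elt (to_fract \<delta> * p) (to_fract \<delta> * q) (to_fract \<delta> * r)"
      by (rule elt_scale)
    finally show ?thesis by (rule W_coordinates)
  qed
  then show ?thesis using \<delta>(1) by blast
qed

text \<open>
  The coefficients of an integral element in such a basis are unique because of the triangular shape,
  so only generation is required.
\<close>

definition triangular_basis :: "'a poly \<Rightarrow> 'a poly \<Rightarrow> 'a poly \<Rightarrow>
    'a poly fract \<Rightarrow> 'a poly fract \<Rightarrow> 'a poly fract \<Rightarrow> bool" where
  "triangular_basis d0 d1 d2 u1 u2 u3 \<longleftrightarrow> d0 \<noteq> 0 \<and> d1 \<noteq> 0 \<and> d2 \<noteq> 0 \<and>
     integers = {j r0 * elt (1 / to_fract d0) 0 0 + j r1 * elt u1 (1 / to_fract d1) 0 +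
       j r2 * elt u3 u2 (1 / to_fract d2) | r0 r1 r2. True}"

text \<open>
  The coefficients of \<open>y\<^sup>2\<close> of the integral elements form a fractional ideal of \<open>k[x]\<close>, which is
  principal; likewise the coefficients of \<open>y\<close> of the integral elements in \<open>k(x) + k(x) y\<close>, and
  the integral elements of \<open>k(x)\<close>.
\<close>

lemma triangular_basis_exists:
  fixes b :: "'b ^ 3"
  assumes b: "is_integral_basis \<iota> F b"
  shows "\<exists>d0 d1 d2 u1 u2 u3. triangular_basis d0 d1 d2 u1 u2 u3"
proof -
  obtain \<delta> where \<delta>: "\<delta> \<noteq> 0" "\<And>p q r. elt p q r \<in> integers \<Longrightarrow>
    (\<exists>p' q' r'. to_fract \<delta> * p = to_fract p' \<and> to_fract \<delta> * q = to_fract q' \<and> to_fract \<delta> * r = to_fract r')"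
    using common_denominator[OF b] by blast
  have scale: "elt (to_fract s * p) (to_fract s * q) (to_fract s * r) \<in> integers"
    if "elt p q r \<in> integers" for s p q r
    using integers_mult[OF j_integral[of s] that] by (simp add: j_def elt_scale)
  have diff: "elt (p - p') (q - q') (r - r') \<in> integers"
    if "elt p q r \<in> integers" "elt p' q' r' \<in> integers" for p q r p' q' r'
    using integers_diff[OF that] by (simp add: elt_diff)
  have one: "elt 1 0 0 \<in> integers" "elt 0 1 0 \<in> integers" "elt 0 0 1 \<in> integers"
    using j_integral[of 1] y_integral integers_mult[OF y_integral y_integral]
    by (auto simp: elt_def power2_eq_square)
  define J0 where "J0 = {a. elt a 0 0 \<in> integers}"
  define J1 where "J1 = {b. \<exists>a. elt a b 0 \<in> integers}"
  define J2 where "J2 = {c. \<exists>a b. elt a b c \<in> integers}"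
  have "\<exists>d. d \<noteq> 0 \<and> 1 / to_fract d \<in> J0 \<and> (\<forall>a\<in>J0. \<exists>r. a = to_fract r / to_fract d)"
  proof (rule fractional_ideal_principal[OF _ _ _ \<delta>(1)])
    show "a - b \<in> J0" if "a \<in> J0" "b \<in> J0" for a b
      using diff[of a 0 0 b 0 0] that by (simp add: J0_def)
    show "to_fract r * a \<in> J0" if "a \<in> J0" for r a
      using scale[of a 0 0 r] that by (simp add: J0_def)
    show "\<exists>p. to_fract \<delta> * a = to_fract p" if "a \<in> J0" for a
      using \<delta>(2)[of a 0 0] that by (auto simp: J0_def)
  qed (use one in \<open>simp add: J0_def\<close>)
  then obtain d0 where d0: "d0 \<noteq> 0" "1 / to_fract d0 \<in> J0" "\<forall>a\<in>J0. \<exists>r. a = to_fract r / to_fract d0"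
    by blast
  have "\<exists>d. d \<noteq> 0 \<and> 1 / to_fract d \<in> J1 \<and> (\<forall>a\<in>J1. \<exists>r. a = to_fract r / to_fract d)"
  proof (rule fractional_ideal_principal[OF _ _ _ \<delta>(1)])
    show "a - b \<in> J1" if ab: "a \<in> J1" "b \<in> J1" for a b
    proof -
      obtain s t where "elt s a 0 \<in> integers" "elt t b 0 \<in> integers" using ab by (auto simp: J1_def)
      then have "elt (s - t) (a - b) 0 \<in> integers" using diff[of s a 0 t b 0] by simp
      then show ?thesis by (auto simp: J1_def)
    qed
    show "to_fract r * a \<in> J1" if a: "a \<in> J1" for r a
    proof -
      obtain s where "elt s a 0 \<in> integers" using a by (auto simp: J1_def)
      then have "elt (to_fract r * s) (to_fract r * a) 0 \<in> integers" using scale[of s a 0 r] by simp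
      then show ?thesis by (auto simp: J1_def)
    qed
    show "\<exists>p. to_fract \<delta> * a = to_fract p" if "a \<in> J1" for a
      using \<delta>(2) that unfolding J1_def by blast
  qed (use one in \<open>auto simp: J1_def\<close>)
  then obtain d1 where d1: "d1 \<noteq> 0" "1 / to_fract d1 \<in> J1" "\<forall>a\<in>J1. \<exists>r. a = to_fract r / to_fract d1"
    by blast
  have "\<exists>d. d \<noteq> 0 \<and> 1 / to_fract d \<in> J2 \<and> (\<forall>a\<in>J2. \<exists>r. a = to_fract r / to_fract d)"
  proof (rule fractional_ideal_principal[OF _ _ _ \<delta>(1)])
    show "a - b \<in> J2" if ab: "a \<in> J2" "b \<in> J2" for a b
    proof -
      obtain s s' t t' where "elt s s' a \<in> integers" "elt t t' b \<in> integers" using ab by (auto simp: J2_def)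
      then have "elt (s - t) (s' - t') (a - b) \<in> integers" by (rule diff)
      then show ?thesis by (auto simp: J2_def)
    qed
    show "to_fract r * a \<in> J2" if a: "a \<in> J2" for r a
    proof -
      obtain s s' where "elt s s' a \<in> integers" using a by (auto simp: J2_def)
      then have "elt (to_fract r * s) (to_fract r * s') (to_fract r * a) \<in> integers" by (rule scale)
      then show ?thesis by (auto simp: J2_def)
    qed
    show "\<exists>p. to_fract \<delta> * a = to_fract p" if "a \<in> J2" for a
      using \<delta>(2) that unfolding J2_def by blast
  qed (use one in \<open>auto simp: J2_def\<close>)
  then obtain d2 where d2: "d2 \<noteq> 0" "1 / to_fract d2 \<in> J2" "\<forall>a\<in>J2. \<exists>r. a = to_fract r / to_fract d2"
    by blast
  obtain u1 where w1: "elt u1 (1 / to_fract d1) 0 \<in> integers" using d1 by (auto simp: J1_def)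
  obtain u3 u2 where w2: "elt u3 u2 (1 / to_fract d2) \<in> integers" using d2 by (auto simp: J2_def)
  have w0: "elt (1 / to_fract d0) 0 0 \<in> integers" using d0 by (simp add: J0_def)
  have "z \<in> {j r0 * elt (1 / to_fract d0) 0 0 + j r1 * elt u1 (1 / to_fract d1) 0 +
       j r2 * elt u3 u2 (1 / to_fract d2) | r0 r1 r2. True}" if z: "z \<in> integers" for z
  proof -
    have "z \<in> F" using z by (simp add: integral_iff)
    then obtain a b c where abc: "z = elt a b c" by (rule F_cases)
    obtain r2 where r2: "c = to_fract r2 / to_fract d2" using d2(3) z abc by (auto simp: J2_def)
    have z': "z - j r2 * elt u3 u2 (1 / to_fract d2) \<in> integers"
      by (intro integers_diff z integers_mult j_integral w2)
    have eq': "z - j r2 * elt u3 u2 (1 / to_fract d2) = elt (a - to_fract r2 * u3) (b - to_fract r2 * u2) 0"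
      by (simp add: abc j_def elt_scale elt_diff r2)
    obtain r1 where r1: "b - to_fract r2 * u2 = to_fract r1 / to_fract d1"
      using d1(3) z' unfolding eq' J1_def by blast
    have z'': "z - j r2 * elt u3 u2 (1 / to_fract d2) - j r1 * elt u1 (1 / to_fract d1) 0 \<in> integers"
      by (intro integers_diff[OF z'] integers_mult j_integral w1)
    have eq'': "z - j r2 * elt u3 u2 (1 / to_fract d2) - j r1 * elt u1 (1 / to_fract d1) 0 =
        elt (a - to_fract r2 * u3 - to_fract r1 * u1) 0 0"
      unfolding eq' by (simp add: j_def elt_scale elt_diff r1)
    obtain r0 where r0: "a - to_fract r2 * u3 - to_fract r1 * u1 = to_fract r0 / to_fract d0"
      using d0(3) z'' unfolding eq'' J0_def by blast
    have "z - j r2 * elt u3 u2 (1 / to_fract d2) - j r1 * elt u1 (1 / to_fract d1) 0 =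
        j r0 * elt (1 / to_fract d0) 0 0"
      unfolding eq'' by (simp add: j_def elt_scale r0)
    then have "z = j r0 * elt (1 / to_fract d0) 0 0 + j r1 * elt u1 (1 / to_fract d1) 0 +
       j r2 * elt u3 u2 (1 / to_fract d2)" by (simp add: algebra_simps)
    then show ?thesis by blast
  qed
  moreover have "j r0 * elt (1 / to_fract d0) 0 0 + j r1 * elt u1 (1 / to_fract d1) 0 +
       j r2 * elt u3 u2 (1 / to_fract d2) \<in> integers" for r0 r1 r2
    by (intro integers_add integers_mult j_integral w0 w1 w2)
  ultimately have "triangular_basis d0 d1 d2 u1 u2 u3"
    using d0 d1 d2 by (auto simp: triangular_basis_def)
  then show ?thesis by blast
qed

end

context balanced_cubic
begin

section \<open>The degree of the index\<close>

lemma triangular_combination: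
  "j r0 * elt (1 / to_fract d0) 0 0 + j r1 * elt u1 (1 / to_fract d1) 0 + j r2 * elt u3 u2 (1 / to_fract d2) =
     elt (to_fract r0 / to_fract d0 + (to_fract r1 * u1 + to_fract r2 * u3))
       (to_fract r1 / to_fract d1 + to_fract r2 * u2) (to_fract r2 / to_fract d2)"
  by (simp add: j_def elt_scale elt_add add.assoc)

text \<open>
  The transition matrix \<open>T\<close> from the triangular basis to \<open>1, y, y\<^sup>2\<close> has determinant \<open>d\<^sub>0 d\<^sub>1 d\<^sub>2\<close>. The
  one between the triangular basis and the given integral basis is invertible over \<open>k[x]\<close>,
  so its determinant is a constant. The square of the product of the two determinants equals \<open>I\<^sup>2\<close>.
\<close>

lemma degree_index:
  assumes tri: "triangular_basis d0 d1 d2 u1 u2 u3" and index: "is_index \<iota> F y I"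
  shows "degree I = degree d0 + degree d1 + degree d2"
proof -
  have d: "d0 \<noteq> 0" "d1 \<noteq> 0" "d2 \<noteq> 0"
    and integers_eq: "integers = {j r0 * elt (1 / to_fract d0) 0 0 + j r1 * elt u1 (1 / to_fract d1) 0 +
       j r2 * elt u3 u2 (1 / to_fract d2) | r0 r1 r2. True}"
    using tri by (auto simp: triangular_basis_def)
  obtain b :: "'b ^ 3" where b: "is_integral_basis \<iota> F b"
    and disc: "discriminant \<iota> F (vector [1, y, y\<^sup>2] :: 'b ^ 3) = (to_fract I)\<^sup>2 * discriminant \<iota> F b"
    using index by (auto simp: is_index_def)
  define w :: "'b ^ 3" where
    "w = vector [elt (1 / to_fract d0) 0 0, elt u1 (1 / to_fract d1) 0, elt u3 u2 (1 / to_fract d2)]"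
  have comb: "(\<Sum>i\<in>UNIV. j (r $ i) * w $ i) =
      elt (to_fract (r $ 1) / to_fract d0 + (to_fract (r $ 2) * u1 + to_fract (r $ 3) * u3))
       (to_fract (r $ 2) / to_fract d1 + to_fract (r $ 3) * u2) (to_fract (r $ 3) / to_fract d2)"
    for r :: "'a poly ^ 3"
    unfolding triangular_combination[symmetric] by (simp add: sum_3 w_def)
  have w_coords: "\<exists>r. z = (\<Sum>i\<in>UNIV. j (r $ i) * w $ i)" if z: "z \<in> integers" for z
  proof -
    obtain r0 r1 r2 where "z = j r0 * elt (1 / to_fract d0) 0 0 + j r1 * elt u1 (1 / to_fract d1) 0 +
       j r2 * elt u3 u2 (1 / to_fract d2)" using z unfolding integers_eq by blast
    then show ?thesis by (intro exI[of _ "vector [r0, r1, r2]"]) (simp add: sum_3 w_def)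
  qed
  have w_indep: "r = s" if eq: "(\<Sum>i\<in>UNIV. j (r $ i) * w $ i) = (\<Sum>i\<in>UNIV. j (s $ i) * w $ i)" for r s
  proof -
    have 3: "r $ 3 = s $ 3"
      using eq d unfolding comb elt_inject by simp
    then have 2: "r $ 2 = s $ 2"
      using eq d unfolding comb elt_inject by simp
    then have "r $ 1 = s $ 1"
      using eq d 3 unfolding comb elt_inject by simp
    then show ?thesis using 2 3 by (simp add: vec_eq_iff forall_3)
  qed
  have w_integral: "w $ i \<in> integers" for i
  proof -
    let ?e = "axis i 1 :: 'a poly ^ 3"
    have "w $ i = (\<Sum>k\<in>UNIV. j (?e $ k) * w $ k)"
      by (simp add: axis_def if_distrib[of j] if_distrib[of "\<lambda>u. u * _"] cong: if_cong)
    also have "\<dots> \<in> integers"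
      unfolding comb triangular_combination[symmetric] integers_eq by blast
    finally show ?thesis .
  qed
  have b_integral: "b $ i \<in> integers" for i
    using b by (simp add: is_integral_basis_def)
  have "\<forall>i. \<exists>r. w $ i = (\<Sum>k\<in>UNIV. j (r $ k) * b $ k)"
    using b w_integral unfolding is_integral_basis_def j_def by blast
  then obtain U' where U': "\<And>i. w $ i = (\<Sum>k\<in>UNIV. j (U' i $ k) * b $ k)" by metis
  define U :: "'a poly ^ 3 ^ 3" where "U = (\<chi> i. U' i)"
  have U: "w $ i = (\<Sum>k\<in>UNIV. j (U $ i $ k) * b $ k)" for i
    using U'[of i] by (simp add: U_def)
  have "\<forall>i. \<exists>r. b $ i = (\<Sum>k\<in>UNIV. j (r $ k) * w $ k)"
    using b_integral w_coords by blast
  then obtain V' where V': "\<And>i. b $ i = (\<Sum>k\<in>UNIV. j (V' i $ k) * w $ k)" by metis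
  define V :: "'a poly ^ 3 ^ 3" where "V = (\<chi> i. V' i)"
  have V: "b $ i = (\<Sum>k\<in>UNIV. j (V $ i $ k) * w $ k)" for i
    using V'[of i] by (simp add: V_def)
  have j_sum: "j (sum f S) = (\<Sum>s\<in>S. j (f s))" for f and S :: "3 set"
    by (simp add: j_def map_sum)
  have compose: "(\<Sum>k\<in>UNIV. j (P $ i $ k) * (\<Sum>l\<in>UNIV. j (Q $ k $ l) * c $ l)) =
      (\<Sum>l\<in>UNIV. j ((P ** Q) $ i $ l) * c $ l)" for P Q :: "'a poly ^ 3 ^ 3" and c :: "'b ^ 3" and i
  proof -
    have "(\<Sum>k\<in>UNIV. j (P $ i $ k) * (\<Sum>l\<in>UNIV. j (Q $ k $ l) * c $ l)) =
        (\<Sum>k\<in>UNIV. \<Sum>l\<in>UNIV. j (P $ i $ k) * j (Q $ k $ l) * c $ l)"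
      by (simp add: sum_distrib_left mult.assoc)
    also have "\<dots> = (\<Sum>l\<in>UNIV. \<Sum>k\<in>UNIV. j (P $ i $ k) * j (Q $ k $ l) * c $ l)"
      by (rule sum.swap)
    also have "\<dots> = (\<Sum>l\<in>UNIV. j ((P ** Q) $ i $ l) * c $ l)"
      by (simp add: matrix_matrix_mult_def j_sum sum_distrib_right)
    finally show ?thesis .
  qed
  \<comment> \<open>The two integral bases are related by an invertible matrix over \<open>k[x]\<close>.\<close>
  have "(U ** V) $ i = mat 1 $ i" for i
  proof (rule w_indep)
    have "(\<Sum>l\<in>UNIV. j ((U ** V) $ i $ l) * w $ l) = w $ i"
      unfolding compose[symmetric] V[symmetric] U[symmetric] ..
    also have "\<dots> = (\<Sum>l\<in>UNIV. j (mat 1 $ i $ l) * w $ l)"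
      by (simp add: mat_def if_distrib[of j] if_distrib[of "\<lambda>u. u * _"] cong: if_cong)
    finally show "(\<Sum>l\<in>UNIV. j ((U ** V) $ i $ l) * w $ l) = (\<Sum>l\<in>UNIV. j (mat 1 $ i $ l) * w $ l)" .
  qed
  then have "U ** V = mat 1" by (simp add: vec_eq_iff)
  then have unit: "det U * det V = 1" by (metis det_mul det_I)
  then have detU: "det U \<noteq> 0" and "det V \<noteq> 0" by auto
  then have "degree (det U) + degree (det V) = degree (det U * det V)"
    by (simp add: degree_mult_eq)
  then have degU: "degree (det U) = 0" by (simp add: unit)
  let ?e = "vector [1, y, y\<^sup>2] :: 'b ^ 3"
  have "?e $ i \<in> integers" for i
    using j_integral[of 1] y_integral integers_mult[OF y_integral y_integral]
    using exhaust_3[of i] by (auto simp: power2_eq_square)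
  then have "\<forall>i. \<exists>r. ?e $ i = (\<Sum>k\<in>UNIV. j (r $ k) * w $ k)"
    using w_coords by blast
  then obtain T' where T': "\<And>i. ?e $ i = (\<Sum>k\<in>UNIV. j (T' i $ k) * w $ k)" by metis
  define T :: "'a poly ^ 3 ^ 3" where "T = (\<chi> i. T' i)"
  have T: "?e $ i = (\<Sum>k\<in>UNIV. j (T $ i $ k) * w $ k)" for i
    using T'[of i] by (simp add: T_def)
  have e: "?e $ 1 = elt 1 0 0" "?e $ 2 = elt 0 1 0" "?e $ 3 = elt 0 0 1"
    by (auto simp: elt_def)
  have T1: "T $ 1 $ 3 = 0" "T $ 1 $ 2 = 0" "T $ 1 $ 1 = d0"
    using T[of 1] d unfolding e comb elt_inject by (auto simp: field_simps)
  have T2: "T $ 2 $ 3 = 0" "T $ 2 $ 2 = d1"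
    using T[of 2] d unfolding e comb elt_inject by (auto simp: field_simps)
  have T3: "T $ 3 $ 3 = d2"
    using T[of 3] d unfolding e comb elt_inject by (auto simp: field_simps)
  have detT: "det T = d0 * d1 * d2"
    by (simp add: det_3 T1 T2 T3)
  define M :: "'a poly fract ^ 3 ^ 3" where "M = (\<chi> i k. to_fract ((T ** U) $ i $ k))"
  have "?e $ i = (\<Sum>k\<in>UNIV. \<iota> (M $ i $ k) * b $ k)" for i
    using T[of i] unfolding U compose by (simp add: M_def j_def)
  moreover have "b $ i \<in> F" for i using b_integral[of i] by (simp add: integral_iff)
  ultimately have "discriminant \<iota> F ?e = (det M)\<^sup>2 * discriminant \<iota> F b"
    by (intro discriminant_change_basis)
  moreover have "det M = to_fract (det (T ** U))"
    by (simp add: det_3 M_def)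
  moreover have "discriminant \<iota> F b \<noteq> 0"
    using disc discriminant_power_basis_nonzero by auto
  ultimately have "(to_fract I)\<^sup>2 = (to_fract (det (T ** U)))\<^sup>2"
    using disc by simp
  then have "to_fract (I * I) = to_fract (det (T ** U) * det (T ** U))"
    by (simp only: power2_eq_square to_fract_mult)
  then have sq: "I * I = det (T ** U) * det (T ** U)" by (simp only: to_fract_eq_iff)
  have det_eq: "det (T ** U) = d0 * d1 * d2 * det U" by (simp add: det_mul detT)
  then have nz: "det (T ** U) \<noteq> 0" using d detU by simp
  then have "I \<noteq> 0" using sq by auto
  then have "degree I + degree I = degree (det (T ** U)) + degree (det (T ** U))"
    using arg_cong[OF sq, of degree] nz by (simp add: degree_mult_eq)
  moreover have "degree (det (T ** U)) = degree d0 + degree d1 + degree d2"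
    unfolding det_eq using d detU degU by (simp add: degree_mult_eq)
  ultimately show ?thesis by simp
qed


section \<open>Counting integral elements of bounded gauge\<close>

text \<open>
  Subtracting from \<open>\<rho> q\<close> its polynomial part leaves an error of negative degree, which affects no
  bound on the degree of a polynomial; so the translated set has as many elements as for \<open>\<rho> = 0\<close>.
\<close>

lemma card_bounded_coset:
  assumes q: "q \<noteq> 0" and nonneg: "0 \<le> m + int (degree q) + 1"
  shows "finite {r :: 'a poly. to_fract r / to_fract q + \<rho> \<in> deg_le m}"
    and "card {r :: 'a poly. to_fract r / to_fract q + \<rho> \<in> deg_le m} = CARD('a) ^ nat (m + int (degree q) + 1)"
proof -
  let ?N = "m + int (degree q)"
  obtain a c where ac: "c \<noteq> 0" "\<rho> * to_fract q = to_fract a / to_fract c" by (rule fract_cases)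
  define h where "h = a div c"
  define \<epsilon> where "\<epsilon> = to_fract (a mod c) / to_fract c"
  have "to_fract a = to_fract (h * c + a mod c)" by (simp only: h_def div_mult_mod_eq)
  then have split: "\<rho> * to_fract q = to_fract h + \<epsilon>"
    unfolding ac \<epsilon>_def using ac(1) by (simp add: field_simps)
  have "\<epsilon> \<in> deg_le (- 1)"
    unfolding \<epsilon>_def deg_le_divide_to_fract[OF ac(1)] deg_le_to_fract
    using degree_mod_less[OF ac(1), of a] by auto
  then have \<epsilon>: "\<epsilon> \<in> deg_le ?N" by (rule deg_le_mono) (use nonneg in simp)
  have iff: "to_fract r / to_fract q + \<rho> \<in> deg_le m \<longleftrightarrow> r + h \<in> polys_below (nat (?N + 1))" for r
  proof -
    have "to_fract r / to_fract q + \<rho> = (to_fract (r + h) + \<epsilon>) / to_fract q"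
      using q split by (simp add: field_simps)
    then have "to_fract r / to_fract q + \<rho> \<in> deg_le m \<longleftrightarrow> to_fract (r + h) + \<epsilon> \<in> deg_le ?N"
      by (simp only: deg_le_divide_to_fract[OF q])
    also have "\<dots> \<longleftrightarrow> to_fract (r + h) \<in> deg_le ?N"
      using deg_le_add[OF _ \<epsilon>, of "to_fract (r + h)"] deg_le_diff[OF _ \<epsilon>, of "to_fract (r + h) + \<epsilon>"] by auto
    also have "\<dots> \<longleftrightarrow> r + h \<in> polys_below (nat (?N + 1))"
      unfolding deg_le_to_fract polys_below_iff by auto
    finally show ?thesis .
  qed
  have bij: "bij_betw (\<lambda>r. r + h) {r. to_fract r / to_fract q + \<rho> \<in> deg_le m} (polys_below (nat (?N + 1)))"
    by (rule bij_betwI[where g = "\<lambda>r. r - h"]) (auto simp: iff)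
  then show "finite {r. to_fract r / to_fract q + \<rho> \<in> deg_le m}"
    using finite_polys_below bij_betw_finite by blast
  show "card {r. to_fract r / to_fract q + \<rho> \<in> deg_le m} = CARD('a) ^ nat (m + int (degree q) + 1)"
    using bij_betw_same_card[OF bij] card_polys_below by simp
qed

text \<open>
  The coefficient \<open>r2\<close> is bounded through the coefficient of \<open>y\<^sup>2\<close>; once it is chosen, the coefficient
  of \<open>y\<close> confines \<open>r1\<close> to a translate of a set of bounded polynomials, and then the constant
  coefficient confines \<open>r0\<close>. The hypothesis on \<open>n\<close> keeps all three degree bounds nonnegative.
\<close>

lemma card_integers_bounded:
  assumes tri: "triangular_basis d0 d1 d2 u1 u2 u3" and n: "degree A \<le> n"
  shows "card (integers \<inter> G (2 * int n)) =
    CARD('a) ^ nat (3 * int n + 3 - d - (d + 1) div 2 + int (degree d0 + degree d1 + degree d2))"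
proof -
  have d0: "d0 \<noteq> 0" "d1 \<noteq> 0" "d2 \<noteq> 0"
    and integers_eq: "integers = {j r0 * elt (1 / to_fract d0) 0 0 + j r1 * elt u1 (1 / to_fract d1) 0 +
       j r2 * elt u3 u2 (1 / to_fract d2) | r0 r1 r2. True}"
    using tri by (auto simp: triangular_basis_def)
  define m1 where "m1 = int n - (d + 1) div 2"
  define m2 where "m2 = int n - d"
  have hdeg: "hdeg (2 * int n) = deg_le (int n)" "hdeg (2 * int n - d) = deg_le m1"
    "hdeg (2 * int n - 2 * d) = deg_le m2"
  proof -
    have "(2 * int n - d) div 2 = m1" by (simp add: m1_def)
    moreover have "(2 * int n - 2 * d) div 2 = m2" by (simp add: m2_def)
    ultimately show "hdeg (2 * int n) = deg_le (int n)" "hdeg (2 * int n - d) = deg_le m1"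
      "hdeg (2 * int n - 2 * d) = deg_le m2" by (simp_all add: hdeg_def)
  qed
  have m: "0 \<le> m1" "0 \<le> m2" using n by (auto simp: m1_def m2_def)
  define R2 where "R2 = {r2. to_fract r2 / to_fract d2 + 0 \<in> deg_le m2}"
  define R1 where "R1 r2 = {r1. to_fract r1 / to_fract d1 + to_fract r2 * u2 \<in> deg_le m1}" for r2
  define R0 where "R0 r2 r1 = {r0. to_fract r0 / to_fract d0 + (to_fract r1 * u1 + to_fract r2 * u3) \<in> deg_le (int n)}" for r2 r1
  define N0 N1 N2 where "N0 = nat (int n + int (degree d0) + 1)"
    and "N1 = nat (m1 + int (degree d1) + 1)" and "N2 = nat (m2 + int (degree d2) + 1)"
  have fin: "finite R2" "finite (R1 r2)" "finite (R0 r2 r1)" for r1 r2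
    unfolding R2_def R1_def R0_def by (rule card_bounded_coset(1); use d0 m in simp)+
  have card: "card R2 = CARD('a) ^ N2" "card (R1 r2) = CARD('a) ^ N1" "card (R0 r2 r1) = CARD('a) ^ N0" for r1 r2
    unfolding R2_def R1_def R0_def N0_def N1_def N2_def using d0 m
    by (intro card_bounded_coset(2); simp)+
  let ?S = "SIGMA r2:R2. SIGMA r1:R1 r2. R0 r2 r1"
  let ?f = "\<lambda>(r2, r1, r0). elt (to_fract r0 / to_fract d0 + (to_fract r1 * u1 + to_fract r2 * u3))
       (to_fract r1 / to_fract d1 + to_fract r2 * u2) (to_fract r2 / to_fract d2)"
  have bounded_iff: "?f (r2, r1, r0) \<in> G (2 * int n) \<longleftrightarrow> (r2, r1, r0) \<in> ?S" for r2 r1 r0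
    by (auto simp: elt_in_G hdeg R2_def R1_def R0_def)
  have integers_f: "integers = {?f (r2, r1, r0) | r0 r1 r2. True}"
    unfolding integers_eq triangular_combination by simp
  have "integers \<inter> G (2 * int n) = ?f ` ?S"
  proof (intro equalityI subsetI)
    fix z assume z: "z \<in> integers \<inter> G (2 * int n)"
    then obtain r0 r1 r2 where "z = ?f (r2, r1, r0)" unfolding integers_f by blast
    then show "z \<in> ?f ` ?S" using z bounded_iff[of r2 r1 r0] by blast
  next
    fix z assume "z \<in> ?f ` ?S"
    then obtain r2 r1 r0 where r: "(r2, r1, r0) \<in> ?S" "z = ?f (r2, r1, r0)" by blast
    then have "z \<in> integers" unfolding integers_f by blast
    then show "z \<in> integers \<inter> G (2 * int n)" using r bounded_iff[of r2 r1 r0] by blast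
  qed
  moreover have "inj_on ?f ?S"
    using d0 by (intro inj_onI) (auto simp: elt_inject)
  ultimately have "card (integers \<inter> G (2 * int n)) = card ?S"
    by (simp add: card_image)
  also have "\<dots> = (\<Sum>r2\<in>R2. \<Sum>r1\<in>R1 r2. card (R0 r2 r1))"
    using fin by (simp add: card_SigmaI)
  also have "\<dots> = CARD('a) ^ N2 * (CARD('a) ^ N1 * CARD('a) ^ N0)"
    by (simp add: card)
  also have "\<dots> = CARD('a) ^ (N2 + (N1 + N0))"
    by (simp only: power_add)
  also have "N2 + (N1 + N0) =
      nat (3 * int n + 3 - d - (d + 1) div 2 + int (degree d0 + degree d1 + degree d2))"
    using m by (simp add: N0_def N1_def N2_def m1_def m2_def)
  finally show ?thesis .
qed

theorem genus_eq:
  assumes "is_index \<iota> F y I"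
  shows "genus const F = d + (d + 1) div 2 - 2 - int (degree I)"
proof -
  obtain b :: "'b ^ 3" where "is_integral_basis \<iota> F b"
    using assms by (auto simp: is_index_def)
  then obtain d0 d1 d2 u1 u2 u3 where tri: "triangular_basis d0 d1 d2 u1 u2 u3"
    using triangular_basis_exists by blast
  note deg = degree_index[OF tri assms]
  show ?thesis
  proof (rule ff.genus_eqI[OF x_in_F x_nonzero degree_over_inverse_x degree_over_poly])
    show "ff.ev x p \<noteq> 0" if "p \<noteq> 0" for p using that by (simp add: ev_x)
    show "\<exists>p. p \<noteq> 0 \<and> 0 < v (ff.ev x p)" if "v \<in> ff.pl" "0 \<le> v x" for v
      using finite_place_polynomial[OF that] .
    show "card (ff.Lsp (ff.pole_multiple x n)) =
        CARD('a) ^ nat (3 * int n + 3 - d - (d + 1) div 2 + int (degree I))" if "degree A \<le> n" for n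
      unfolding Lsp_pole_multiple deg using tri that by (rule card_integers_bounded)
    show "int (nat (3 * int n + 3 - d - (d + 1) div 2 + int (degree I))) =
        int (3 * n) + 1 - (d + (d + 1) div 2 - 2 - int (degree I))" if "degree A \<le> n" for n
    proof -
      have "0 \<le> 3 * int n + 3 - d - (d + 1) div 2" using that by linarith
      then show ?thesis by simp
    qed
  qed
qed

end


section \<open>The genus formula\<close>

text \<open>
  Translation by \<open>1\<close> permutes the field, so summing all its elements gives \<open>CARD('a) = 0\<close> in it.
\<close>

lemma three_eq_0_if_card_power:
  assumes "CARD('a::{finite, field}) = 3 ^ n"
  shows "(3 :: 'a) = 0"
proof -
  have "(\<Sum>a\<in>UNIV. a) = (\<Sum>a\<in>UNIV. a + (1 :: 'a))"
    by (rule sum.reindex_bij_witness[of _ "\<lambda>a. a + 1" "\<lambda>a. a - 1"]) auto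
  also have "\<dots> = (\<Sum>a\<in>UNIV. a) + of_nat CARD('a)"
    by (simp add: sum.distrib)
  finally have "(of_nat CARD('a) :: 'a) = 0" by simp
  then have "(3 :: 'a) ^ n = 0" unfolding assms by simp
  then show ?thesis by simp
qed

theorem theorem5p3:
  fixes A B I :: "'a::{finite, field} poly"
    and \<iota> :: "'a poly fract \<Rightarrow> 'l::field"
    and y :: 'l
    and F :: "'l set"
    and n :: nat
  assumes "CARD('a) = 3 ^ n"
    and "A \<noteq> 0"
    and "absolutely_irreducible (cubic A B)"
    and "field_embedding \<iota>"
    and "poly (map_poly (\<lambda>a. \<iota> (to_fract a)) (cubic A B)) y = 0"
    and "F = adjoin \<iota> y"
    and "standard_form A B"
    and "is_index \<iota> F y I"
    and "tame_or_unramified_at_infinity \<iota> F"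
  shows "of_int (genus (\<iota> \<circ> rat_const) F) =
    (3 * of_nat (degree A) - 2 * of_nat (degree I)
      + (if even (degree A) then 0 else 1) - 4) / (2 :: rat)"
proof -
  interpret emb: embedding \<iota> by unfold_locales fact
  have root: "y ^ 3 = \<iota> (to_fract A) * y - \<iota> (to_fract B)"
    using assms(5) by (simp add: cubic_def map_poly_pCons power3_eq_cube algebra_simps)
  interpret C: cubic_extension \<iota> A B y
    by unfold_locales (rule root, rule no_root_if_absolutely_irreducible[OF assms(3)])
  have F: "F = C.F" using assms(6) C.adjoin_eq_F by simp
  have "2 * degree B \<le> 3 * degree A"
    using C.degrees_if_tame assms(2,7,9) unfolding F by blast
  then interpret C: balanced_cubic \<iota> A B y
    using three_eq_0_if_card_power[OF assms(1)] assms(2) by unfold_locales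
  have "genus C.const C.F = int (degree A) + (int (degree A) + 1) div 2 - 2 - int (degree I)"
    using C.genus_eq assms(8) unfolding F by blast
  then have genus: "genus (\<iota> \<circ> rat_const) F = int (degree A) + (int (degree A) + 1) div 2 - 2 - int (degree I)"
    by (simp only: F C.const_def)
  show ?thesis
  proof (cases "even (degree A)")
    case True
    then obtain k where "degree A = 2 * k" by (elim evenE)
    then show ?thesis by (simp add: genus)
  next
    case False
    then obtain k where "degree A = 2 * k + 1" by (elim oddE)
    then show ?thesis by (simp add: genus)
  qed
qed

end
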